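(* Fix $1<p<\infty$. There are constants $c_p,C_p>0$ depending only on $p$ such that the following holds for all integers $d,L\ge2$, with $n=L^d$ and $G=[L]^d$ the nearest-neighbor box. Put $$U_p(d,L)=\begin{cases} n\,d^{1/(p-1)}L^{p/(p-1)},&1<p<2,\\ n\,d\,L^2,&p\ge2.\end{cases}$$ Then $$\sup_{f_0\in[-1,1]^{[L]^d}}\mathbb{E}\,\tau_p(1/2;f_0)\ \ge\ c_p\begin{cases}U_p(d,L)/\log(en),&p\neq2,\\ U_2(d,L),&p=2.\end{cases}$$ Consequently, at tolerance $1/2$, the upper bound $U_p(d,L)\log(2n)$ and the lower bound $$\mathrm{Low}_p(d,L)=n\begin{cases}\max\{d^{1/(p-1)-1}L^{p/(p-1)},\,d\log L\},&1<p<2,\\ dL^2,&p=2,\\ \max\{d\log L,\,L^2\},&p>2,\end{cases}$$ which bound $\sup_{f_0\in[-1,1]^{[L]^d}}\mathbb{E}\,\tau_p(1/2;f_0)$ from above and below up to constants depending only on $p$, satisfy $$\frac{U_p(d,L)\log(2n)}{\mathrm{Low}_p(d,L)}\le C_p\begin{cases}(\log n)^2,&p\ne2,\\ \log n,&p=2.\end{cases}$$ Moreover, the term $n\,d^{1/(p-1)-1}L^{p/(p-1)}$ (for $1<p<2$), respectively $nL^2$ (for $p>2$), of $\mathrm{Low}_p(d,L)$ equals $U_p(d,L)/d$.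
   Context: The box: $[L]^d=\{0,\ldots,L-1\}^d$ is the vertex set of a graph in which two vertices are adjacent iff they differ by $\pm e_i$ for some standard basis vector $e_i$ (nearest-neighbor edges). Dynamics on a finite connected simple graph $G=(V,E)$ with $n=|V|\ge2$ and $1<p<\infty$: a profile is a function $f:V\to\mathbb{R}$. For a nonempty vector $y=(y_1,\dots,y_k)$ let $m_p(y)$ be the unique minimizer over $x\in\mathbb{R}$ of $\sum_{i=1}^k|x-y_i|^p$. For $u\in V$, $f^{\#u}$ is the profile equal to $m_p((f(v))_{v\sim u})$ at $u$ and equal to $f$ at every other vertex. Let $U_1,U_2,\ldots$ be independent uniformly distributed vertices of $V$; starting from a deterministic profile $f_0$ set $f_t=f_{t-1}^{\#U_t}$ for $t\ge1$. Let $\operatorname{osc}(f)=\max_V f-\min_V f$ and $\tau_p(\epsilon;f_0)=\min\{t\ge0:\operatorname{osc}(f_t)\le\epsilon\}$ (equal to $\infty$ if the set is empty). $\mathbb{E}$ is expectation over $(U_t)$. Logarithms are natural. *)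

theory Defs
  imports "HOL-Probability.Probability"
begin

definition box_verts :: "nat \<Rightarrow> nat \<Rightarrow> (nat \<Rightarrow> nat) set" where
  "box_verts d L = {..<d} \<rightarrow>\<^sub>E {..<L}"

text \<open>Two vertices are adjacent iff \<open>v = u + e\<^sub>i\<close> or \<open>u = v + e\<^sub>i\<close> for some \<open>i < d\<close>.\<close>

definition box_adj :: "nat \<Rightarrow> nat \<Rightarrow> (nat \<Rightarrow> nat) \<Rightarrow> (nat \<Rightarrow> nat) \<Rightarrow> bool" where
  "box_adj d L u v \<longleftrightarrow> u \<in> box_verts d L \<and> v \<in> box_verts d L \<and>
     (\<exists>i<d. v = u(i := u i + 1) \<or> u = v(i := v i + 1))"

text \<open>A graph is given by its vertex set \<open>V\<close> and its adjacency relation \<open>adj\<close>; a profile is an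
  element of \<open>V \<rightarrow>\<^sub>E UNIV\<close>.  The vector \<open>y\<close> below is indexed by a finite nonempty set \<open>I\<close>;
  for \<open>p > 1\<close> the minimizer exists and is unique.\<close>

definition p_mean :: "real \<Rightarrow> 'i set \<Rightarrow> ('i \<Rightarrow> real) \<Rightarrow> real" where
  "p_mean p I y = (THE x. is_arg_min (\<lambda>x. \<Sum>i\<in>I. \<bar>x - y i\<bar> powr p) (\<lambda>_. True) x)"

definition update :: "real \<Rightarrow> 'a set \<Rightarrow> ('a \<Rightarrow> 'a \<Rightarrow> bool) \<Rightarrow> ('a \<Rightarrow> real) \<Rightarrow> 'a \<Rightarrow> 'a \<Rightarrow> real" where
  "update p V adj f u = f(u := p_mean p {v \<in> V. adj u v} f)"

text \<open>The update sequence \<open>U\<^sub>1, U\<^sub>2, \<dots>\<close> is \<open>\<omega> 0, \<omega> 1, \<dots>\<close>, i.e. the vertex \<open>U\<^sub>t\<close> is \<open>\<omega> (t - 1)\<close>.\<close>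

primrec profile_at ::
  "real \<Rightarrow> 'a set \<Rightarrow> ('a \<Rightarrow> 'a \<Rightarrow> bool) \<Rightarrow> ('a \<Rightarrow> real) \<Rightarrow> (nat \<Rightarrow> 'a) \<Rightarrow> nat \<Rightarrow> 'a \<Rightarrow> real" where
  "profile_at p V adj f0 \<omega> 0 = f0"
| "profile_at p V adj f0 \<omega> (Suc t) = update p V adj (profile_at p V adj f0 \<omega> t) (\<omega> t)"

definition osc :: "'a set \<Rightarrow> ('a \<Rightarrow> real) \<Rightarrow> real" where
  "osc V f = Max (f ` V) - Min (f ` V)"

definition hit_time ::
  "real \<Rightarrow> 'a set \<Rightarrow> ('a \<Rightarrow> 'a \<Rightarrow> bool) \<Rightarrow> real \<Rightarrow> ('a \<Rightarrow> real) \<Rightarrow> (nat \<Rightarrow> 'a) \<Rightarrow> ennreal" where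
  "hit_time p V adj \<epsilon> f0 \<omega> =
     (if \<exists>t. osc V (profile_at p V adj f0 \<omega> t) \<le> \<epsilon>
      then of_nat (LEAST t. osc V (profile_at p V adj f0 \<omega> t) \<le> \<epsilon>) else \<infinity>)"

text \<open>The law of a sequence of independent uniform vertices.  Every subset of the finite set \<open>V\<close> is
  measurable, hence so is \<open>hit_time\<close>, and the integral below is an honest expectation with values
  in \<open>[0, \<infinity>]\<close>.\<close>

definition update_space :: "'a set \<Rightarrow> (nat \<Rightarrow> 'a) measure" where
  "update_space V = (\<Pi>\<^sub>M t\<in>UNIV. uniform_count_measure V)"

definition expected_time ::
  "real \<Rightarrow> 'a set \<Rightarrow> ('a \<Rightarrow> 'a \<Rightarrow> bool) \<Rightarrow> real \<Rightarrow> ('a \<Rightarrow> real) \<Rightarrow> ennreal" where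
  "expected_time p V adj \<epsilon> f0 = (\<integral>\<^sup>+ \<omega>. hit_time p V adj \<epsilon> f0 \<omega> \<partial>update_space V)"

definition worst_expected_time :: "real \<Rightarrow> real \<Rightarrow> nat \<Rightarrow> nat \<Rightarrow> ennreal" where
  "worst_expected_time p \<epsilon> d L =
     (SUP f0 \<in> box_verts d L \<rightarrow>\<^sub>E {-1..1}. expected_time p (box_verts d L) (box_adj d L) \<epsilon> f0)"

text \<open>In both definitions the factor \<open>real (L ^ d)\<close> is the number \<open>n\<close> of vertices.\<close>

definition U_bound :: "real \<Rightarrow> nat \<Rightarrow> nat \<Rightarrow> real" where
  "U_bound p d L =
     (if p < 2 then real (L ^ d) * real d powr (1 / (p - 1)) * real L powr (p / (p - 1))
      else real (L ^ d) * real d * real L ^ 2)"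

definition Low_bound :: "real \<Rightarrow> nat \<Rightarrow> nat \<Rightarrow> real" where
  "Low_bound p d L = real (L ^ d) *
     (if p < 2 then max (real d powr (1 / (p - 1) - 1) * real L powr (p / (p - 1)))
                        (real d * ln (real L))
      else if p = 2 then real d * real L ^ 2
      else max (real d * ln (real L)) (real L ^ 2))"

end

theory Submission
  imports Defs
begin

text \<open>
  Write \<open>\<phi> x = sgn x \<cdot> \<bar>x\<bar> powr (p - 1)\<close>. The p-mean of \<open>y\<close> is the root of the increasing function
  \<open>x \<mapsto> \<Sum> \<phi> (x - y i)\<close>. Therefore it is monotone in \<open>y\<close>, commutes with adding constants and is nonexpansive for the
  supremum norm; moreover it minimizes the local energy at the updated vertex. The upper bound uses the latter property,
  the lower bounds the former ones.

  \<^bold>\<open>Upper bound.\<close> Let the energy of \<open>f\<close> be the sum of \<open>\<bar>f u - f v\<bar> powr p\<close> over adjacent pairs. An update at \<open>u\<close>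
  decreases it at least as much as the move of \<open>f u\<close> a little way towards a constant \<open>m\<close>. Summed over \<open>u\<close>, the
  first-order gain of these moves is a multiple of the energy (\<open>sum_by_parts\<close>), and the remainders are controlled by a
  Poincare inequality for \<open>f - m\<close>. On the box that inequality holds with a constant of order \<open>L powr p\<close> for
  \<open>p \<le> 2\<close>, without any dependence on \<open>d\<close> (\<open>box_Poincare\<close>); for \<open>p \<ge> 2\<close> it follows from the quadratic case by a change of
  variables (\<open>Poincare_ge2\<close>). Optimizing the size of the moves shows that each random update contracts the mean energy by
  a factor \<open>1 - c / U\<close>, where \<open>U = U_bound p d L\<close> and \<open>c\<close> depends on \<open>p\<close> only. The energy
  starts below a power of \<open>n\<close> and stays above an inverse power of \<open>n\<close> as long as the oscillation exceeds \<open>1/2\<close>, whence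
  the factor \<open>ln (2 n)\<close>.

  \<^bold>\<open>Lower bounds.\<close> If a single update changes the initial profile by at most \<open>\<eta>\<close>, then the displacement of a vertex is at
  most \<open>\<eta>\<close> times the length of a chain of updates of successive neighbours that ends in it, and within \<open>t\<close>
  steps such chains have mean length at most of order \<open>d t / n\<close> (\<open>mean_displacement_le\<close>). Hence a profile with oscillation \<open>2\<close> needs a
  time of order \<open>n / (d \<eta>)\<close>. For \<open>p = 2\<close> the dynamics is linear in mean and the time is of order \<open>n / \<eta>\<close>. A cosine
  averaged over all coordinates has \<open>\<eta>\<close> of order \<open>1 / (d L\<^sup>2)\<close> (\<open>worst_ge_wave\<close>); a profile in one coordinate
  with a prescribed flux has \<open>\<eta>\<close> of order \<open>(d L powr p) powr (- 1 / (p - 1))\<close> (\<open>worst_ge_flux\<close>). The term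
  \<open>n d ln L = n ln n\<close> comes from a two-coloured profile: until all vertices of one colour have been updated, both extreme
  values are present, and this takes as long as collecting coupons (\<open>sojourn_two_colours\<close>).

  \<^bold>\<open>Comparison.\<close> One has \<open>Low_bound p d L \<ge> U / d\<close>, with equality of \<open>Low_bound\<close> and \<open>U_bound\<close> at \<open>p = 2\<close>, and
  \<open>d \<le> 2 ln n\<close> because \<open>n = L ^ d\<close>. So the factor \<open>d\<close> between the bounds costs at most one logarithm, and the lower
  bound \<open>U / ln (e n)\<close> as well as the ratio of the bounds are consequences of the bounds themselves.
\<close>

section \<open>Signed powers\<close>

text \<open>For \<open>s = p - 1\<close> and up to the factor \<open>p\<close> this is the derivative of \<open>\<bar>x\<bar> powr p\<close>; the exponent \<open>p / 2\<close> occurs as a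
change of variables in the Poincare inequality for \<open>p \<ge> 2\<close>.\<close>

definition spow :: "real \<Rightarrow> real \<Rightarrow> real" where
  "spow s x = sgn x * \<bar>x\<bar> powr s"

lemma spow_0 [simp]: "spow s 0 = 0"
  by (simp add: spow_def)

lemma spow_minus [simp]: "spow s (- x) = - spow s x"
  by (simp add: spow_def sgn_minus)

lemma spow_nonneg: "0 \<le> x \<Longrightarrow> spow s x = x powr s"
  by (cases "x = 0") (auto simp: spow_def)

lemma spow_nonneg_iff [simp]: "0 \<le> spow s x \<longleftrightarrow> 0 \<le> x"
  by (auto simp: spow_def sgn_if zero_le_mult_iff)

lemma abs_spow: "\<bar>spow s x\<bar> = \<bar>x\<bar> powr s"
  by (auto simp: spow_def abs_mult sgn_if)

lemma spow_one [simp]: "spow 1 x = x"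
  by (simp add: spow_def sgn_mult_abs)

lemma spow_times_self: "spow (p - 1) x * x = \<bar>x\<bar> powr p"
proof -
  have "spow (p - 1) x * x = \<bar>x\<bar> * \<bar>x\<bar> powr (p - 1)"
    by (simp add: spow_def sgn_if)
  also have "\<dots> = \<bar>x\<bar> powr (1 + (p - 1))"
    by (rule powr_mult_base) simp
  finally show ?thesis by simp
qed

lemma spow_strict_mono:
  assumes "0 < s" "x < y" shows "spow s x < spow s y"
proof -
  consider "0 \<le> x" | "x < 0" "0 < y" | "x < 0" "y \<le> 0" by linarith
  then show ?thesis
  proof cases
    case 1 then show ?thesis using assms by (simp add: spow_nonneg powr_less_mono2)
  next
    case 2
    then have "0 < y powr s" "0 < (- x) powr s" by auto
    moreover have "spow s x = - ((- x) powr s)" "spow s y = y powr s"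
      using 2 by (simp_all add: spow_def)
    ultimately show ?thesis by linarith
  next
    case 3
    then have "(- y) powr s < (- x) powr s" using assms by (intro powr_less_mono2) auto
    then show ?thesis using 3 assms by (simp add: spow_def sgn_if)
  qed
qed

lemma spow_mono: "0 < s \<Longrightarrow> x \<le> y \<Longrightarrow> spow s x \<le> spow s y"
  using spow_strict_mono[of s x y] by (cases "x = y") auto

lemma powr_subadditive:
  fixes a b s :: real
  assumes "0 \<le> a" "0 \<le> b" "0 < s" "s \<le> 1"
  shows "(a + b) powr s \<le> a powr s + b powr s"
proof (cases "a + b = 0")
  case False
  then have pos: "0 < a + b" using assms by linarith
  have "a / (a + b) \<le> (a / (a + b)) powr s" "b / (a + b) \<le> (b / (a + b)) powr s"
    using powr_mono'[of s 1 "a / (a + b)"] powr_mono'[of s 1 "b / (a + b)"] assms pos by auto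
  then have "a / (a + b) + b / (a + b) \<le> (a powr s + b powr s) / (a + b) powr s"
    by (simp add: powr_divide add_divide_distrib)
  moreover have "a / (a + b) + b / (a + b) = 1"
    using pos by (simp flip: add_divide_distrib)
  ultimately show ?thesis using pos by (simp add: field_simps)
qed (use assms in auto)

lemma spow_Hoelder:
  assumes "0 < s" "s \<le> 1"
  shows "\<bar>spow s a - spow s b\<bar> \<le> 2 * \<bar>a - b\<bar> powr s"
proof -
  have *: "\<bar>spow s a - spow s b\<bar> \<le> 2 * \<bar>a - b\<bar> powr s" if "b \<le> a" for a b
  proof -
    consider "0 \<le> b" | "b < 0" "0 < a" | "a \<le> 0" by linarith
    then show ?thesis
    proof cases
      case 1
      then have "a powr s \<le> (a - b) powr s + b powr s"
        using powr_subadditive[of "a - b" b s] assms that by simp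
      moreover have "b powr s \<le> a powr s" using that 1 assms by (intro powr_mono2) auto
      moreover have "0 \<le> (a - b) powr s" by simp
      ultimately have "a powr s - b powr s \<le> 2 * (a - b) powr s" "b powr s \<le> a powr s" by linarith+
      then show ?thesis using 1 that by (simp add: spow_nonneg abs_of_nonneg)
    next
      case 2
      have "a powr s \<le> (a - b) powr s" "(- b) powr s \<le> (a - b) powr s"
        using 2 assms by (intro powr_mono2; simp)+
      moreover have "0 \<le> a powr s" "0 \<le> (- b) powr s" by simp_all
      ultimately show ?thesis using 2 that by (simp add: spow_def)
    next
      case 3
      then have "(- b) powr s \<le> (a - b) powr s + (- a) powr s"
        using powr_subadditive[of "a - b" "- a" s] assms that by simp
      moreover have "(- a) powr s \<le> (- b) powr s" using that 3 assms by (intro powr_mono2) auto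
      moreover have "spow s a = - ((- a) powr s)" "spow s b = - ((- b) powr s)"
        using 3 that spow_nonneg[of "- a" s] spow_nonneg[of "- b" s] by auto
      moreover have "0 \<le> (a - b) powr s" by simp
      moreover have "\<bar>a - b\<bar> = a - b" using that by simp
      ultimately show ?thesis by (simp only:)
    qed
  qed
  show ?thesis
  proof (cases "b \<le> a")
    case False
    then show ?thesis using *[of a b] by (simp add: abs_minus_commute)
  qed (rule *)
qed

text \<open>The graph of the convex function \<open>\<bar>x\<bar> powr p\<close> lies above its tangents. After expansion the claim reads
\<open>p \<cdot> spow (p - 1) a \<cdot> b \<le> \<bar>b\<bar> powr p + (p - 1) \<cdot> \<bar>a\<bar> powr p\<close>, which is Young's inequality; this avoids
differentiating at \<open>0\<close>.\<close>

lemma powr_tangent: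
  fixes a b p :: real
  assumes "1 < p"
  shows "p * spow (p - 1) a * (b - a) \<le> \<bar>b\<bar> powr p - \<bar>a\<bar> powr p"
proof -
  let ?q = "p / (p - 1)"
  have "spow (p - 1) a * b \<le> \<bar>b\<bar> * \<bar>a\<bar> powr (p - 1)"
    by (rule order.trans[OF abs_ge_self]) (simp add: abs_mult abs_spow)
  also have "\<dots> \<le> \<bar>b\<bar> powr p / p + (\<bar>a\<bar> powr (p - 1)) powr ?q / ?q"
    using assms by (intro Youngs_inequality) (auto simp: field_simps)
  also have "(\<bar>a\<bar> powr (p - 1)) powr ?q = \<bar>a\<bar> powr p"
    using assms by (simp add: powr_powr)
  finally have "p * (spow (p - 1) a * b) \<le> p * (\<bar>b\<bar> powr p / p + \<bar>a\<bar> powr p / ?q)"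
    using assms by (intro mult_left_mono) auto
  also have "\<dots> = \<bar>b\<bar> powr p + (p - 1) * \<bar>a\<bar> powr p"
    using assms by (simp add: field_simps)
  finally have "p * (spow (p - 1) a * b) \<le> \<bar>b\<bar> powr p + (p - 1) * \<bar>a\<bar> powr p" .
  moreover have "p * spow (p - 1) a * (b - a) = p * (spow (p - 1) a * b) - p * \<bar>a\<bar> powr p"
    unfolding spow_times_self[symmetric] by (simp only: right_diff_distrib mult.assoc)
  moreover have "(p - 1) * \<bar>a\<bar> powr p = p * \<bar>a\<bar> powr p - \<bar>a\<bar> powr p"
    by (simp add: algebra_simps)
  ultimately show ?thesis by linarith
qed

text \<open>If both arguments have the same sign, this is again the tangent inequality, now for the exponent \<open>s\<close>; if
the signs differ, the two summands are compared with the larger argument separately.\<close>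

lemma spow_Lipschitz:
  assumes "1 \<le> s"
  shows "\<bar>spow s a - spow s b\<bar> \<le> s * \<bar>a - b\<bar> * max \<bar>a\<bar> \<bar>b\<bar> powr (s - 1)"
proof -
  have *: "\<bar>spow s a - spow s b\<bar> \<le> s * \<bar>a - b\<bar> * max \<bar>a\<bar> \<bar>b\<bar> powr (s - 1)" if "\<bar>b\<bar> \<le> \<bar>a\<bar>" "0 < a" for a b
  proof (cases "0 \<le> b")
    case True
    have "s * spow (s - 1) a * (b - a) \<le> b powr s - a powr s"
    proof (cases "s = 1")
      case True then show ?thesis using that \<open>0 \<le> b\<close> by (simp add: spow_def)
    next
      case False then show ?thesis using powr_tangent[of s a b] assms that True by simp
    qed
    moreover have "b powr s \<le> a powr s" using that True assms by (intro powr_mono2) auto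
    ultimately show ?thesis using that True
      by (simp add: spow_nonneg max_def algebra_simps)
  next
    case False
    have "spow s b = - ((- b) powr s)" using spow_nonneg[of "- b" s] False by auto
    then have "\<bar>spow s a - spow s b\<bar> = a powr s + (- b) powr s"
      using that by (simp add: spow_nonneg)
    also have "\<dots> = a * a powr (s - 1) + (- b) * (- b) powr (s - 1)"
      using that False powr_mult_base[of a "s - 1"] powr_mult_base[of "- b" "s - 1"] by simp
    also have "\<dots> \<le> a * a powr (s - 1) + (- b) * a powr (s - 1)"
      using that False assms by (intro add_left_mono mult_left_mono powr_mono2) auto
    also have "\<dots> = 1 * ((a - b) * a powr (s - 1))" by (simp add: algebra_simps)
    also have "\<dots> \<le> s * ((a - b) * a powr (s - 1))"
      using assms that by (intro mult_right_mono) auto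
    finally show ?thesis using that False by (simp add: max_def mult.assoc)
  qed
  have **: "\<bar>spow s a - spow s b\<bar> \<le> s * \<bar>a - b\<bar> * max \<bar>a\<bar> \<bar>b\<bar> powr (s - 1)" if "\<bar>b\<bar> \<le> \<bar>a\<bar>" for a b
  proof -
    consider "a = 0" | "0 < a" | "a < 0" by linarith
    then show ?thesis
    proof cases
      case 1 then show ?thesis using that by simp
    next
      case 3
      then show ?thesis using *[of "- b" "- a"] that
        by (simp add: abs_minus_commute)
    qed (use * that in auto)
  qed
  show ?thesis
  proof (cases "\<bar>b\<bar> \<le> \<bar>a\<bar>")
    case False
    then show ?thesis using **[of a b] by (simp add: abs_minus_commute max.commute)
  qed (rule **)
qed

text \<open>The remainder of the first-order expansion comes from convexity alone: the tangent at \<open>y - h\<close> bounds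
\<open>\<bar>y - h\<bar> powr p\<close> from above, and its slope differs from the one at \<open>y\<close> by an increment of \<open>spow (p - 1)\<close>. The
two lemmas after it insert the modulus of continuity of \<open>spow (p - 1)\<close>, which is of Hoelder type for \<open>p \<le> 2\<close> and
Lipschitz on bounded sets for \<open>p \<ge> 2\<close>.\<close>

lemma powr_Taylor:
  assumes "1 < p"
  shows "\<bar>y - h\<bar> powr p \<le> \<bar>y\<bar> powr p - p * spow (p - 1) y * h
           + p * \<bar>h\<bar> * \<bar>spow (p - 1) y - spow (p - 1) (y - h)\<bar>"
proof -
  have "\<bar>y - h\<bar> powr p \<le> \<bar>y\<bar> powr p - p * spow (p - 1) (y - h) * h"
    using powr_tangent[OF assms, of "y - h" y] by (simp add: algebra_simps)
  also have "\<dots> = \<bar>y\<bar> powr p - p * spow (p - 1) y * h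
      + p * (h * (spow (p - 1) y - spow (p - 1) (y - h)))"
    by (simp add: algebra_simps)
  also have "\<dots> \<le> \<bar>y\<bar> powr p - p * spow (p - 1) y * h
      + p * \<bar>h * (spow (p - 1) y - spow (p - 1) (y - h))\<bar>"
    using assms by (intro add_left_mono mult_left_mono) auto
  finally show ?thesis by (simp add: abs_mult mult.assoc)
qed

lemma powr_Taylor_le2:
  assumes "1 < p" "p \<le> 2"
  shows "\<bar>y - h\<bar> powr p \<le> \<bar>y\<bar> powr p - p * spow (p - 1) y * h + 2 * p * \<bar>h\<bar> powr p"
proof -
  have "p * \<bar>h\<bar> * \<bar>spow (p - 1) y - spow (p - 1) (y - h)\<bar>
      \<le> p * \<bar>h\<bar> * (2 * \<bar>y - (y - h)\<bar> powr (p - 1))"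
    using assms by (intro mult_left_mono spow_Hoelder) auto
  also have "\<dots> = 2 * p * (\<bar>h\<bar> * \<bar>h\<bar> powr (p - 1))" by simp
  also have "\<bar>h\<bar> * \<bar>h\<bar> powr (p - 1) = \<bar>h\<bar> powr p" by (simp add: powr_mult_base)
  finally show ?thesis using powr_Taylor[OF assms(1), of y h] by linarith
qed

lemma powr_add_le:
  fixes a b s :: real
  assumes "0 \<le> a" "0 \<le> b" "0 \<le> s"
  shows "(a + b) powr s \<le> 2 powr s * (a powr s + b powr s)"
proof -
  have "(a + b) powr s \<le> (2 * max a b) powr s"
    using assms by (intro powr_mono2) auto
  also have "\<dots> = 2 powr s * max a b powr s" by (simp add: powr_mult)
  also have "\<dots> \<le> 2 powr s * (a powr s + b powr s)"
    by (intro mult_left_mono) (auto simp: max_def)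
  finally show ?thesis .
qed

lemma powr_Taylor_ge2:
  assumes "2 \<le> p"
  shows "\<bar>y - h\<bar> powr p \<le> \<bar>y\<bar> powr p - p * spow (p - 1) y * h
           + p * (p - 1) * 2 powr (p - 2) * (h\<^sup>2 * \<bar>y\<bar> powr (p - 2) + \<bar>h\<bar> powr p)"
proof -
  have "\<bar>spow (p - 1) y - spow (p - 1) (y - h)\<bar>
      \<le> (p - 1) * \<bar>y - (y - h)\<bar> * max \<bar>y\<bar> \<bar>y - h\<bar> powr (p - 1 - 1)"
    using assms by (intro spow_Lipschitz) auto
  also have "\<dots> = (p - 1) * \<bar>h\<bar> * max \<bar>y\<bar> \<bar>y - h\<bar> powr (p - 2)" by simp
  also have "\<dots> \<le> (p - 1) * \<bar>h\<bar> * (\<bar>y\<bar> + \<bar>h\<bar>) powr (p - 2)"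
    using assms by (intro mult_left_mono powr_mono2) auto
  also have "\<dots> \<le> (p - 1) * \<bar>h\<bar> * (2 powr (p - 2) * (\<bar>y\<bar> powr (p - 2) + \<bar>h\<bar> powr (p - 2)))"
    using assms by (intro mult_left_mono powr_add_le) auto
  finally have "p * \<bar>h\<bar> * \<bar>spow (p - 1) y - spow (p - 1) (y - h)\<bar>
     \<le> p * \<bar>h\<bar> * ((p - 1) * \<bar>h\<bar> * (2 powr (p - 2) * (\<bar>y\<bar> powr (p - 2) + \<bar>h\<bar> powr (p - 2))))"
    using assms by (intro mult_left_mono) auto
  also have "\<dots> = p * (p - 1) * 2 powr (p - 2) * (\<bar>h\<bar> * \<bar>h\<bar> * \<bar>y\<bar> powr (p - 2) + \<bar>h\<bar> * (\<bar>h\<bar> * \<bar>h\<bar> powr (p - 2)))"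
    by (simp only: distrib_left mult_ac)
  also have "\<bar>h\<bar> * (\<bar>h\<bar> * \<bar>h\<bar> powr (p - 2)) = \<bar>h\<bar> powr p"
    by (simp add: powr_mult_base)
  also have "\<bar>h\<bar> * \<bar>h\<bar> = h\<^sup>2" by (simp add: power2_eq_square)
  finally show ?thesis using powr_Taylor[of p y h] assms by linarith
qed

lemma spow_add_nonneg: "0 < s \<Longrightarrow> 0 \<le> x + y \<Longrightarrow> 0 \<le> spow s x + spow s y"
  using spow_mono[of s "- y" x] by simp

lemma spow_add_nonpos: "0 < s \<Longrightarrow> x + y \<le> 0 \<Longrightarrow> spow s x + spow s y \<le> 0"
  using spow_mono[of s x "- y"] by simp

lemma spow_nonpos: "x \<le> 0 \<Longrightarrow> spow s x \<le> 0"
  using spow_nonneg_iff[of s "- x"] by simp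

text \<open>A quadratic-type term is interpolated between two \<open>p\<close>-th powers. With a rescaled first factor this takes the
place of Hoelder's inequality in the energy estimates for \<open>p \<ge> 2\<close>.\<close>

lemma sq_powr_le:
  fixes a b :: real assumes "2 \<le> p"
  shows "a\<^sup>2 * \<bar>b\<bar> powr (p - 2) \<le> \<bar>a\<bar> powr p + \<bar>b\<bar> powr p"
proof -
  let ?M = "max \<bar>a\<bar> \<bar>b\<bar>"
  have "a\<^sup>2 * \<bar>b\<bar> powr (p - 2) \<le> ?M\<^sup>2 * ?M powr (p - 2)"
  proof (intro mult_mono powr_mono2)
    have "\<bar>a\<bar>\<^sup>2 \<le> ?M\<^sup>2" by (intro power_mono) auto
    then show "a\<^sup>2 \<le> ?M\<^sup>2" by simp
  qed (use assms in auto)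
  also have "?M\<^sup>2 * ?M powr (p - 2) = ?M powr p"
  proof (cases "?M = 0")
    case False
    then have "?M\<^sup>2 = ?M powr 2" by simp
    then have "?M\<^sup>2 * ?M powr (p - 2) = ?M powr (2 + (p - 2))" by (simp only: powr_add)
    then show ?thesis by simp
  qed (simp add: max_def split: if_splits)
  also have "\<dots> \<le> \<bar>a\<bar> powr p + \<bar>b\<bar> powr p" by (auto simp: max_def)
  finally show ?thesis .
qed

section \<open>The p-mean\<close>

lemma continuous_on_spow: "0 < s \<Longrightarrow> continuous_on UNIV (spow s)"
proof -
  assume s: "0 < s"
  have "spow s = (\<lambda>x. (max 0 x) powr s - (max 0 (- x)) powr s)"
    by (auto simp: fun_eq_iff spow_def sgn_if max_def)
  moreover have "continuous_on UNIV (\<lambda>x::real. (max 0 x) powr s - (max 0 (- x)) powr s)"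
    using s by (intro continuous_intros continuous_on_powr') auto
  ultimately show ?thesis by simp
qed

lemma spow_root_exists:
  fixes y :: "'i \<Rightarrow> real"
  assumes "finite I" "I \<noteq> {}" "0 < s"
  shows "\<exists>m. (\<Sum>i\<in>I. spow s (m - y i)) = 0"
proof -
  let ?G = "\<lambda>x. \<Sum>i\<in>I. spow s (x - y i)"
  have "?G (Min (y ` I)) \<le> 0"
  proof (rule sum_nonpos)
    fix i assume "i \<in> I"
    then have "Min (y ` I) - y i \<le> 0" using assms by simp
    then show "spow s (Min (y ` I) - y i) \<le> 0"
      using spow_mono[of s _ 0] assms(3) by fastforce
  qed
  moreover have "0 \<le> ?G (Max (y ` I))"
    using assms by (intro sum_nonneg) auto
  moreover have "Min (y ` I) \<le> Max (y ` I)"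
    using assms by (simp add: Min_le_iff)
  moreover have "continuous_on {Min (y ` I)..Max (y ` I)} ?G"
  proof (intro continuous_on_sum)
    fix i
    have "continuous_on UNIV (\<lambda>x. spow s (x - y i))"
      by (rule continuous_on_compose2[OF continuous_on_spow[OF assms(3)], of UNIV])
        (auto intro!: continuous_intros)
    then show "continuous_on {Min (y ` I)..Max (y ` I)} (\<lambda>x. spow s (x - y i))"
      by (rule continuous_on_subset) simp
  qed
  ultimately show ?thesis
    using IVT'[of ?G "Min (y ` I)" 0 "Max (y ` I)"] by blast
qed

lemma spow_sum_strict_mono:
  fixes y :: "'i \<Rightarrow> real"
  assumes "finite I" "I \<noteq> {}" "0 < s" "a < b"
  shows "(\<Sum>i\<in>I. spow s (a - y i)) < (\<Sum>i\<in>I. spow s (b - y i))"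
  using assms by (intro sum_strict_mono spow_strict_mono) auto

lemma sum_powr_tangent:
  assumes "1 < p"
  shows "(\<Sum>i\<in>I. \<bar>a - y i\<bar> powr p) + p * (\<Sum>i\<in>I. spow (p - 1) (a - y i)) * (b - a)
     \<le> (\<Sum>i\<in>I. \<bar>b - y i\<bar> powr p)"
proof -
  have "(\<Sum>i\<in>I. \<bar>a - y i\<bar> powr p + p * spow (p - 1) (a - y i) * (b - a)) \<le> (\<Sum>i\<in>I. \<bar>b - y i\<bar> powr p)"
  proof (rule sum_mono)
    fix i
    show "\<bar>a - y i\<bar> powr p + p * spow (p - 1) (a - y i) * (b - a) \<le> \<bar>b - y i\<bar> powr p"
      using powr_tangent[OF assms, of "a - y i" "b - y i"] by simp
  qed
  then show ?thesis by (simp add: sum.distrib sum_distrib_left sum_distrib_right)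
qed

text \<open>By the tangent inequality a root of the increasing function \<open>x \<mapsto> \<Sum> spow (p - 1) (x - y i)\<close> minimizes the
objective. For uniqueness, compare another minimizer with the midpoint between it and the root: there the slope
points towards the root, so the midpoint has a smaller objective.\<close>

lemma p_mean_root_eq:
  fixes y :: "'i \<Rightarrow> real"
  assumes "finite I" "I \<noteq> {}" "1 < p" and root: "(\<Sum>i\<in>I. spow (p - 1) (m - y i)) = 0"
  shows "p_mean p I y = m"
  unfolding p_mean_def
proof (rule the_equality)
  let ?obj = "\<lambda>x. \<Sum>i\<in>I. \<bar>x - y i\<bar> powr p"
  have min: "?obj m \<le> ?obj x" for x
    using sum_powr_tangent[OF assms(3), where a = m and b = x and I = I and y = y] root by simp
  then show "is_arg_min ?obj (\<lambda>_. True) m"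
    by (auto simp: is_arg_min_linorder)
  fix x assume x: "is_arg_min ?obj (\<lambda>_. True) x"
  show "x = m"
  proof (rule ccontr)
    assume ne: "x \<noteq> m"
    define c where "c = (x + m) / 2"
    let ?G = "\<lambda>x. \<Sum>i\<in>I. spow (p - 1) (x - y i)"
    have "0 < ?G c * (x - c)"
    proof (cases "m < x")
      case True
      then have "?G m < ?G c" using assms by (intro spow_sum_strict_mono) (auto simp: c_def)
      with True root show ?thesis by (auto simp: c_def intro!: mult_pos_pos)
    next
      case False
      then have "?G c < ?G m" using assms ne by (intro spow_sum_strict_mono) (auto simp: c_def)
      with False ne root show ?thesis by (auto simp: c_def intro!: mult_neg_neg)
    qed
    then have "0 < p * ?G c * (x - c)" using assms(3) by (simp add: mult.assoc)
    with sum_powr_tangent[OF assms(3), where a = c and b = x and I = I and y = y]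
    have "?obj c < ?obj x" by linarith
    with min[of c] x show False by (auto simp: is_arg_min_linorder not_le[symmetric])
  qed
qed

lemma p_mean_root:
  fixes y :: "'i \<Rightarrow> real"
  assumes "finite I" "I \<noteq> {}" "1 < p"
  shows "(\<Sum>i\<in>I. spow (p - 1) (p_mean p I y - y i)) = 0"
proof -
  obtain m where "(\<Sum>i\<in>I. spow (p - 1) (m - y i)) = 0"
    using spow_root_exists[OF assms(1,2), of "p - 1" y] assms(3) by auto
  with p_mean_root_eq[OF assms this] show ?thesis by simp
qed

lemma p_mean_minimal:
  fixes y :: "'i \<Rightarrow> real"
  assumes "finite I" "I \<noteq> {}" "1 < p"
  shows "(\<Sum>i\<in>I. \<bar>p_mean p I y - y i\<bar> powr p) \<le> (\<Sum>i\<in>I. \<bar>x - y i\<bar> powr p)"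
  using sum_powr_tangent[OF assms(3), where a = "p_mean p I y" and b = x and I = I and y = y]
    p_mean_root[OF assms, of y] by simp

lemma p_mean_leI:
  fixes y :: "'i \<Rightarrow> real"
  assumes "finite I" "I \<noteq> {}" "1 < p" "0 \<le> (\<Sum>i\<in>I. spow (p - 1) (x - y i))"
  shows "p_mean p I y \<le> x"
  using spow_sum_strict_mono[OF assms(1,2), of "p - 1" x "p_mean p I y" y] p_mean_root[OF assms(1-3), of y]
    assms(3,4) by fastforce

lemma p_mean_geI:
  fixes y :: "'i \<Rightarrow> real"
  assumes "finite I" "I \<noteq> {}" "1 < p" "(\<Sum>i\<in>I. spow (p - 1) (x - y i)) \<le> 0"
  shows "x \<le> p_mean p I y"
  using spow_sum_strict_mono[OF assms(1,2), of "p - 1" "p_mean p I y" x y] p_mean_root[OF assms(1-3), of y]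
    assms(3,4) by fastforce

text \<open>The root is monotone in the data and moves along with a common shift, so the p-mean is nonexpansive for the
supremum norm.\<close>

lemma p_mean_perturb_le:
  fixes y z :: "'i \<Rightarrow> real"
  assumes "finite I" "I \<noteq> {}" "1 < p" "\<And>i. i \<in> I \<Longrightarrow> y i \<le> z i + D"
  shows "p_mean p I y \<le> p_mean p I z + D"
proof (rule p_mean_leI[OF assms(1-3)])
  have "0 = (\<Sum>i\<in>I. spow (p - 1) (p_mean p I z - z i))"
    using p_mean_root[OF assms(1-3), of z] by simp
  also have "\<dots> \<le> (\<Sum>i\<in>I. spow (p - 1) (p_mean p I z + D - y i))"
    using assms by (intro sum_mono spow_mono) (auto simp: algebra_simps)
  finally show "0 \<le> (\<Sum>i\<in>I. spow (p - 1) (p_mean p I z + D - y i))" .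
qed

lemma p_mean_perturb:
  fixes y z :: "'i \<Rightarrow> real"
  assumes "finite I" "I \<noteq> {}" "1 < p" "\<And>i. i \<in> I \<Longrightarrow> \<bar>y i - z i\<bar> \<le> D"
  shows "\<bar>p_mean p I y - p_mean p I z\<bar> \<le> D"
proof -
  have "p_mean p I y \<le> p_mean p I z + D"
    by (rule p_mean_perturb_le[OF assms(1-3)]) (use assms(4) in \<open>fastforce simp: abs_le_iff\<close>)
  moreover have "p_mean p I z \<le> p_mean p I y + D"
    by (rule p_mean_perturb_le[OF assms(1-3)]) (use assms(4) in \<open>fastforce simp: abs_le_iff\<close>)
  ultimately show ?thesis by (simp add: abs_le_iff)
qed

lemma p_mean_le_bound:
  fixes y :: "'i \<Rightarrow> real"
  assumes "finite I" "I \<noteq> {}" "1 < p" "\<And>i. i \<in> I \<Longrightarrow> y i \<le> B"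
  shows "p_mean p I y \<le> B"
  by (rule p_mean_leI[OF assms(1-3)]) (use assms(4) in \<open>auto intro!: sum_nonneg\<close>)

lemma p_mean_ge_bound:
  fixes y :: "'i \<Rightarrow> real"
  assumes "finite I" "I \<noteq> {}" "1 < p" "\<And>i. i \<in> I \<Longrightarrow> B \<le> y i"
  shows "B \<le> p_mean p I y"
proof (rule p_mean_geI[OF assms(1-3)])
  show "(\<Sum>i\<in>I. spow (p - 1) (B - y i)) \<le> 0"
  proof (rule sum_nonpos)
    fix i assume "i \<in> I"
    then show "spow (p - 1) (B - y i) \<le> 0"
      using spow_mono[of "p - 1" "B - y i" 0] assms(3,4) by auto
  qed
qed

lemma p_mean_2:
  fixes y :: "'i \<Rightarrow> real"
  assumes "finite I" "I \<noteq> {}"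
  shows "p_mean 2 I y = (\<Sum>i\<in>I. y i) / real (card I)"
  by (rule p_mean_root_eq) (use assms in \<open>auto simp: sum_subtractf\<close>)

section \<open>Mean values along a sequence of independent uniform updates\<close>

primrec run :: "('s \<Rightarrow> 'a \<Rightarrow> 's) \<Rightarrow> 's \<Rightarrow> (nat \<Rightarrow> 'a) \<Rightarrow> nat \<Rightarrow> 's" where
  "run step s \<omega> 0 = s"
| "run step s \<omega> (Suc t) = step (run step s \<omega> t) (\<omega> t)"

text \<open>The mean of \<open>H\<close> after \<open>t\<close> random steps from \<open>s\<close>, as a finite recursion that conditions on the first step. All
estimates are made for this operator, which is linear and monotone; the infinite product measure enters only
through \<open>nn_integral_run\<close>.\<close>

primrec mean_after :: "'a set \<Rightarrow> ('s \<Rightarrow> 'a \<Rightarrow> 's) \<Rightarrow> nat \<Rightarrow> ('s \<Rightarrow> real) \<Rightarrow> 's \<Rightarrow> real" where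
  "mean_after V step 0 H s = H s"
| "mean_after V step (Suc t) H s = (\<Sum>u\<in>V. mean_after V step t H (step s u)) / real (card V)"

lemma profile_at_eq_run: "profile_at p V adj f0 \<omega> t = run (update p V adj) f0 \<omega> t"
  by (induction t) auto

lemma run_Suc_shift: "run step s \<omega> (Suc t) = run step (step s (\<omega> 0)) (\<lambda>n. \<omega> (Suc n)) t"
  by (induction t) auto

lemma mean_after_nonneg: "(\<And>s. 0 \<le> H s) \<Longrightarrow> 0 \<le> mean_after V step t H s"
  by (induction t arbitrary: s) (auto intro!: divide_nonneg_nonneg sum_nonneg)

text \<open>The state space carries no sigma-algebra. The run is still measurable, because \<open>t\<close> steps depend on finitely many
coordinates with values in a finite set; the induction splits off the first coordinate.\<close>

lemma borel_measurable_run: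
  assumes "finite V"
  shows "(\<lambda>\<omega>. ennreal (H (run step s \<omega> t))) \<in> borel_measurable (update_space V)"
proof (induction t arbitrary: s)
  case (Suc t)
  have shift: "(\<lambda>\<omega> n. \<omega> (Suc n)) \<in> measurable (update_space V) (update_space V)"
    unfolding update_space_def
    by (intro measurable_PiM_single') (auto simp: space_PiM PiE_iff)
  have "(\<lambda>\<omega>. \<omega> 0) \<in> measurable (update_space V) (uniform_count_measure V)"
    unfolding update_space_def by measurable
  then have coord: "(\<lambda>\<omega>. \<omega> 0) \<in> measurable (update_space V) (count_space V)"
    by (subst measurable_cong_sets[of _ "update_space V" _ "uniform_count_measure V"])
      (simp_all add: sets_uniform_count_measure)
  show ?case
    unfolding run_Suc_shift
    by (rule measurable_compose_countable'[OF _ coord])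
      (auto intro!: measurable_compose[OF shift Suc.IH] countable_finite assms)
qed simp

text \<open>The product measure is invariant under putting a fresh independent coordinate in front of a sequence; this is
the recursion that defines \<open>mean_after\<close>.\<close>

theorem nn_integral_run:
  assumes V: "finite V" "V \<noteq> {}" and H: "\<And>s. 0 \<le> H s"
  shows "(\<integral>\<^sup>+ \<omega>. ennreal (H (run step s \<omega> t)) \<partial>update_space V) = ennreal (mean_after V step t H s)"
proof -
  interpret M: prob_space "uniform_count_measure V"
    by (rule prob_space_uniform_count_measure) fact+
  interpret S: sequence_space "uniform_count_measure V" ..
  show ?thesis
  proof (induction t arbitrary: s)
    case 0
    show ?case using S.P.emeasure_space_1 by (simp add: update_space_def)
  next
    case (Suc t)
    let ?M = "uniform_count_measure V" and ?S = "update_space V"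
    have "(\<integral>\<^sup>+ \<omega>. ennreal (H (run step s \<omega> (Suc t))) \<partial>?S)
        = (\<integral>\<^sup>+ \<omega>. ennreal (H (run step s \<omega> (Suc t))) \<partial>distr (?M \<Otimes>\<^sub>M ?S) ?S (\<lambda>(u, \<omega>). case_nat u \<omega>))"
      using S.PiM_iter by (simp add: update_space_def)
    also have "\<dots> = (\<integral>\<^sup>+ x. ennreal (H (run step s (case x of (u, \<omega>) \<Rightarrow> case_nat u \<omega>) (Suc t))) \<partial>(?M \<Otimes>\<^sub>M ?S))"
      unfolding update_space_def
    proof (rule nn_integral_distr)
      show "(\<lambda>(u, \<omega>). case_nat u \<omega>) \<in> measurable
          (?M \<Otimes>\<^sub>M (\<Pi>\<^sub>M t\<in>UNIV. ?M)) (\<Pi>\<^sub>M t\<in>UNIV. ?M)"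
        by measurable
      show "(\<lambda>\<omega>. ennreal (H (run step s \<omega> (Suc t)))) \<in> borel_measurable
          (distr (?M \<Otimes>\<^sub>M (\<Pi>\<^sub>M t\<in>UNIV. ?M)) (\<Pi>\<^sub>M t\<in>UNIV. ?M) (\<lambda>(u, \<omega>). case_nat u \<omega>))"
        using borel_measurable_run[OF V(1), of H step s "Suc t"]
        by (simp only: update_space_def measurable_distr_eq1)
    qed
    also have "\<dots> = (\<integral>\<^sup>+ u. \<integral>\<^sup>+ \<omega>. ennreal (H (run step s (case_nat u \<omega>) (Suc t))) \<partial>?S \<partial>?M)"
    proof (subst S.P.nn_integral_fst[symmetric, folded update_space_def])
      have "(\<lambda>(u, \<omega>). case_nat u \<omega>) \<in> measurable (?M \<Otimes>\<^sub>M ?S) ?S"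
        unfolding update_space_def by measurable
      then show "(\<lambda>x. ennreal (H (run step s (case x of (u, \<omega>) \<Rightarrow> case_nat u \<omega>) (Suc t))))
          \<in> borel_measurable (?M \<Otimes>\<^sub>M ?S)"
        by (rule measurable_compose) (rule borel_measurable_run[OF V(1)])
    qed simp
    also have "\<dots> = (\<integral>\<^sup>+ u. ennreal (mean_after V step t H (step s u)) \<partial>?M)"
      unfolding run_Suc_shift by (simp add: Suc.IH)
    also have "\<dots> = (\<Sum>u\<in>V. ennreal (1 / real (card V)) * ennreal (mean_after V step t H (step s u)))"
      unfolding uniform_count_measure_def
      by (subst nn_integral_point_measure_finite) (auto simp: V mult.commute)
    also have "\<dots> = (\<Sum>u\<in>V. ennreal (mean_after V step t H (step s u) / real (card V)))"
      by (intro sum.cong refl) (simp add: ennreal_mult[symmetric] mean_after_nonneg H)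
    also have "\<dots> = ennreal (mean_after V step (Suc t) H s)"
      by (simp add: sum_ennreal mean_after_nonneg H sum_divide_distrib)
    finally show ?case .
  qed
qed

text \<open>Driving two processes by the same random vertices keeps them in any relation that single steps preserve. The case of
equal states in an invariant set gives monotonicity.\<close>

lemma mean_after_coupling:
  assumes step: "\<And>r s u. R r s \<Longrightarrow> u \<in> V \<Longrightarrow> R (stepr r u) (step s u)"
    and le: "\<And>r s. R r s \<Longrightarrow> H r \<le> H' s" and "R r s"
  shows "mean_after V stepr t H r \<le> mean_after V step t H' s"
  using assms(3)
  by (induction t arbitrary: r s) (auto intro!: divide_right_mono sum_mono step le)

lemma mean_after_mono:
  assumes "\<And>s u. s \<in> S \<Longrightarrow> u \<in> V \<Longrightarrow> step s u \<in> S" "\<And>s. s \<in> S \<Longrightarrow> H s \<le> H' s" "s \<in> S"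
  shows "mean_after V step t H s \<le> mean_after V step t H' s"
  by (rule mean_after_coupling[where R = "\<lambda>r s. r = s \<and> s \<in> S"]) (use assms in auto)

lemma mean_after_add:
  "mean_after V step t (\<lambda>s. H s + H' s) s = mean_after V step t H s + mean_after V step t H' s"
  by (induction t arbitrary: s) (auto simp: sum.distrib add_divide_distrib)

lemma mean_after_cmult: "mean_after V step t (\<lambda>s. c * H s) s = c * mean_after V step t H s"
  by (induction t arbitrary: s) (auto simp: sum_distrib_left)

lemma mean_after_const:
  assumes "finite V" "V \<noteq> {}"
  shows "mean_after V step t (\<lambda>_. c) s = c"
  using assms by (induction t arbitrary: s) auto

lemma mean_after_sum:
  "mean_after V step t (\<lambda>s. \<Sum>w\<in>A. H w s) s = (\<Sum>w\<in>A. mean_after V step t (H w) s)"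
proof (induction t arbitrary: s)
  case (Suc t)
  then show ?case by (simp add: sum_divide_distrib) (rule sum.swap)
qed simp

text \<open>The defining recursion conditions on the first step; estimates that are propagated in time need the last step
instead.\<close>

lemma mean_after_Suc_last:
  "mean_after V step (Suc t) H s = mean_after V step t (\<lambda>s. (\<Sum>u\<in>V. H (step s u)) / real (card V)) s"
  by (induction t arbitrary: s) auto

lemma mean_after_diff:
  "mean_after V step t (\<lambda>s. H s - H' s) s = mean_after V step t H s - mean_after V step t H' s"
  using mean_after_add[of V step t H "\<lambda>s. (-1) * H' s" s] mean_after_cmult[of V step t "-1" H' s] by simp

text \<open>The mean number of times at which the state satisfies \<open>P\<close>. For a property that, once lost, is never regained,
this is the mean time until it is lost.\<close>

definition mean_sojourn :: "'a set \<Rightarrow> ('s \<Rightarrow> 'a \<Rightarrow> 's) \<Rightarrow> ('s \<Rightarrow> bool) \<Rightarrow> 's \<Rightarrow> ennreal" where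
  "mean_sojourn V step P s = (\<Sum>t. ennreal (mean_after V step t (\<lambda>s. of_bool (P s)) s))"

lemma nn_integral_sojourn:
  assumes "finite V" "V \<noteq> {}"
  shows "(\<integral>\<^sup>+ \<omega>. (\<Sum>t. ennreal (of_bool (P (run step s \<omega> t)))) \<partial>update_space V)
       = mean_sojourn V step P s"
  unfolding mean_sojourn_def
proof (subst nn_integral_suminf)
  fix t
  show "(\<lambda>\<omega>. ennreal (of_bool (P (run step s \<omega> t)))) \<in> borel_measurable (update_space V)"
    by (rule borel_measurable_run[OF assms(1), of "\<lambda>s. of_bool (P s)"])
qed (intro suminf_cong nn_integral_run assms, simp)

lemma mean_sojourn_first_step:
  assumes "finite V" "V \<noteq> {}"
  shows "mean_sojourn V step P s
       = of_bool (P s) + (\<Sum>u\<in>V. mean_sojourn V step P (step s u)) * ennreal (1 / real (card V))"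
proof -
  let ?m = "\<lambda>t s. mean_after V step t (\<lambda>s. of_bool (P s)) s"
  have "mean_sojourn V step P s = ennreal (?m 0 s) + (\<Sum>t. ennreal (?m (Suc t) s))"
    unfolding mean_sojourn_def by (subst suminf_offset[of _ 1]) auto
  also have "(\<Sum>t. ennreal (?m (Suc t) s)) = (\<Sum>t. (\<Sum>u\<in>V. ennreal (?m t (step s u))) * ennreal (1 / real (card V)))"
    by (intro suminf_cong)
      (simp add: sum_ennreal mean_after_nonneg ennreal_mult[symmetric] sum_nonneg)
  also have "\<dots> = (\<Sum>u\<in>V. mean_sojourn V step P (step s u)) * ennreal (1 / real (card V))"
    unfolding mean_sojourn_def
    by (simp add: ennreal_suminf_multc suminf_sum[symmetric])
  also have "ennreal (?m 0 s) = of_bool (P s)" by simp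
  finally show ?thesis .
qed

lemma suminf_of_bool_decreasing:
  assumes dec: "\<And>t. Q (Suc t) \<Longrightarrow> Q t"
  shows "(\<Sum>t. ennreal (of_bool (Q t))) = (if \<exists>t. \<not> Q t then of_nat (LEAST t. \<not> Q t) else \<infinity>)"
proof (cases "\<exists>t. \<not> Q t")
  case True
  define T where "T = (LEAST t. \<not> Q t)"
  have QT: "\<not> Q T" unfolding T_def using True by (rule LeastI_ex)
  have after: "\<not> Q t" if "T \<le> t" for t
    using that
  proof (induction t rule: dec_induct)
    case base show ?case by (rule QT)
  next
    case (step t) then show ?case using dec[of t] by blast
  qed
  have before: "Q t" if "t < T" for t using that not_less_Least unfolding T_def by blast
  have "(\<Sum>t. ennreal (of_bool (Q t))) = (\<Sum>t<T. ennreal (of_bool (Q t)))"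
    by (rule suminf_finite) (auto simp: after)
  also have "\<dots> = (\<Sum>t<T. 1)" by (intro sum.cong) (auto simp: before)
  finally show ?thesis using True by (simp add: T_def)
next
  case False
  then have "(\<Sum>t. ennreal (of_bool (Q t))) = (\<Sum>t. 1)" by simp
  also have "\<dots> = \<infinity>"
  proof -
    have "(\<Sum>t. (1::ennreal)) = (SUP n. of_nat n)" by (subst suminf_eq_SUP) simp
    then show ?thesis by (simp add: ennreal_SUP_of_nat_eq_top)
  qed
  finally show ?thesis using False by simp
qed

lemma mean_sojourn_ge:
  assumes "\<And>t. t < T \<Longrightarrow> q \<le> mean_after V step t (\<lambda>s. of_bool (P s)) s" "0 \<le> q"
  shows "ennreal (real T * q) \<le> mean_sojourn V step P s"
proof -
  have "ennreal (real T * q) = (\<Sum>t<T. ennreal q)" using assms(2)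
    by (simp add: ennreal_mult ennreal_of_nat_eq_real_of_nat)
  also have "\<dots> \<le> (\<Sum>t<T. ennreal (mean_after V step t (\<lambda>s. of_bool (P s)) s))"
    by (intro sum_mono ennreal_leI assms) auto
  also have "\<dots> \<le> mean_sojourn V step P s"
    unfolding mean_sojourn_def by (rule sum_le_suminf) auto
  finally show ?thesis .
qed

text \<open>Probabilities are at most \<open>1\<close>, so the geometric bound is of use only from the time \<open>T \<approx> ln B / \<kappa>\<close> on, when it
drops below \<open>1\<close>. Up to \<open>T\<close> the terms are bounded by \<open>1\<close>, afterwards they sum to at most \<open>1 / \<kappa>\<close>.\<close>

lemma mean_sojourn_le_geometric:
  assumes V: "finite V" "V \<noteq> {}"
    and \<kappa>: "0 < \<kappa>" "\<kappa> \<le> 1" and B: "1 \<le> B"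
    and le: "\<And>t. mean_after V step t (\<lambda>s. of_bool (P s)) s \<le> B * (1 - \<kappa>) ^ t"
  shows "mean_sojourn V step P s \<le> ennreal ((ln B + 2) / \<kappa>)"
proof -
  let ?m = "\<lambda>t. mean_after V step t (\<lambda>s. of_bool (P s)) s"
  have m0: "0 \<le> ?m t" for t by (rule mean_after_nonneg) auto
  have m1: "?m t \<le> 1" for t
    using mean_after_mono[of UNIV V step "\<lambda>s. of_bool (P s)" "\<lambda>_. 1" s t] mean_after_const[OF V, of step t 1 s]
    by auto
  define T where "T = nat \<lceil>ln B / \<kappa>\<rceil>"
  have T: "ln B / \<kappa> \<le> T" "T \<le> ln B / \<kappa> + 1"
    using \<kappa> B unfolding T_def by (auto simp: of_nat_nat ceiling_correct intro: le_of_int_ceiling)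
  have "B * (1 - \<kappa>) ^ T \<le> 1"
  proof -
    have "(1 - \<kappa>) ^ T \<le> exp (- \<kappa>) ^ T"
      using \<kappa> exp_ge_add_one_self[of "- \<kappa>"] by (intro power_mono) auto
    also have "\<dots> = exp (- (\<kappa> * T))" by (simp add: exp_of_nat_mult[symmetric] mult.commute)
    also have "\<dots> \<le> exp (- ln B)" using T(1) \<kappa> by (simp add: field_simps)
    also have "\<dots> = 1 / B" using B by (simp add: exp_minus inverse_eq_divide)
    finally show ?thesis using B by (simp add: field_simps)
  qed
  then have tail: "?m (t + T) \<le> (1 - \<kappa>) ^ t" for t
    using le[of "t + T"] \<kappa> mult_right_mono[of "B * (1 - \<kappa>) ^ T" 1 "(1 - \<kappa>) ^ t"]
    by (simp add: power_add mult_ac)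
  have "mean_sojourn V step P s = (\<Sum>t. ennreal (?m (t + T))) + (\<Sum>t<T. ennreal (?m t))"
    unfolding mean_sojourn_def by (rule suminf_offset) auto
  also have "\<dots> \<le> (\<Sum>t. ennreal ((1 - \<kappa>) ^ t)) + (\<Sum>t<T. 1)"
    using m1 by (intro add_mono suminf_le sum_mono ennreal_leI tail) (auto simp: ennreal_le_1)
  also have "(\<Sum>t. ennreal ((1 - \<kappa>) ^ t)) = ennreal (\<Sum>t. (1 - \<kappa>) ^ t)"
    using \<kappa> by (intro suminf_ennreal2) (auto intro!: summable_geometric)
  also have "(\<Sum>t. (1 - \<kappa>) ^ t) = 1 / \<kappa>"
    using \<kappa> by (subst suminf_geometric) auto
  also have "(\<Sum>t<T. (1::ennreal)) = ennreal (real T)"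
    by (simp add: ennreal_of_nat_eq_real_of_nat)
  also have "ennreal (1 / \<kappa>) + ennreal (real T) = ennreal (1 / \<kappa> + real T)"
    using \<kappa> by (simp add: ennreal_plus)
  also have "\<dots> \<le> ennreal ((ln B + 2) / \<kappa>)"
  proof (rule ennreal_leI)
    have "1 \<le> 1 / \<kappa>" using \<kappa> by simp
    then show "1 / \<kappa> + real T \<le> (ln B + 2) / \<kappa>"
      using T(2) by (simp add: add_divide_distrib)
  qed
  finally show ?thesis .
qed

section \<open>Two elementary estimates\<close>

lemma nat_floor_bound:
  fixes X :: real assumes "0 \<le> X"
  shows "\<exists>T. X \<le> real T \<and> (\<forall>t<T. real t \<le> X)"
proof (intro exI conjI allI impI)
  let ?T = "nat \<lfloor>X\<rfloor> + 1"
  show "X \<le> real ?T" using assms by (simp add: of_nat_nat) linarith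
  fix t assume "t < ?T"
  then have "real t \<le> real (nat \<lfloor>X\<rfloor>)" by simp
  also have "\<dots> \<le> X" using assms by (simp add: of_nat_nat)
  finally show "real t \<le> X" .
qed

text \<open>The increment of the left side is at most \<open>1 / (k + 1) + 1 / (2 k + 2)\<close>, the increment of the right side.\<close>

lemma harm_double_le: "harm (2 * k) \<le> 3/2 * (harm k :: real)"
proof (induction k)
  case (Suc k)
  have "harm (2 * Suc k) = harm (2 * k) + 1 / real (2 * k + 1) + 1 / real (2 * k + 2)"
    by (simp add: harm_Suc inverse_eq_divide)
  also have "\<dots> \<le> 3/2 * harm k + 3/2 * (1 / real (k + 1))"
  proof -
    have "1 / real (2 * k + 1) \<le> 1 / real (k + 1)" by (simp add: field_simps)
    moreover have "1 / real (2 * k + 2) = 1/2 * (1 / real (k + 1))" by (simp add: field_simps)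
    ultimately show ?thesis using Suc by linarith
  qed
  also have "\<dots> = 3/2 * harm (Suc k)" by (simp add: harm_Suc inverse_eq_divide algebra_simps)
  finally show ?case .
qed (simp add: harm_def)

section \<open>The dynamics on a finite graph\<close>

locale p_dynamics =
  fixes V :: "'a set" and adj :: "'a \<Rightarrow> 'a \<Rightarrow> bool" and p :: real
  assumes fin: "finite V" and ne: "V \<noteq> {}"
    and sym: "adj u v \<Longrightarrow> adj v u" and irrefl: "\<not> adj u u"
    and has_nbr: "u \<in> V \<Longrightarrow> \<exists>v\<in>V. adj u v"
    and p_gt_1: "1 < p"
begin

definition N :: "'a \<Rightarrow> 'a set" where "N u = {v \<in> V. adj u v}"

abbreviation upd :: "('a \<Rightarrow> real) \<Rightarrow> 'a \<Rightarrow> 'a \<Rightarrow> real" where "upd \<equiv> update p V adj"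

abbreviation n :: real where "n \<equiv> real (card V)"

lemma n_ge_1: "1 \<le> n" and n_pos: "0 < n"
  using fin ne by (simp_all add: Suc_leI card_gt_0_iff)

lemma N_props: "finite (N u)" "N u \<subseteq> V" "u \<notin> N u" "u \<in> V \<Longrightarrow> N u \<noteq> {}"
  using fin has_nbr irrefl by (auto simp: N_def)

lemma N_sym: "u \<in> V \<Longrightarrow> v \<in> N u \<Longrightarrow> u \<in> N v"
  using sym by (auto simp: N_def)

lemma upd_eq: "upd f u = f(u := p_mean p (N u) f)"
  by (simp add: update_def N_def)

lemma upd_upper: "u \<in> V \<Longrightarrow> (\<And>v. v \<in> V \<Longrightarrow> f v \<le> b) \<Longrightarrow> v \<in> V \<Longrightarrow> upd f u v \<le> b"
  using N_props[of u] by (auto simp: upd_eq intro!: p_mean_le_bound p_gt_1)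

lemma upd_lower: "u \<in> V \<Longrightarrow> (\<And>v. v \<in> V \<Longrightarrow> b \<le> f v) \<Longrightarrow> v \<in> V \<Longrightarrow> b \<le> upd f u v"
  using N_props[of u] by (auto simp: upd_eq intro!: p_mean_ge_bound p_gt_1)

lemma diff_le_osc: "x \<in> V \<Longrightarrow> y \<in> V \<Longrightarrow> f x - f y \<le> osc V f"
  unfolding osc_def using fin by (intro diff_mono Max_ge Min_le) auto

lemma osc_leI:
  assumes "\<And>x y. x \<in> V \<Longrightarrow> y \<in> V \<Longrightarrow> f x - f y \<le> c"
  shows "osc V f \<le> c"
proof -
  have "Max (f ` V) \<in> f ` V" "Min (f ` V) \<in> f ` V" using fin ne by (auto intro!: Max_in Min_in)
  then show ?thesis unfolding osc_def using assms by auto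
qed

lemma osc_upd_le: "u \<in> V \<Longrightarrow> osc V (upd f u) \<le> osc V f"
proof (rule osc_leI)
  fix x y assume "u \<in> V" "x \<in> V" "y \<in> V"
  then have "upd f u x \<le> Max (f ` V)" "Min (f ` V) \<le> upd f u y"
    using fin by (auto intro!: upd_upper upd_lower)
  then show "upd f u x - upd f u y \<le> osc V f" by (simp add: osc_def)
qed

text \<open>The oscillation never increases along an update, so the hitting time counts the times with oscillation
above the tolerance.\<close>

lemma expected_time_eq_sojourn:
  "expected_time p V adj \<epsilon> f0 = mean_sojourn V upd (\<lambda>f. \<epsilon> < osc V f) f0"
proof -
  have "hit_time p V adj \<epsilon> f0 \<omega> = (\<Sum>t. ennreal (of_bool (\<epsilon> < osc V (run upd f0 \<omega> t))))"
    if "\<omega> \<in> space (update_space V)" for \<omega>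
  proof -
    have "\<omega> t \<in> V" for t
      using that by (auto simp: update_space_def space_PiM space_uniform_count_measure)
    then have "osc V (run upd f0 \<omega> (Suc t)) \<le> osc V (run upd f0 \<omega> t)" for t
      by (auto intro: osc_upd_le)
    then have dec: "\<epsilon> < osc V (run upd f0 \<omega> t)" if "\<epsilon> < osc V (run upd f0 \<omega> (Suc t))" for t
      using that order.strict_trans2 by blast
    show ?thesis
      unfolding hit_time_def profile_at_eq_run
      by (subst suminf_of_bool_decreasing[OF dec]) (auto simp: not_less)
  qed
  then have "expected_time p V adj \<epsilon> f0
      = (\<integral>\<^sup>+ \<omega>. (\<Sum>t. ennreal (of_bool (\<epsilon> < osc V (run upd f0 \<omega> t)))) \<partial>update_space V)"
    unfolding expected_time_def by (rule nn_integral_cong)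
  also have "\<dots> = mean_sojourn V upd (\<lambda>f. \<epsilon> < osc V f) f0"
    by (rule nn_integral_sojourn[OF fin ne])
  finally show ?thesis .
qed

section \<open>Lower bounds from profiles that updates hardly change\<close>

text \<open>The oscillation is at most \<open>2\<close> along the dynamics. Hence a mean spread of at least \<open>1\<close> between two vertices
forces the oscillation to exceed \<open>1/2\<close> with probability at least \<open>1/3\<close>.\<close>

lemma expected_time_ge_if_mean_spread:
  assumes f0: "\<And>v. v \<in> V \<Longrightarrow> \<bar>f0 v\<bar> \<le> 1" and xy: "x \<in> V" "y \<in> V"
    and spread: "\<And>t. t < T \<Longrightarrow> 1 \<le> mean_after V upd t (\<lambda>f. f x - f y) f0"
  shows "ennreal (real T / 3) \<le> expected_time p V adj (1/2) f0"
proof -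
  let ?S = "{f. \<forall>v\<in>V. \<bar>f v\<bar> \<le> 1}"
  let ?q = "\<lambda>t. mean_after V upd t (\<lambda>f. of_bool (1/2 < osc V f)) f0"
  have inv: "upd f u \<in> ?S" if "f \<in> ?S" "u \<in> V" for f u
    using that upd_upper[of u f 1] upd_lower[of u "-1" f] by (auto simp: abs_le_iff minus_le_iff)
  have "1 \<le> 1/2 + 3/2 * ?q t" if "t < T" for t
  proof -
    have "1 \<le> mean_after V upd t (\<lambda>f. f x - f y) f0" by (rule spread) fact
    also have "\<dots> \<le> mean_after V upd t (\<lambda>f. 1/2 + 3/2 * of_bool (1/2 < osc V f)) f0"
    proof (rule mean_after_mono[of ?S])
      fix f :: "'a \<Rightarrow> real" assume f: "f \<in> ?S"
      have "f x - f y \<le> osc V f" using diff_le_osc xy by blast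
      moreover have "f x - f y \<le> 2" using f xy by (smt (verit) mem_Collect_eq)
      ultimately show "f x - f y \<le> 1/2 + 3/2 * of_bool (1/2 < osc V f)" by auto
    qed (use inv f0 in auto)
    also have "\<dots> = 1/2 + 3/2 * ?q t"
      by (simp only: mean_after_add mean_after_cmult mean_after_const[OF fin ne])
    finally show ?thesis .
  qed
  then have "1/3 \<le> ?q t" if "t < T" for t using that by fastforce
  from mean_sojourn_ge[OF this] show ?thesis
    unfolding expected_time_eq_sojourn by simp
qed

text \<open>Only the update at \<open>v\<close> itself, which has probability \<open>1 / n\<close>, can change the value at \<open>v\<close>.\<close>

lemma upd_mean_one_site:
  assumes "v \<in> V"
  shows "(\<Sum>u\<in>V. H (upd f u v)) / n = (1 - 1 / n) * H (f v) + H (p_mean p (N v) f) / n"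
proof -
  have "(\<Sum>u\<in>V. H (upd f u v)) = H (upd f v v) + (\<Sum>u\<in>V - {v}. H (upd f u v))"
    by (rule sum.remove[OF fin assms])
  also have "(\<Sum>u\<in>V - {v}. H (upd f u v)) = (\<Sum>u\<in>V - {v}. H (f v))"
    by (intro sum.cong) (auto simp: upd_eq)
  also have "\<dots> = (n - 1) * H (f v)"
    using assms fin n_ge_1 by (simp add: of_nat_diff card_Diff_singleton Suc_leI card_gt_0_iff)
  finally show ?thesis using n_pos by (simp add: upd_eq field_simps)
qed

text \<open>Let \<open>\<eta>\<close> bound the change that a single update makes to the initial profile. Since the p-mean is nonexpansive, an
update at \<open>v\<close> makes the displacement of \<open>v\<close> at most \<open>\<eta>\<close> larger than the largest displacement of a neighbour, so
displacement is at most \<open>\<eta>\<close> times the length of the longest chain of updates that leads to \<open>v\<close>. The maximum over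
neighbours is nonlinear; it turns into a sum, at the cost of the factor \<open>D\<close>, for the exponential of the
displacement divided by \<open>\<eta>\<close>. That exponential grows in mean by the factor \<open>1 + e D / n\<close> per step, and Jensen's
inequality takes the logarithm.\<close>

lemma mean_displacement_le:
  assumes \<eta>: "0 < \<eta>" "\<And>u. u \<in> V \<Longrightarrow> \<bar>p_mean p (N u) f0 - f0 u\<bar> \<le> \<eta>"
    and D: "\<And>u. u \<in> V \<Longrightarrow> real (card (N u)) \<le> D" and v: "v \<in> V"
  shows "mean_after V upd t (\<lambda>f. \<bar>f v - f0 v\<bar>) f0 \<le> \<eta> * (exp 1 * D / n * real t)"
proof -
  define W where "W v f = exp (\<bar>f v - f0 v\<bar> / \<eta>)" for v and f :: "'a \<Rightarrow> real"
  define A where "A t v = mean_after V upd t (W v) f0" for t v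
  define r where "r = exp 1 * D / n"
  have D0: "0 \<le> D" using D[OF v] by (meson of_nat_0_le_iff order.trans)
  then have r0: "0 \<le> r" using n_pos by (simp add: r_def)
  have A: "A t v \<le> (1 + r) ^ t" if "v \<in> V" for t v
    using that
  proof (induction t arbitrary: v)
    case 0
    then show ?case by (simp add: A_def W_def)
  next
    case (Suc t)
    have one: "(\<Sum>u\<in>V. W v (upd f u)) / n \<le> W v f + exp 1 / n * (\<Sum>w\<in>N v. W w f)" for f
    proof -
      obtain w where w: "w \<in> N v" "\<bar>p_mean p (N v) f - p_mean p (N v) f0\<bar> \<le> \<bar>f w - f0 w\<bar>"
      proof -
        let ?M = "Max ((\<lambda>w. \<bar>f w - f0 w\<bar>) ` N v)"
        have "\<bar>p_mean p (N v) f - p_mean p (N v) f0\<bar> \<le> ?M"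
          by (rule p_mean_perturb) (use N_props Suc.prems p_gt_1 in auto)
        moreover have "?M \<in> (\<lambda>w. \<bar>f w - f0 w\<bar>) ` N v"
          using N_props Suc.prems by (intro Max_in) auto
        ultimately show ?thesis using that by auto
      qed
      have "\<bar>p_mean p (N v) f - f0 v\<bar> \<le> \<bar>f w - f0 w\<bar> + \<eta>"
        using w(2) \<eta>(2)[OF Suc.prems] by linarith
      then have "\<bar>p_mean p (N v) f - f0 v\<bar> / \<eta> \<le> \<bar>f w - f0 w\<bar> / \<eta> + 1"
        using \<eta>(1) by (simp add: field_simps)
      then have "exp (\<bar>p_mean p (N v) f - f0 v\<bar> / \<eta>) \<le> exp (\<bar>f w - f0 w\<bar> / \<eta> + 1)"
        by simp
      also have "\<dots> = exp 1 * W w f" by (simp add: W_def exp_add)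
      also have "W w f \<le> (\<Sum>w\<in>N v. W w f)"
        using w(1) N_props by (intro member_le_sum) (auto simp: W_def)
      finally have new: "exp (\<bar>p_mean p (N v) f - f0 v\<bar> / \<eta>) \<le> exp 1 * (\<Sum>w\<in>N v. W w f)"
        by simp
      have "(\<Sum>u\<in>V. W v (upd f u)) / n
          = (1 - 1 / n) * W v f + exp (\<bar>p_mean p (N v) f - f0 v\<bar> / \<eta>) / n"
        unfolding W_def
        by (rule upd_mean_one_site[OF Suc.prems, where H = "\<lambda>x. exp (\<bar>x - f0 v\<bar> / \<eta>)"])
      also have "\<dots> \<le> 1 * W v f + exp 1 * (\<Sum>w\<in>N v. W w f) / n"
        using new n_pos by (intro add_mono mult_right_mono divide_right_mono) (auto simp: W_def)
      finally show ?thesis by simp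
    qed
    have "A (Suc t) v = mean_after V upd t (\<lambda>f. (\<Sum>u\<in>V. W v (upd f u)) / n) f0"
      unfolding A_def by (rule mean_after_Suc_last)
    also have "\<dots> \<le> mean_after V upd t (\<lambda>f. W v f + exp 1 / n * (\<Sum>w\<in>N v. W w f)) f0"
      by (rule mean_after_mono[of UNIV]) (use one in auto)
    also have "\<dots> = A t v + exp 1 / n * (\<Sum>w\<in>N v. A t w)"
      by (simp only: mean_after_add mean_after_cmult mean_after_sum A_def)
    also have "\<dots> \<le> (1 + r) ^ t + exp 1 / n * (\<Sum>w\<in>N v. (1 + r) ^ t)"
      using Suc N_props(2)[of v] by (intro add_mono mult_left_mono sum_mono Suc.IH) auto
    also have "\<dots> \<le> (1 + r) ^ t + exp 1 / n * (D * (1 + r) ^ t)"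
      using D[OF Suc.prems] r0 by (auto intro!: divide_right_mono mult_right_mono mult_left_mono)
    also have "\<dots> = (1 + r) ^ Suc t" by (simp add: r_def algebra_simps)
    finally show ?case .
  qed
  (* Jensen's inequality in the form of the tangent to exp at the point a, the logarithm of the bound. *)
  define a where "a = r * real t"
  have "mean_after V upd t (\<lambda>f. \<bar>f v - f0 v\<bar>) f0
      \<le> mean_after V upd t (\<lambda>f. \<eta> * (exp (- a) * W v f) + \<eta> * (a - 1)) f0"
  proof (rule mean_after_mono[of UNIV])
    fix f
    have "1 + (\<bar>f v - f0 v\<bar> / \<eta> - a) \<le> exp (\<bar>f v - f0 v\<bar> / \<eta> - a)"
      by (rule exp_ge_add_one_self)
    then have "\<bar>f v - f0 v\<bar> / \<eta> \<le> exp (- a) * W v f + (a - 1)"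
      by (simp add: W_def exp_diff exp_minus divide_inverse mult.commute)
    then have "\<eta> * (\<bar>f v - f0 v\<bar> / \<eta>) \<le> \<eta> * (exp (- a) * W v f + (a - 1))"
      using \<eta>(1) by (intro mult_left_mono) auto
    then show "\<bar>f v - f0 v\<bar> \<le> \<eta> * (exp (- a) * W v f) + \<eta> * (a - 1)"
      using \<eta>(1) by (simp add: distrib_left)
  qed auto
  also have "\<dots> = \<eta> * (exp (- a) * A t v) + \<eta> * (a - 1)"
    by (simp only: mean_after_add mean_after_cmult mean_after_const[OF fin ne] A_def)
  also have "\<dots> \<le> \<eta> * (exp (- a) * exp a) + \<eta> * (a - 1)"
  proof -
    have "A t v \<le> (1 + r) ^ t" by (rule A[OF v])
    also have "\<dots> \<le> exp r ^ t" using r0 by (intro power_mono) auto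
    also have "\<dots> = exp a" by (simp add: a_def exp_of_nat_mult[symmetric] mult.commute)
    finally show ?thesis using \<eta>(1) by simp
  qed
  also have "\<dots> = \<eta> * a" by (simp add: exp_minus algebra_simps)
  finally show ?thesis by (simp add: a_def r_def)
qed

lemma expected_time_ge_of_near_fixed:
  assumes \<eta>: "0 < \<eta>" "\<And>u. u \<in> V \<Longrightarrow> \<bar>p_mean p (N u) f0 - f0 u\<bar> \<le> \<eta>"
    and D: "0 < D" "\<And>u. u \<in> V \<Longrightarrow> real (card (N u)) \<le> D"
    and f0: "\<And>v. v \<in> V \<Longrightarrow> \<bar>f0 v\<bar> \<le> 1" and xy: "x \<in> V" "y \<in> V" "f0 x - f0 y = 2"
  shows "ennreal (n / (6 * exp 1 * D * \<eta>)) \<le> expected_time p V adj (1/2) f0"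
proof -
  define X where "X = n / (2 * exp 1 * D * \<eta>)"
  have "0 \<le> X" using \<eta>(1) D(1) n_pos by (simp add: X_def)
  then obtain T where T: "X \<le> real T" "\<forall>t<T. real t \<le> X" using nat_floor_bound by blast
  have "ennreal (real T / 3) \<le> expected_time p V adj (1/2) f0"
  proof (rule expected_time_ge_if_mean_spread[OF f0 xy(1,2)])
    fix t assume "t < T"
    then have "real t \<le> X" using T(2) by blast
    then have "\<eta> * (exp 1 * D / n * real t) \<le> \<eta> * (exp 1 * D / n * X)"
      using \<eta>(1) D(1) n_pos by (intro mult_left_mono) auto
    also have "\<dots> = 1/2" using \<eta>(1) D(1) n_pos by (simp add: X_def field_simps)
    finally have half: "\<eta> * (exp 1 * D / n * real t) \<le> 1/2" .
    have disp: "mean_after V upd t (\<lambda>f. \<bar>f x - f0 x\<bar>) f0 \<le> 1/2" "mean_after V upd t (\<lambda>f. \<bar>f y - f0 y\<bar>) f0 \<le> 1/2"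
      using order.trans[OF mean_displacement_le[OF \<eta> D(2) xy(1)] half]
        order.trans[OF mean_displacement_le[OF \<eta> D(2) xy(2)] half] by auto
    have "2 - 1/2 - 1/2 \<le> mean_after V upd t (\<lambda>f. 2 - \<bar>f x - f0 x\<bar> - \<bar>f y - f0 y\<bar>) f0"
      unfolding mean_after_diff mean_after_const[OF fin ne] by (intro diff_mono order.refl disp)
    also have "\<dots> \<le> mean_after V upd t (\<lambda>f. f x - f y) f0"
    proof (rule mean_after_mono[of UNIV])
      fix f :: "'a \<Rightarrow> real"
      show "2 - \<bar>f x - f0 x\<bar> - \<bar>f y - f0 y\<bar> \<le> f x - f y" using xy(3) by linarith
    qed auto
    finally show "1 \<le> mean_after V upd t (\<lambda>f. f x - f y) f0" by simp
  qed
  moreover have "n / (6 * exp 1 * D * \<eta>) = X / 3" by (simp add: X_def)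
  moreover have "ennreal (X / 3) \<le> ennreal (real T / 3)" using T(1) by (intro ennreal_leI) auto
  ultimately show ?thesis by (simp only: order.trans)
qed

text \<open>For \<open>p = 2\<close> the mean displacement itself satisfies a linear recursion with averaging weights, so there is no
maximum over neighbours to be paid for and the degree does not enter.\<close>

lemma mean_displacement_linear:
  assumes p2: "p = 2" and \<eta>: "0 \<le> \<eta>" "\<And>u. u \<in> V \<Longrightarrow> \<bar>p_mean p (N u) f0 - f0 u\<bar> \<le> \<eta>" and v: "v \<in> V"
  shows "\<bar>mean_after V upd t (\<lambda>f. f v - f0 v) f0\<bar> \<le> \<eta> / n * real t"
  using v
proof (induction t arbitrary: v)
  case (Suc t)
  define B where "B v = mean_after V upd t (\<lambda>f. f v - f0 v) f0" for v
  define c where "c = p_mean p (N v) f0 - f0 v"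
  let ?k = "real (card (N v))"
  have k: "0 < ?k" using N_props Suc.prems by (simp add: card_gt_0_iff)
  have "p_mean p (N v) f - f0 v = 1 / ?k * (\<Sum>w\<in>N v. f w - f0 w) + c" for f
    using N_props Suc.prems p2 by (simp add: p_mean_2 sum_subtractf diff_divide_distrib c_def)
  then have "(\<Sum>u\<in>V. upd f u v - f0 v) / n
      = (1 - 1 / n) * (f v - f0 v) + 1 / n * (1 / ?k * (\<Sum>w\<in>N v. f w - f0 w) + c)" for f
    using upd_mean_one_site[OF Suc.prems, of "\<lambda>x. x - f0 v" f] by simp
  then have "mean_after V upd (Suc t) (\<lambda>f. f v - f0 v) f0
      = (1 - 1 / n) * B v + 1 / n * (1 / ?k * (\<Sum>w\<in>N v. B w) + c)"
    unfolding mean_after_Suc_last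
    by (simp only: mean_after_add mean_after_cmult mean_after_sum mean_after_const[OF fin ne] B_def)
  also have "\<bar>\<dots>\<bar> \<le> (1 - 1 / n) * \<bar>B v\<bar> + 1 / n * (1 / ?k * (\<Sum>w\<in>N v. \<bar>B w\<bar>) + \<bar>c\<bar>)"
  proof -
    have "\<bar>\<Sum>w\<in>N v. B w\<bar> \<le> (\<Sum>w\<in>N v. \<bar>B w\<bar>)" by (rule sum_abs)
    then have "1 / ?k * \<bar>\<Sum>w\<in>N v. B w\<bar> \<le> 1 / ?k * (\<Sum>w\<in>N v. \<bar>B w\<bar>)"
      using k by (intro mult_left_mono) auto
    then have "\<bar>1 / ?k * (\<Sum>w\<in>N v. B w) + c\<bar> \<le> 1 / ?k * (\<Sum>w\<in>N v. \<bar>B w\<bar>) + \<bar>c\<bar>"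
      by (intro order.trans[OF abs_triangle_ineq]) (simp add: abs_mult)
    then have "1 / n * \<bar>1 / ?k * (\<Sum>w\<in>N v. B w) + c\<bar> \<le> 1 / n * (1 / ?k * (\<Sum>w\<in>N v. \<bar>B w\<bar>) + \<bar>c\<bar>)"
      using n_pos by (intro mult_left_mono) auto
    moreover have "\<bar>1 - 1 / n\<bar> = 1 - 1 / n" using n_ge_1 by simp
    ultimately show ?thesis using n_pos
      by (intro order.trans[OF abs_triangle_ineq]) (simp add: abs_mult)
  qed
  also have "\<dots> \<le> (1 - 1 / n) * (\<eta> / n * real t) + 1 / n * (1 / ?k * (\<Sum>w\<in>N v. \<eta> / n * real t) + \<eta>)"
    using Suc.prems N_props(2)[of v] n_ge_1 unfolding B_def c_def
    by (intro add_mono mult_left_mono sum_mono Suc.IH \<eta>(2)) auto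
  also have "\<dots> = \<eta> / n * real (Suc t)"
    using k n_pos by (simp add: field_simps)
  finally show ?case .
qed simp

lemma expected_time_ge_of_near_fixed_linear:
  assumes p2: "p = 2" and \<eta>: "0 < \<eta>" "\<And>u. u \<in> V \<Longrightarrow> \<bar>p_mean p (N u) f0 - f0 u\<bar> \<le> \<eta>"
    and f0: "\<And>v. v \<in> V \<Longrightarrow> \<bar>f0 v\<bar> \<le> 1" and xy: "x \<in> V" "y \<in> V" "f0 x - f0 y = 2"
  shows "ennreal (n / (6 * \<eta>)) \<le> expected_time p V adj (1/2) f0"
proof -
  define X where "X = n / (2 * \<eta>)"
  have "0 \<le> X" using \<eta>(1) n_pos by (simp add: X_def)
  then obtain T where T: "X \<le> real T" "\<forall>t<T. real t \<le> X" using nat_floor_bound by blast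
  have "ennreal (real T / 3) \<le> expected_time p V adj (1/2) f0"
  proof (rule expected_time_ge_if_mean_spread[OF f0 xy(1,2)])
    fix t assume "t < T"
    then have "\<eta> / n * real t \<le> \<eta> / n * X"
      using \<eta>(1) n_pos T(2) by (intro mult_left_mono) auto
    also have "\<dots> = 1/2" using \<eta>(1) n_pos by (simp add: X_def)
    finally have half: "\<eta> / n * real t \<le> 1/2" .
    have "mean_after V upd t (\<lambda>f. f x - f y) f0
        = mean_after V upd t (\<lambda>f. f x - f0 x) f0 - mean_after V upd t (\<lambda>f. f y - f0 y) f0 + 2"
      using xy(3) by (simp add: mean_after_diff mean_after_const fin ne)
    then show "1 \<le> mean_after V upd t (\<lambda>f. f x - f y) f0"
      using mean_displacement_linear[OF p2 less_imp_le[OF \<eta>(1)] \<eta>(2) xy(1), of t]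
        mean_displacement_linear[OF p2 less_imp_le[OF \<eta>(1)] \<eta>(2) xy(2), of t] half
      by linarith
  qed
  moreover have "n / (6 * \<eta>) = X / 3" by (simp add: X_def)
  moreover have "ennreal (X / 3) \<le> ennreal (real T / 3)" using T(1) by (intro ennreal_leI) auto
  ultimately show ?thesis by (simp only: order.trans)
qed

section \<open>Lower bound by collecting coupons\<close>

text \<open>Let \<open>a\<close> and \<open>b\<close> be the numbers of vertices of the two colours that have not been updated. The claimed value
\<open>n \<cdot> (harm a + harm b - harm (a + b))\<close> is the expected minimum of the two collection times, by
inclusion and exclusion: \<open>n \<cdot> harm a\<close> is the mean time to collect \<open>a\<close> coupons, and the maximum of both times is the
time to collect all \<open>a + b\<close>. It vanishes when a colour is exhausted and until then decreases in mean by exactly \<open>1\<close> per step, so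
it satisfies the first-step equation of the sojourn time.\<close>

lemma sojourn_two_colours:
  fixes A B :: "'a set"
  defines "alive \<equiv> \<lambda>R. R \<inter> A \<noteq> {} \<and> R \<inter> B \<noteq> {}"
  assumes "A \<inter> B = {}" "R \<subseteq> A \<union> B" "A \<union> B \<subseteq> V"
  shows "ennreal (n * (harm (card (R \<inter> A)) + harm (card (R \<inter> B)) - harm (card R)))
       \<le> mean_sojourn V (\<lambda>R u. R - {u}) alive R"
  using assms(3)
proof (induction "card R" arbitrary: R rule: less_induct)
  case less
  let ?v = "mean_sojourn V (\<lambda>R u. R - {u}) alive"
  let ?h = "\<lambda>R. n * (harm (card (R \<inter> A)) + harm (card (R \<inter> B)) - harm (card R))"
  have finR: "finite R" "R \<subseteq> V" using less.prems assms(4) fin by (auto intro: finite_subset)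
  have R_split: "card R = card (R \<inter> A) + card (R \<inter> B)"
    using less.prems assms(2) finR by (subst card_Un_disjoint[symmetric]) (auto intro!: arg_cong[where f = card])
  show ?case
  proof (cases "alive R \<and> ?v R \<noteq> \<infinity>")
    case False
    then consider "R \<inter> A = {}" | "R \<inter> B = {}" | "?v R = \<infinity>" by (auto simp: alive_def)
    then show ?thesis
      by cases (use R_split in \<open>auto simp: harm_def\<close>)
  next
    case True
    then obtain x where x: "?v R = ennreal x" "0 \<le> x" by (cases "?v R") (auto simp: top_ennreal_def)
    define a where "a = card (R \<inter> A)"
    define b where "b = card (R \<inter> B)"
    have ab: "0 < a" "0 < b" using True finR by (auto simp: a_def b_def alive_def card_gt_0_iff)
    have stepA: "?h (R - {u}) = ?h R - n / a + n / (a + b)" if "u \<in> R \<inter> A" for u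
    proof -
      have "(R - {u}) \<inter> A = R \<inter> A - {u}" "(R - {u}) \<inter> B = R \<inter> B" using that assms(2) by auto
      then have c: "card ((R - {u}) \<inter> A) = a - 1" "card ((R - {u}) \<inter> B) = b" "card (R - {u}) = a + b - 1"
        using that finR R_split by (auto simp: a_def b_def)
      obtain k where "a = Suc k" using ab by (cases a) auto
      then have "harm a = harm (a - 1) + 1 / real a" "harm (a + b) = harm (a + b - 1) + 1 / real (a + b)"
        by (auto simp: harm_Suc inverse_eq_divide)
      moreover have "?h R = n * (harm a + harm b - harm (a + b))" using R_split by (simp add: a_def b_def)
      ultimately show ?thesis unfolding c by (simp add: algebra_simps)
    qed
    have stepB: "?h (R - {u}) = ?h R - n / b + n / (a + b)" if "u \<in> R \<inter> B" for u
    proof -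
      have "(R - {u}) \<inter> B = R \<inter> B - {u}" "(R - {u}) \<inter> A = R \<inter> A" using that assms(2) by auto
      then have c: "card ((R - {u}) \<inter> A) = a" "card ((R - {u}) \<inter> B) = b - 1" "card (R - {u}) = a + b - 1"
        using that finR R_split by (auto simp: a_def b_def)
      obtain k where "b = Suc k" using ab by (cases b) auto
      then have "harm b = harm (b - 1) + 1 / real b" "harm (a + b) = harm (a + b - 1) + 1 / real (a + b)"
        by (auto simp: harm_Suc inverse_eq_divide)
      moreover have "?h R = n * (harm a + harm b - harm (a + b))" using R_split by (simp add: a_def b_def)
      ultimately show ?thesis unfolding c by (simp add: algebra_simps)
    qed
    have "R = (R \<inter> A) \<union> (R \<inter> B)" using less.prems by auto
    then have "(\<Sum>u\<in>R. ?h (R - {u})) = (\<Sum>u\<in>R \<inter> A. ?h (R - {u})) + (\<Sum>u\<in>R \<inter> B. ?h (R - {u}))"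
      using assms(2) finR by (subst sum.union_disjoint[symmetric]) auto
    also have "\<dots> = (\<Sum>u\<in>R \<inter> A. ?h R - n / a + n / (a + b)) + (\<Sum>u\<in>R \<inter> B. ?h R - n / b + n / (a + b))"
      by (intro arg_cong2[where f = "(+)"] sum.cong refl stepA stepB)
    also have "\<dots> = a * (?h R - n / a + n / (a + b)) + b * (?h R - n / b + n / (a + b))"
      by (simp only: sum_constant a_def[symmetric] b_def[symmetric])
    also have "\<dots> = (a + b) * ?h R - n"
    proof -
      have "a * (n / a) = n" "b * (n / b) = n" "(a + b) * (n / (a + b)) = n" using ab by auto
      then show ?thesis by (simp only: distrib_left distrib_right right_diff_distrib of_nat_add)
    qed
    finally have sum_h: "(\<Sum>u\<in>R. ?h (R - {u})) = (a + b) * ?h R - n" .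
    have "ennreal (\<Sum>u\<in>R. ?h (R - {u})) \<le> (\<Sum>u\<in>R. ?v (R - {u}))"
    proof -
      have "ennreal (\<Sum>u\<in>R. ?h (R - {u})) \<le> ennreal (\<Sum>u\<in>R. max 0 (?h (R - {u})))"
        by (intro ennreal_leI sum_mono) auto
      also have "\<dots> = (\<Sum>u\<in>R. ennreal (max 0 (?h (R - {u}))))" by (rule sum_ennreal[symmetric]) simp
      also have "\<dots> = (\<Sum>u\<in>R. ennreal (?h (R - {u})))"
        by (intro sum.cong) (auto simp: max_def ennreal_neg)
      also have "\<dots> \<le> (\<Sum>u\<in>R. ?v (R - {u}))"
      proof (intro sum_mono less.hyps)
        fix u assume "u \<in> R"
        then show "card (R - {u}) < card R" by (rule card_Diff1_less[OF finR(1)])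
        show "R - {u} \<subseteq> A \<union> B" using less.prems by auto
      qed
      finally show ?thesis .
    qed
    then have ins: "ennreal (max 0 ((a + b) * ?h R - n)) \<le> (\<Sum>u\<in>R. ?v (R - {u}))"
      unfolding sum_h by (simp add: max_def ennreal_neg)
    have out: "(\<Sum>u\<in>V - R. ?v (R - {u})) = ennreal ((n - (a + b)) * x)"
    proof -
      have "(\<Sum>u\<in>V - R. ?v (R - {u})) = (\<Sum>u\<in>V - R. ennreal x)"
        using x by (intro sum.cong) auto
      also have "\<dots> = ennreal (real (card (V - R)) * x)"
        using x by (simp add: ennreal_mult ennreal_of_nat_eq_real_of_nat)
      also have "real (card (V - R)) = n - (a + b)"
        using finR R_split card_mono[OF fin finR(2)]
        by (simp add: card_Diff_subset of_nat_diff a_def b_def)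
      finally show ?thesis .
    qed
    have sumV: "(\<Sum>u\<in>V. ?v (R - {u})) = (\<Sum>u\<in>V - R. ?v (R - {u})) + (\<Sum>u\<in>R. ?v (R - {u}))"
      by (rule sum.subset_diff[OF finR(2) fin])
    have nab: "0 \<le> n - (a + b)" 
      using R_split card_mono[OF fin finR(2)] by (simp add: a_def b_def flip: of_nat_add)
    define z where "z = (n - (a + b)) * x + max 0 ((a + b) * ?h R - n)"
    have z0: "0 \<le> z" using nab x(2) by (auto simp: z_def)
    have "ennreal z \<le> (\<Sum>u\<in>V. ?v (R - {u}))"
      unfolding z_def using x nab sumV out ins by (subst ennreal_plus) (auto intro: add_left_mono)
    then have "1 + ennreal z * ennreal (1 / n) \<le> ?v R"
      using True mean_sojourn_first_step[OF fin ne, of "\<lambda>R u. R - {u}" alive R]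
      by (simp add: add_left_mono mult_right_mono)
    moreover have "1 + ennreal z * ennreal (1 / n) = ennreal (1 + z / n)"
      using z0 n_pos ennreal_plus[of 1 "z / n"] by (simp add: ennreal_mult[symmetric])
    ultimately have "1 + z / n \<le> x"
      using x z0 n_pos by (simp del: ennreal_plus)
    then have "n * (1 + z / n) \<le> n * x"
      using n_pos by (intro mult_left_mono) auto
    then have "n + z \<le> n * x"
      using n_pos by (simp add: distrib_left)
    then have "n + ((n - (a + b)) * x + ((a + b) * ?h R - n)) \<le> n * x"
      by (simp add: z_def)
    then have "(a + b) * ?h R \<le> (a + b) * x"
      by (simp add: left_diff_distrib)
    then have "?h R \<le> x" using ab by (simp add: mult_le_cancel_left)
    then show ?thesis using x by (simp add: ennreal_leI)
  qed
qed

text \<open>As long as both colours have a vertex that has not been updated, the values \<open>1\<close> and \<open>-1\<close> are both present.\<close>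

lemma expected_time_ge_two_colours:
  assumes AB: "A \<subseteq> V" "B \<subseteq> V" "A \<inter> B = {}" "card A = k" "card B = k"
    and f0: "\<And>v. v \<in> A \<Longrightarrow> f0 v = 1" "\<And>v. v \<in> B \<Longrightarrow> f0 v = -1"
  shows "ennreal (n * (harm k / 2)) \<le> expected_time p V adj (1/2) f0"
proof -
  let ?alive = "\<lambda>R. R \<inter> A \<noteq> {} \<and> R \<inter> B \<noteq> {}"
  have fAB: "finite A" "finite B" using AB fin by (auto intro: finite_subset)
  have "(A \<union> B) \<inter> A = A" "(A \<union> B) \<inter> B = B" "card (A \<union> B) = 2 * k"
    using AB fAB by (auto simp: card_Un_disjoint)
  then have "ennreal (n * (harm k + harm k - harm (2 * k)))
      \<le> mean_sojourn V (\<lambda>R u. R - {u}) ?alive (A \<union> B)"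
    using sojourn_two_colours[of A B "A \<union> B"] AB by simp
  also have "\<dots> \<le> mean_sojourn V upd (\<lambda>f. 1/2 < osc V f) f0"
    unfolding mean_sojourn_def
  proof (intro suminf_le ennreal_leI)
    fix t
    let ?Rel = "\<lambda>R f. (\<forall>v\<in>R \<inter> A. f v = 1) \<and> (\<forall>v\<in>R \<inter> B. f v = (-1::real))"
    show "mean_after V (\<lambda>R u. R - {u}) t (\<lambda>R. of_bool (?alive R)) (A \<union> B)
        \<le> mean_after V upd t (\<lambda>f. of_bool (1/2 < osc V f)) f0"
    proof (rule mean_after_coupling[where R = ?Rel])
      fix R f assume rel: "?Rel R f"
      have "1/2 < osc V f" if "?alive R"
      proof -
        from that obtain x y where "x \<in> R \<inter> A" "y \<in> R \<inter> B" by auto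
        then have "x \<in> V" "y \<in> V" "f x = 1" "f y = -1" using rel AB by auto
        then show ?thesis using diff_le_osc[of x y f] by simp
      qed
      then show "of_bool (?alive R) \<le> (of_bool (1/2 < osc V f) :: real)" by auto
    qed (use f0 in \<open>auto simp: upd_eq\<close>)
  qed auto
  finally have main: "ennreal (n * (harm k + harm k - harm (2 * k))) \<le> expected_time p V adj (1/2) f0"
    by (simp add: expected_time_eq_sojourn)
  have "n * (harm k / 2) \<le> n * (harm k + harm k - harm (2 * k))"
    using harm_double_le[of k] n_pos by (intro mult_left_mono) auto
  then show ?thesis using main ennreal_leI order.trans by blast
qed

end

context p_dynamics
begin

section \<open>Decay of the energy\<close>

text \<open>Every edge is counted twice, once for each endpoint.\<close>

definition energy :: "('a \<Rightarrow> real) \<Rightarrow> real" where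
  "energy f = (\<Sum>u\<in>V. \<Sum>v\<in>N u. \<bar>f u - f v\<bar> powr p)"

definition local_energy :: "('a \<Rightarrow> real) \<Rightarrow> 'a \<Rightarrow> real \<Rightarrow> real" where
  "local_energy f u x = (\<Sum>v\<in>N u. \<bar>x - f v\<bar> powr p)"

lemma energy_nonneg: "0 \<le> energy f"
  by (simp add: energy_def sum_nonneg)

lemma sum_nbrs_swap: "(\<Sum>u\<in>V. \<Sum>v\<in>N u. G u v) = (\<Sum>u\<in>V. \<Sum>v\<in>N u. G v u)"
proof -
  have "(\<Sum>u\<in>V. \<Sum>v\<in>N u. G u v) = (\<Sum>v\<in>V. \<Sum>u | u \<in> V \<and> adj u v. G u v)"
    unfolding N_def by (rule sum.swap_restrict[OF fin fin])
  also have "\<dots> = (\<Sum>v\<in>V. \<Sum>u\<in>N v. G u v)"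
    unfolding N_def using sym by (intro sum.cong) auto
  finally show ?thesis .
qed

lemma energy_fun_upd:
  assumes "u \<in> V"
  shows "energy (f(u := x)) = energy f + 2 * (local_energy f u x - local_energy f u (f u))"
proof -
  let ?g = "f(u := x)"
  let ?d = "\<lambda>w v. \<bar>?g w - ?g v\<bar> powr p - \<bar>f w - f v\<bar> powr p"
  have at_u: "(\<Sum>v\<in>N u. ?d u v) = local_energy f u x - local_energy f u (f u)"
  proof -
    have "(\<Sum>v\<in>N u. ?d u v) = (\<Sum>v\<in>N u. \<bar>x - f v\<bar> powr p - \<bar>f u - f v\<bar> powr p)"
      using N_props(3)[of u] by (intro sum.cong) auto
    then show ?thesis by (simp add: local_energy_def sum_subtractf)
  qed
  have "(\<Sum>w\<in>V - {u}. \<Sum>v\<in>N w. ?d w v) = (\<Sum>w\<in>V - {u}. if w \<in> N u then ?d w u else 0)"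
  proof (intro sum.cong refl)
    fix w assume w: "w \<in> V - {u}"
    have "(\<Sum>v\<in>N w. ?d w v) = (\<Sum>v\<in>N w. if v = u then ?d w u else 0)"
      using w by (intro sum.cong) auto
    also have "\<dots> = (if u \<in> N w then ?d w u else 0)" using N_props(1) by simp
    also have "u \<in> N w \<longleftrightarrow> w \<in> N u" using w assms N_sym[of u w] N_sym[of w u] by auto
    finally show "(\<Sum>v\<in>N w. ?d w v) = (if w \<in> N u then ?d w u else 0)" .
  qed
  also have "\<dots> = (\<Sum>w\<in>(V - {u}) \<inter> N u. ?d w u)"
    by (rule sum.inter_restrict[symmetric]) (use fin in auto)
  also have "(V - {u}) \<inter> N u = N u" using N_props by auto
  also have "(\<Sum>w\<in>N u. ?d w u) = (\<Sum>w\<in>N u. ?d u w)" by (simp add: abs_minus_commute)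
  finally have others: "(\<Sum>w\<in>V - {u}. \<Sum>v\<in>N w. ?d w v) = local_energy f u x - local_energy f u (f u)"
    using at_u by simp
  have "energy ?g - energy f = (\<Sum>w\<in>V. \<Sum>v\<in>N w. ?d w v)"
    by (simp add: energy_def sum_subtractf)
  also have "\<dots> = (\<Sum>v\<in>N u. ?d u v) + (\<Sum>w\<in>V - {u}. \<Sum>v\<in>N w. ?d w v)"
    by (rule sum.remove[OF fin assms])
  finally show ?thesis unfolding at_u others by simp
qed

text \<open>The p-mean minimizes the local energy, so any other new value for the vertex gives an upper bound.\<close>

lemma energy_upd_le:
  assumes "u \<in> V"
  shows "energy (upd f u) \<le> energy f + 2 * (local_energy f u x - local_energy f u (f u))"
proof -
  have "local_energy f u (p_mean p (N u) f) \<le> local_energy f u x"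
    unfolding local_energy_def by (rule p_mean_minimal) (use N_props assms p_gt_1 in auto)
  then show ?thesis using energy_fun_upd[OF assms, of f "p_mean p (N u) f"] by (simp add: upd_eq)
qed

text \<open>Summation by parts for the discrete p-Laplacian; symmetrizing over the two endpoints of an edge cancels the
constant \<open>m\<close>.\<close>

lemma sum_by_parts:
  "(\<Sum>u\<in>V. \<Sum>v\<in>N u. spow (p - 1) (f u - f v) * (f u - m)) = energy f / 2"
proof -
  let ?A = "\<Sum>u\<in>V. \<Sum>v\<in>N u. spow (p - 1) (f u - f v) * (f u - m)"
  have "?A = (\<Sum>u\<in>V. \<Sum>v\<in>N u. spow (p - 1) (f v - f u) * (f v - m))"
    by (rule sum_nbrs_swap)
  then have "2 * ?A = (\<Sum>u\<in>V. \<Sum>v\<in>N u. spow (p - 1) (f u - f v) * (f u - m) + spow (p - 1) (f v - f u) * (f v - m))"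
    by (simp add: sum.distrib)
  also have "\<dots> = energy f"
    unfolding energy_def
  proof (intro sum.cong refl)
    fix u v
    have "spow (p - 1) (f v - f u) = - spow (p - 1) (f u - f v)"
      using spow_minus[of "p - 1" "f u - f v"] by simp
    then show "spow (p - 1) (f u - f v) * (f u - m) + spow (p - 1) (f v - f u) * (f v - m)
        = \<bar>f u - f v\<bar> powr p"
      unfolding spow_times_self[symmetric] by (simp add: algebra_simps)
  qed
  finally show ?thesis by simp
qed

lemma sum_nbrs_le:
  assumes "\<And>u. u \<in> V \<Longrightarrow> real (card (N u)) \<le> D" "\<And>u. 0 \<le> G u"
  shows "(\<Sum>u\<in>V. \<Sum>v\<in>N u. G u) \<le> D * (\<Sum>u\<in>V. G u)"
  using assms by (auto simp: sum_distrib_left intro!: sum_mono mult_right_mono)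

text \<open>Compare the update of every vertex \<open>u\<close> with the move from \<open>f u\<close> to \<open>f u - \<epsilon> (f u - m)\<close>. The first-order gain adds
up to a multiple of the energy by summation by parts. Thus it suffices that the remainders use up at most half of
that gain.\<close>

lemma sum_energy_upd_le:
  assumes Taylor: "\<And>u v. u \<in> V \<Longrightarrow> v \<in> N u \<Longrightarrow>
     \<bar>(f u - f v) - \<epsilon> * (f u - m)\<bar> powr p
       \<le> \<bar>f u - f v\<bar> powr p - p * spow (p - 1) (f u - f v) * (\<epsilon> * (f u - m)) + rest u v"
    and rest: "(\<Sum>u\<in>V. \<Sum>v\<in>N u. rest u v) \<le> p * \<epsilon> / 4 * energy f"
  shows "(\<Sum>u\<in>V. energy (upd f u)) \<le> (n - p * \<epsilon> / 2) * energy f"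
proof -
  let ?x = "\<lambda>u. f u - \<epsilon> * (f u - m)"
  have "(\<Sum>u\<in>V. energy (upd f u))
      \<le> (\<Sum>u\<in>V. energy f + 2 * (local_energy f u (?x u) - local_energy f u (f u)))"
    by (intro sum_mono energy_upd_le)
  also have "\<dots> = n * energy f + 2 * (\<Sum>u\<in>V. local_energy f u (?x u) - local_energy f u (f u))"
    by (simp add: sum.distrib sum_distrib_left)
  also have "(\<Sum>u\<in>V. local_energy f u (?x u) - local_energy f u (f u))
      \<le> (\<Sum>u\<in>V. \<Sum>v\<in>N u. (- p * \<epsilon>) * (spow (p - 1) (f u - f v) * (f u - m)) + rest u v)"
    unfolding local_energy_def sum_subtractf[symmetric]
  proof (intro sum_mono)
    fix u v assume "u \<in> V" "v \<in> N u"
    from Taylor[OF this]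
    show "\<bar>?x u - f v\<bar> powr p - \<bar>f u - f v\<bar> powr p
        \<le> (- p * \<epsilon>) * (spow (p - 1) (f u - f v) * (f u - m)) + rest u v"
      by (simp add: algebra_simps)
  qed
  also have "\<dots> = (- p * \<epsilon>) * (energy f / 2) + (\<Sum>u\<in>V. \<Sum>v\<in>N u. rest u v)"
    unfolding sum_by_parts[of f m, symmetric] sum.distrib sum_distrib_left by simp
  finally show ?thesis using rest by (simp add: algebra_simps)
qed

text \<open>The remainders sum to a multiple of \<open>\<epsilon> powr p \<cdot> D \<cdot> P\<close> times the energy, and \<open>\<epsilon>\<close> is chosen such that this equals
half of the gain.\<close>

lemma energy_contraction_le2:
  assumes "p \<le> 2" and D: "1 \<le> D" "\<And>u. u \<in> V \<Longrightarrow> real (card (N u)) \<le> D" and P: "0 < P"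
    and Poincare: "(\<Sum>u\<in>V. \<bar>f u - m\<bar> powr p) \<le> P * energy f"
  defines "\<epsilon> \<equiv> (1 / (8 * D * P)) powr (1 / (p - 1))"
  shows "(\<Sum>u\<in>V. energy (upd f u)) \<le> (n - p * \<epsilon> / 2) * energy f"
proof (rule sum_energy_upd_le)
  have \<epsilon>: "0 < \<epsilon>" using D P by (simp add: \<epsilon>_def)
  show "\<bar>(f u - f v) - \<epsilon> * (f u - m)\<bar> powr p
       \<le> \<bar>f u - f v\<bar> powr p - p * spow (p - 1) (f u - f v) * (\<epsilon> * (f u - m))
          + 2 * p * \<epsilon> powr p * \<bar>f u - m\<bar> powr p" for u v
    using powr_Taylor_le2[of p "f u - f v" "\<epsilon> * (f u - m)"] p_gt_1 assms(1) \<epsilon>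
    by (simp add: abs_mult powr_mult mult_ac)
  have "\<epsilon> powr p = \<epsilon> * \<epsilon> powr (p - 1)" using \<epsilon> by (simp add: powr_mult_base)
  also have "\<epsilon> powr (p - 1) = 1 / (8 * D * P)" unfolding \<epsilon>_def using p_gt_1 D P by (simp add: powr_powr)
  finally have \<epsilon>p: "\<epsilon> powr p = \<epsilon> / (8 * D * P)" by simp
  have "(\<Sum>u\<in>V. \<Sum>v\<in>N u. 2 * p * \<epsilon> powr p * \<bar>f u - m\<bar> powr p)
      \<le> D * (\<Sum>u\<in>V. 2 * p * \<epsilon> powr p * \<bar>f u - m\<bar> powr p)"
    using p_gt_1 by (intro sum_nbrs_le D) auto
  also have "\<dots> = 2 * p * D * \<epsilon> powr p * (\<Sum>u\<in>V. \<bar>f u - m\<bar> powr p)"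
    by (simp add: sum_distrib_left mult_ac)
  also have "\<dots> \<le> 2 * p * D * \<epsilon> powr p * (P * energy f)"
    using p_gt_1 D by (intro mult_left_mono Poincare) auto
  also have "\<dots> = p * \<epsilon> / 4 * energy f"
    unfolding \<epsilon>p using D P by (simp add: field_simps)
  finally show "(\<Sum>u\<in>V. \<Sum>v\<in>N u. 2 * p * \<epsilon> powr p * \<bar>f u - m\<bar> powr p) \<le> p * \<epsilon> / 4 * energy f" .
qed

text \<open>With \<open>\<epsilon> = \<theta> / K\<close> both parts of the remainder are of order \<open>\<theta>\<^sup>2 / K\<close> while the gain is of order \<open>\<theta> / K\<close>, so
a small \<open>\<theta>\<close> that depends on \<open>p\<close> only suffices.\<close>

lemma energy_contraction_ge2:
  assumes p2: "2 \<le> p" and D: "1 \<le> D" "\<And>u. u \<in> V \<Longrightarrow> real (card (N u)) \<le> D" and K: "1 \<le> K"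
    and Poincare: "D * (\<Sum>u\<in>V. \<bar>f u - m\<bar> powr p) \<le> K powr (p / 2) * energy f"
  defines "C \<equiv> p * (p - 1) * 2 powr (p - 2)"
  defines "\<epsilon> \<equiv> 1 / ((p + 12 * C) * K)"
  shows "(\<Sum>u\<in>V. energy (upd f u)) \<le> (n - p * \<epsilon> / 2) * energy f"
proof (rule sum_energy_upd_le)
  have C: "0 < C" using p2 by (simp add: C_def)
  define \<theta> where "\<theta> = 1 / (p + 12 * C)"
  have \<theta>: "0 < \<theta>" "\<theta> \<le> 1" "12 * C * \<theta> \<le> 1" using C p2 by (auto simp: \<theta>_def)
  have \<epsilon>\<theta>: "\<epsilon> = \<theta> / K" by (simp add: \<epsilon>_def \<theta>_def)
  have \<epsilon>: "0 < \<epsilon>" using \<theta> K by (simp add: \<epsilon>\<theta>)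
  let ?F = "\<lambda>u. f u - m"
  let ?S = "\<Sum>u\<in>V. \<bar>?F u\<bar> powr p"
  let ?r = "\<lambda>u v. C * (\<epsilon>\<^sup>2 * ((?F u)\<^sup>2 * \<bar>f u - f v\<bar> powr (p - 2)) + \<epsilon> powr p * \<bar>?F u\<bar> powr p)"
  show "\<bar>(f u - f v) - \<epsilon> * ?F u\<bar> powr p
       \<le> \<bar>f u - f v\<bar> powr p - p * spow (p - 1) (f u - f v) * (\<epsilon> * ?F u) + ?r u v" for u v
    using powr_Taylor_ge2[of p "f u - f v" "\<epsilon> * ?F u"] p2 \<epsilon>
    by (simp add: C_def abs_mult powr_mult power_mult_distrib mult_ac)
  (* Scaling F by the square root of K balances the two powers under the assumed inequality. *)
  have bound: "(?F u)\<^sup>2 * \<bar>f u - f v\<bar> powr (p - 2)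
      \<le> K * (K powr (- (p / 2)) * \<bar>?F u\<bar> powr p + \<bar>f u - f v\<bar> powr p)" for u v
  proof -
    have "(?F u)\<^sup>2 * \<bar>f u - f v\<bar> powr (p - 2) = K * ((?F u / sqrt K)\<^sup>2 * \<bar>f u - f v\<bar> powr (p - 2))"
      using K by (simp add: power_divide)
    also have "\<dots> \<le> K * (\<bar>?F u / sqrt K\<bar> powr p + \<bar>f u - f v\<bar> powr p)"
      using K p2 by (intro mult_left_mono sq_powr_le) auto
    also have "\<bar>?F u / sqrt K\<bar> powr p = K powr (- (p / 2)) * \<bar>?F u\<bar> powr p"
      using K by (simp add: powr_divide powr_half_sqrt[symmetric] powr_powr powr_minus_divide)
    finally show ?thesis .
  qed
  have DS: "(\<Sum>u\<in>V. \<Sum>v\<in>N u. \<bar>?F u\<bar> powr p) \<le> K powr (p / 2) * energy f"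
    using sum_nbrs_le[OF D(2), of "\<lambda>u. \<bar>?F u\<bar> powr p"] Poincare by simp
  have "(\<Sum>u\<in>V. \<Sum>v\<in>N u. (?F u)\<^sup>2 * \<bar>f u - f v\<bar> powr (p - 2))
      \<le> (\<Sum>u\<in>V. \<Sum>v\<in>N u. K * (K powr (- (p / 2)) * \<bar>?F u\<bar> powr p + \<bar>f u - f v\<bar> powr p))"
    by (intro sum_mono bound)
  also have "\<dots> = K * (K powr (- (p / 2)) * (\<Sum>u\<in>V. \<Sum>v\<in>N u. \<bar>?F u\<bar> powr p) + energy f)"
    by (simp only: energy_def sum.distrib sum_distrib_left distrib_left)
  also have "\<dots> \<le> K * (K powr (- (p / 2)) * (K powr (p / 2) * energy f) + energy f)"
    using K by (intro mult_left_mono add_right_mono DS) auto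
  also have "\<dots> = 2 * K * energy f"
    using K by (simp add: mult.assoc[symmetric] powr_add[symmetric])
  finally have first: "(\<Sum>u\<in>V. \<Sum>v\<in>N u. (?F u)\<^sup>2 * \<bar>f u - f v\<bar> powr (p - 2)) \<le> 2 * K * energy f" .
  have "\<epsilon> powr p * K powr (p / 2) = \<theta> powr p * K powr (- (p / 2))"
    using K \<theta> by (simp add: \<epsilon>\<theta> powr_divide powr_minus_divide field_simps powr_add[symmetric])
  also have "\<dots> \<le> \<theta> powr 2 * K powr (- 1)"
    using K \<theta> p2 by (intro mult_mono powr_mono powr_mono') auto
  also have "\<dots> = \<theta>\<^sup>2 / K" using K \<theta> by (simp add: powr_minus_divide)
  finally have second: "\<epsilon> powr p * K powr (p / 2) \<le> \<theta>\<^sup>2 / K" .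
  have "(\<Sum>u\<in>V. \<Sum>v\<in>N u. ?r u v)
      = C * (\<epsilon>\<^sup>2 * (\<Sum>u\<in>V. \<Sum>v\<in>N u. (?F u)\<^sup>2 * \<bar>f u - f v\<bar> powr (p - 2))
           + \<epsilon> powr p * (\<Sum>u\<in>V. \<Sum>v\<in>N u. \<bar>?F u\<bar> powr p))"
    by (simp only: sum.distrib sum_distrib_left[symmetric])
  also have "\<dots> \<le> C * (\<epsilon>\<^sup>2 * (2 * K * energy f) + \<epsilon> powr p * (K powr (p / 2) * energy f))"
    using C by (intro mult_left_mono add_mono first DS) auto
  also have "\<dots> = C * (2 * K * \<epsilon>\<^sup>2 + \<epsilon> powr p * K powr (p / 2)) * energy f"
    by (simp add: algebra_simps)
  also have "\<dots> \<le> C * (2 * (\<theta>\<^sup>2 / K) + \<theta>\<^sup>2 / K) * energy f"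
    using C K second energy_nonneg
    by (intro mult_right_mono mult_left_mono add_mono) (auto simp: \<epsilon>\<theta> power2_eq_square)
  also have "\<dots> = 12 * C * \<theta> * (\<epsilon> / 4 * energy f)"
    by (simp add: \<epsilon>\<theta> power2_eq_square)
  also have "\<dots> \<le> p * (\<epsilon> / 4 * energy f)"
    using \<theta> p2 \<epsilon> energy_nonneg by (intro mult_right_mono) auto
  finally show "(\<Sum>u\<in>V. \<Sum>v\<in>N u. ?r u v) \<le> p * \<epsilon> / 4 * energy f" by simp
qed

lemma mean_energy_le:
  assumes "\<And>f. (\<Sum>u\<in>V. energy (upd f u)) / n \<le> \<rho> * energy f" "0 \<le> \<rho>"
  shows "mean_after V upd t energy f \<le> \<rho> ^ t * energy f"
proof (induction t)
  case (Suc t)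
  have "mean_after V upd (Suc t) energy f = mean_after V upd t (\<lambda>f. (\<Sum>u\<in>V. energy (upd f u)) / n) f"
    by (rule mean_after_Suc_last)
  also have "\<dots> \<le> mean_after V upd t (\<lambda>f. \<rho> * energy f) f"
    by (rule mean_after_mono[of UNIV]) (use assms in auto)
  also have "\<dots> = \<rho> * mean_after V upd t energy f" by (rule mean_after_cmult)
  also have "\<dots> \<le> \<rho> * (\<rho> ^ t * energy f)" by (intro mult_left_mono Suc assms)
  finally show ?case by simp
qed simp

text \<open>If the oscillation exceeds \<open>1/2\<close>, some edge has an increment larger than \<open>1 / (2 M)\<close> and the energy is at least
\<open>(1 / (2 M)) powr p\<close>. By Markov's inequality the probability of this event inherits the geometric decay of the
mean energy.\<close>

lemma expected_time_le_of_contraction: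
  assumes contr: "\<And>f. (\<Sum>u\<in>V. energy (upd f u)) \<le> (n - \<gamma>) * energy f"
    and \<gamma>: "0 < \<gamma>" "\<gamma> \<le> 1"
    and D: "1 \<le> D" "\<And>u. u \<in> V \<Longrightarrow> real (card (N u)) \<le> D"
    and M: "1 \<le> M" "\<And>f r. (\<And>u v. u \<in> V \<Longrightarrow> v \<in> N u \<Longrightarrow> \<bar>f u - f v\<bar> \<le> r) \<Longrightarrow> osc V f \<le> M * r"
    and f0: "\<And>v. v \<in> V \<Longrightarrow> \<bar>f0 v\<bar> \<le> 1"
  shows "expected_time p V adj (1/2) f0 \<le> ennreal (n * (ln (n * D * (4 * M) powr p) + 2) / \<gamma>)"
proof -
  define \<kappa> where "\<kappa> = \<gamma> / n"
  have \<kappa>: "0 < \<kappa>" "\<kappa> \<le> 1" using \<gamma> n_ge_1 by (auto simp: \<kappa>_def)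
  define thr where "thr = (1 / (2 * M)) powr p"
  have thr: "0 < thr" using M by (simp add: thr_def)
  have osc_energy: "thr * of_bool (1/2 < osc V f) \<le> energy f" for f
  proof (cases "1/2 < osc V f")
    case True
    have "\<exists>u\<in>V. \<exists>v\<in>N u. 1 / (2 * M) < \<bar>f u - f v\<bar>"
    proof (rule ccontr)
      assume "\<not> ?thesis"
      then have "osc V f \<le> M * (1 / (2 * M))" by (intro M) (auto simp: not_less)
      with True M(1) show False by simp
    qed
    then obtain u v where uv: "u \<in> V" "v \<in> N u" "1 / (2 * M) < \<bar>f u - f v\<bar>" by auto
    have "thr \<le> \<bar>f u - f v\<bar> powr p"
      unfolding thr_def using uv M p_gt_1 by (intro powr_mono2) auto
    also have "\<dots> \<le> (\<Sum>v\<in>N u. \<bar>f u - f v\<bar> powr p)"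
      using uv N_props by (intro member_le_sum[of v]) auto
    also have "\<dots> \<le> energy f"
      unfolding energy_def
      by (rule member_le_sum[of u V "\<lambda>u. \<Sum>v\<in>N u. \<bar>f u - f v\<bar> powr p"]) (use uv fin in \<open>auto intro: sum_nonneg\<close>)
    finally show ?thesis using True by simp
  qed (simp add: energy_nonneg)
  have "energy f0 \<le> (\<Sum>u\<in>V. \<Sum>v\<in>N u. 2 powr p)"
    unfolding energy_def
  proof (intro sum_mono powr_mono2)
    fix u v assume "u \<in> V" "v \<in> N u"
    then show "\<bar>f0 u - f0 v\<bar> \<le> 2" using f0[of u] f0[of v] N_props(2) by force
  qed (use p_gt_1 in auto)
  also have "\<dots> \<le> D * (\<Sum>u\<in>V. 2 powr p)" by (intro sum_nbrs_le D) auto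
  finally have e0: "energy f0 \<le> n * D * 2 powr p" by (simp add: mult_ac)
  define B where "B = n * D * (4 * M) powr p"
  have B_eq: "B = n * D * 2 powr p / thr"
    using M by (simp add: B_def thr_def powr_mult powr_divide) (simp flip: powr_mult)
  have B1: "1 \<le> B"
  proof -
    have "1 \<le> (4 * M) powr p" using M p_gt_1 by (intro ge_one_powr_ge_zero) auto
    then show ?thesis unfolding B_def using n_ge_1 D(1)
      by (intro order.trans[OF _ mult_mono[of 1 "n * D" 1]] order.trans[OF _ mult_mono[of 1 n 1 D]]) auto
  qed
  have "mean_sojourn V upd (\<lambda>f. 1/2 < osc V f) f0 \<le> ennreal ((ln B + 2) / \<kappa>)"
  proof (rule mean_sojourn_le_geometric[OF fin ne \<kappa> B1])
    fix t
    have step: "(\<Sum>u\<in>V. energy (upd f u)) / n \<le> (1 - \<kappa>) * energy f" for f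
      using contr[of f] n_pos by (simp add: \<kappa>_def field_simps)
    have "thr * mean_after V upd t (\<lambda>f. of_bool (1/2 < osc V f)) f0
        = mean_after V upd t (\<lambda>f. thr * of_bool (1/2 < osc V f)) f0"
      by (simp only: mean_after_cmult)
    also have "\<dots> \<le> mean_after V upd t energy f0"
      by (rule mean_after_mono[of UNIV]) (use osc_energy in auto)
    also have "\<dots> \<le> (1 - \<kappa>) ^ t * energy f0"
      using \<kappa> by (intro mean_energy_le step) auto
    also have "\<dots> \<le> (1 - \<kappa>) ^ t * (n * D * 2 powr p)"
      using \<kappa> e0 by (intro mult_left_mono) auto
    finally show "mean_after V upd t (\<lambda>f. of_bool (1/2 < osc V f)) f0 \<le> B * (1 - \<kappa>) ^ t"
      using thr by (simp add: B_eq field_simps)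
  qed
  then show ?thesis by (simp add: expected_time_eq_sojourn B_def \<kappa>_def mult.commute)
qed

end

section \<open>Poincare inequality on the box\<close>

text \<open>Jensen's inequality, as the sum of the tangent inequalities at the mean.\<close>

lemma mean_powr_le:
  fixes x :: "'i \<Rightarrow> real"
  assumes "finite I" "I \<noteq> {}" "1 < p"
  shows "\<bar>(\<Sum>i\<in>I. x i) / card I\<bar> powr p \<le> (\<Sum>i\<in>I. \<bar>x i\<bar> powr p) / card I"
proof -
  let ?m = "(\<Sum>i\<in>I. x i) / card I"
  have c: "0 < real (card I)" using assms by (simp add: card_gt_0_iff)
  have "0 = (\<Sum>i\<in>I. p * spow (p - 1) ?m * (x i - ?m))"
    using c by (simp add: sum_distrib_left[symmetric] sum_subtractf)
  also have "\<dots> \<le> (\<Sum>i\<in>I. \<bar>x i\<bar> powr p - \<bar>?m\<bar> powr p)"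
    by (intro sum_mono powr_tangent assms)
  also have "\<dots> = (\<Sum>i\<in>I. \<bar>x i\<bar> powr p) - card I * \<bar>?m\<bar> powr p"
    by (simp add: sum_subtractf)
  finally have "card I * \<bar>?m\<bar> powr p \<le> (\<Sum>i\<in>I. \<bar>x i\<bar> powr p)" by simp
  then show ?thesis using c by (simp only: pos_le_divide_eq mult.commute)
qed

lemma abs_diff_le_sum_increments:
  fixes a :: "nat \<Rightarrow> real"
  assumes "j \<le> k" "k < L"
  shows "\<bar>a k - a j\<bar> \<le> (\<Sum>i<L - 1. \<bar>a (Suc i) - a i\<bar>)"
proof -
  have "a k - a j = (\<Sum>i=j..<k. a (Suc i) - a i)" using assms(1) by (simp add: sum_Suc_diff')
  also have "\<bar>\<dots>\<bar> \<le> (\<Sum>i=j..<k. \<bar>a (Suc i) - a i\<bar>)" by (rule sum_abs)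
  also have "\<dots> \<le> (\<Sum>i<L - 1. \<bar>a (Suc i) - a i\<bar>)"
    using assms by (intro sum_mono2) auto
  finally show ?thesis .
qed

text \<open>Replace the mean by an average over \<open>j\<close> and bound the difference between positions \<open>j\<close> and \<open>k\<close> by the sum of the
increments in between.\<close>

lemma segment_Poincare:
  fixes a :: "nat \<Rightarrow> real"
  assumes "1 < p"
  shows "(\<Sum>k<L. \<bar>a k - (\<Sum>j<L. a j) / L\<bar> powr p) \<le> real L powr p * (\<Sum>i<L - 1. \<bar>a (Suc i) - a i\<bar> powr p)"
proof (cases "L \<le> 1")
  case True
  then have "L = 0 \<or> L = 1" by auto
  then show ?thesis by auto
next
  case False
  let ?E = "\<Sum>i<L - 1. \<bar>a (Suc i) - a i\<bar> powr p"
  have E0: "0 \<le> ?E" by (simp add: sum_nonneg)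
  have L: "0 < real L" using False by simp
  define Q where "Q = real L powr (p - 1) * ?E"
  have L_pow: "real L * real L powr (p - 1) = real L powr p" using L by (simp add: powr_mult_base)
  have pair: "\<bar>a k - a j\<bar> powr p \<le> Q" if "k < L" "j < L" for k j
  proof -
    let ?T = "\<Sum>i<L - 1. \<bar>a (Suc i) - a i\<bar>" and ?l = "real (L - 1)"
    have l: "0 < ?l" "?l \<le> real L" using False by auto
    have "\<bar>a k - a j\<bar> \<le> ?T"
      using abs_diff_le_sum_increments[of j k L a] abs_diff_le_sum_increments[of k j L a] that
      by (cases "j \<le> k") (auto simp: abs_minus_commute)
    then have "\<bar>a k - a j\<bar> powr p \<le> ?T powr p" using assms by (intro powr_mono2) auto
    also have "\<dots> = ?l powr p * \<bar>?T / ?l\<bar> powr p"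
      using l by (simp add: powr_mult[symmetric] sum_nonneg)
    also have "\<dots> \<le> ?l powr p * (?E / ?l)"
      using mean_powr_le[of "{..<L - 1}" p "\<lambda>i. \<bar>a (Suc i) - a i\<bar>"] False assms
      by (intro mult_left_mono) (auto simp: lessThan_empty_iff)
    also have "\<dots> = ?l powr (p - 1) * ?E" using l by (simp add: powr_diff)
    also have "\<dots> \<le> Q" unfolding Q_def using l assms E0 by (intro mult_right_mono powr_mono2) auto
    finally show ?thesis .
  qed
  have "\<bar>a k - (\<Sum>j<L. a j) / L\<bar> powr p \<le> Q" if "k < L" for k
  proof -
    have "a k - (\<Sum>j<L. a j) / L = (\<Sum>j<L. a k - a j) / real (card {..<L})"
      using L by (simp add: sum_subtractf diff_divide_distrib)
    then have "\<bar>a k - (\<Sum>j<L. a j) / L\<bar> powr p \<le> (\<Sum>j<L. \<bar>a k - a j\<bar> powr p) / L"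
      using mean_powr_le[of "{..<L}" p "\<lambda>j. a k - a j"] assms False by (auto simp: lessThan_empty_iff)
    also have "\<dots> \<le> (\<Sum>j<L. Q) / L"
      using that by (intro divide_right_mono sum_mono pair) auto
    finally show ?thesis using L by simp
  qed
  then have "(\<Sum>k<L. \<bar>a k - (\<Sum>j<L. a j) / L\<bar> powr p) \<le> (\<Sum>k<L. Q)" by (intro sum_mono) auto
  also have "\<dots> = real L powr p * ?E" by (simp add: Q_def L_pow flip: mult.assoc)
  finally show ?thesis .
qed

lemma finite_box: "finite (box_verts d L)"
  by (simp add: box_verts_def finite_PiE)

lemma card_box: "card (box_verts d L) = L ^ d"
  by (simp add: box_verts_def card_PiE)

lemma sum_box_Suc:
  "(\<Sum>x\<in>box_verts (Suc d) L. h x) = (\<Sum>g\<in>box_verts d L. \<Sum>k<L. h (g(d := k)))"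
proof -
  have "box_verts (Suc d) L = (\<lambda>(y, g). g(d := y)) ` ({..<L} \<times> box_verts d L)"
    by (simp add: box_verts_def lessThan_Suc PiE_insert_eq)
  moreover have "inj_on (\<lambda>(y, g). g(d := y)) ({..<L} \<times> box_verts d L)"
    unfolding box_verts_def by (rule inj_combinator) simp
  ultimately have "(\<Sum>x\<in>box_verts (Suc d) L. h x) = (\<Sum>(k, g)\<in>{..<L} \<times> box_verts d L. h (g(d := k)))"
    by (simp only: sum.reindex) (simp add: o_def case_prod_beta)
  also have "\<dots> = (\<Sum>k<L. \<Sum>g\<in>box_verts d L. h (g(d := k)))"
    by (simp add: sum.cartesian_product)
  also have "\<dots> = (\<Sum>g\<in>box_verts d L. \<Sum>k<L. h (g(d := k)))" by (rule sum.swap)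
  finally show ?thesis .
qed

text \<open>Every edge occurs once here, in the direction of its increasing coordinate, whereas \<open>energy\<close> counts it twice. In this
form the sum splits along the last coordinate.\<close>

definition forward_sum :: "nat \<Rightarrow> nat \<Rightarrow> ((nat \<Rightarrow> nat) \<Rightarrow> (nat \<Rightarrow> nat) \<Rightarrow> real) \<Rightarrow> real" where
  "forward_sum d L G = (\<Sum>i<d. \<Sum>x\<in>box_verts d L. if x i + 1 < L then G x (x(i := x i + 1)) else 0)"

lemma sum_shorten: "(\<Sum>k<L. if Suc k < L then h k else 0) = (\<Sum>k<L - 1. h k :: real)"
proof -
  have "(\<Sum>k<L. if Suc k < L then h k else 0) = (\<Sum>k\<in>{..<L} \<inter> {k. Suc k < L}. h k)"
    by (subst sum.inter_restrict) auto
  also have "{..<L} \<inter> {k. Suc k < L} = {..<L - 1}" by auto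
  finally show ?thesis .
qed

text \<open>The edges of the box with one more dimension are those inside the layers \<open>x d = k\<close> and those on the fibres in
direction \<open>d\<close>.\<close>

lemma forward_sum_Suc:
  "forward_sum (Suc d) L G = (\<Sum>k<L. forward_sum d L (\<lambda>x y. G (x(d := k)) (y(d := k))))
     + (\<Sum>g\<in>box_verts d L. \<Sum>k<L - 1. G (g(d := k)) (g(d := Suc k)))"
proof -
  have "(\<Sum>i<d. \<Sum>x\<in>box_verts (Suc d) L. if x i + 1 < L then G x (x(i := x i + 1)) else 0)
      = (\<Sum>i<d. \<Sum>k<L. \<Sum>g\<in>box_verts d L. if g i + 1 < L then G (g(d := k)) ((g(i := g i + 1))(d := k)) else 0)"
  proof (intro sum.cong refl)
    fix i assume "i \<in> {..<d}"
    then have i: "i < d" by simp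
    then have tw: "(g(d := k))(i := g i + 1) = (g(i := g i + 1))(d := k)" for g :: "nat \<Rightarrow> nat" and k
      by (auto simp: fun_upd_twist)
    have "(\<Sum>x\<in>box_verts (Suc d) L. if x i + 1 < L then G x (x(i := x i + 1)) else 0)
       = (\<Sum>g\<in>box_verts d L. \<Sum>k<L. if g i + 1 < L then G (g(d := k)) ((g(i := g i + 1))(d := k)) else 0)"
      unfolding sum_box_Suc
    proof (intro sum.cong refl)
      fix g :: "nat \<Rightarrow> nat" and k :: nat
      have "(g(d := k)) i = g i" using i by simp
      then show "(if (g(d := k)) i + 1 < L then G (g(d := k)) ((g(d := k))(i := (g(d := k)) i + 1)) else 0)
         = (if g i + 1 < L then G (g(d := k)) ((g(i := g i + 1))(d := k)) else 0)"
        by (simp only: tw)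
    qed
    also have "\<dots> = (\<Sum>k<L. \<Sum>g\<in>box_verts d L. if g i + 1 < L then G (g(d := k)) ((g(i := g i + 1))(d := k)) else 0)"
      by (rule sum.swap)
    finally show "(\<Sum>x\<in>box_verts (Suc d) L. if x i + 1 < L then G x (x(i := x i + 1)) else 0)
       = (\<Sum>k<L. \<Sum>g\<in>box_verts d L. if g i + 1 < L then G (g(d := k)) ((g(i := g i + 1))(d := k)) else 0)" .
  qed
  also have "\<dots> = (\<Sum>k<L. forward_sum d L (\<lambda>x y. G (x(d := k)) (y(d := k))))"
    unfolding forward_sum_def by (rule sum.swap)
  finally have first: "(\<Sum>i<d. \<Sum>x\<in>box_verts (Suc d) L. if x i + 1 < L then G x (x(i := x i + 1)) else 0)
     = (\<Sum>k<L. forward_sum d L (\<lambda>x y. G (x(d := k)) (y(d := k))))" .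
  have last: "(\<Sum>x\<in>box_verts (Suc d) L. if x d + 1 < L then G x (x(d := x d + 1)) else 0)
     = (\<Sum>g\<in>box_verts d L. \<Sum>k<L - 1. G (g(d := k)) (g(d := Suc k)))"
    by (simp add: sum_box_Suc sum_shorten)
  show ?thesis by (simp only: forward_sum_def[of "Suc d"] sum.lessThan_Suc first last)
qed

lemma forward_sum_mono:
  "(\<And>x y. G x y \<le> H x y) \<Longrightarrow> forward_sum d L G \<le> forward_sum d L H"
  unfolding forward_sum_def by (intro sum_mono) auto

lemma forward_sum_sum: "forward_sum d L (\<lambda>x y. \<Sum>k\<in>A. G k x y) = (\<Sum>k\<in>A. forward_sum d L (G k))"
proof -
  have "forward_sum d L (\<lambda>x y. \<Sum>k\<in>A. G k x y)
     = (\<Sum>i<d. \<Sum>x\<in>box_verts d L. \<Sum>k\<in>A. if x i + 1 < L then G k x (x(i := x i + 1)) else 0)"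
    unfolding forward_sum_def by (intro sum.cong) auto
  also have "\<dots> = (\<Sum>i<d. \<Sum>k\<in>A. \<Sum>x\<in>box_verts d L. if x i + 1 < L then G k x (x(i := x i + 1)) else 0)"
    by (intro sum.cong refl sum.swap)
  also have "\<dots> = (\<Sum>k\<in>A. forward_sum d L (G k))"
    unfolding forward_sum_def by (rule sum.swap)
  finally show ?thesis .
qed

lemma forward_sum_divide: "forward_sum d L (\<lambda>x y. G x y / c) = forward_sum d L G / c"
  unfolding forward_sum_def sum_divide_distrib by (intro sum.cong) auto

text \<open>The constant does not depend on the dimension. Average over the last coordinate: the differences of \<open>f\<close> from the
fibre means \<open>fb\<close> have mean zero on each fibre, so the linear term of the expansion around \<open>fb g - mean\<close> vanishes, as in
the inequality of von Bahr and Esseen for martingales. The fibres contribute the inequality on a segment; the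
function \<open>fb\<close> lives on a box of lower dimension and its energy is at most the average energy of the layers.\<close>

lemma box_Poincare:
  fixes f :: "(nat \<Rightarrow> nat) \<Rightarrow> real"
  assumes p: "1 < p" "p \<le> 2" and L: "1 \<le> L"
  defines "mean \<equiv> \<lambda>d f. (\<Sum>x\<in>box_verts d L. f x) / real (L ^ d)"
  shows "(\<Sum>x\<in>box_verts d L. \<bar>f x - mean d f\<bar> powr p)
      \<le> 2 * p * real L powr p * forward_sum d L (\<lambda>x y. \<bar>f y - f x\<bar> powr p)"
proof (induction d arbitrary: f)
  case 0
  show ?case by (simp add: mean_def forward_sum_def box_verts_def)
next
  case (Suc d)
  define fb where "fb g = (\<Sum>k<L. f (g(d := k))) / L" for g
  let ?\<mu> = "mean (Suc d) f" and ?c = "2 * p * real L powr p"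
  have Lp: "0 < real L" using L by simp
  have mean_fb: "mean d fb = ?\<mu>"
    using Lp by (simp add: mean_def fb_def sum_box_Suc sum_divide_distrib[symmetric])
  have fibre: "(\<Sum>k<L. \<bar>f (g(d := k)) - ?\<mu>\<bar> powr p)
     \<le> L * \<bar>fb g - ?\<mu>\<bar> powr p + ?c * (\<Sum>k<L - 1. \<bar>f (g(d := Suc k)) - f (g(d := k))\<bar> powr p)" for g
  proof -
    let ?s = "p * spow (p - 1) (fb g - ?\<mu>)"
    have "(\<Sum>k<L. \<bar>f (g(d := k)) - ?\<mu>\<bar> powr p)
      \<le> (\<Sum>k<L. \<bar>fb g - ?\<mu>\<bar> powr p + ?s * (f (g(d := k)) - fb g) + 2 * p * \<bar>f (g(d := k)) - fb g\<bar> powr p)"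
    proof (rule sum_mono)
      fix k
      show "\<bar>f (g(d := k)) - ?\<mu>\<bar> powr p
        \<le> \<bar>fb g - ?\<mu>\<bar> powr p + ?s * (f (g(d := k)) - fb g) + 2 * p * \<bar>f (g(d := k)) - fb g\<bar> powr p"
        using powr_Taylor_le2[OF p, of "fb g - ?\<mu>" "fb g - f (g(d := k))"]
        by (simp add: abs_minus_commute algebra_simps)
    qed
    also have "\<dots> = L * \<bar>fb g - ?\<mu>\<bar> powr p + ?s * (\<Sum>k<L. f (g(d := k)) - fb g)
        + 2 * p * (\<Sum>k<L. \<bar>f (g(d := k)) - fb g\<bar> powr p)"
      by (simp only: sum.distrib sum_distrib_left[symmetric] sum_constant card_lessThan)
    also have "(\<Sum>k<L. f (g(d := k)) - fb g) = 0"
      using Lp by (simp add: sum_subtractf fb_def)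
    also have "2 * p * (\<Sum>k<L. \<bar>f (g(d := k)) - fb g\<bar> powr p)
       \<le> 2 * p * (real L powr p * (\<Sum>k<L - 1. \<bar>f (g(d := Suc k)) - f (g(d := k))\<bar> powr p))"
      unfolding fb_def using p by (intro mult_left_mono segment_Poincare) auto
    finally show ?thesis by (simp only: mult_zero_right add_0_right mult.assoc)
  qed
  have Jensen: "\<bar>fb y - fb x\<bar> powr p \<le> (\<Sum>k<L. \<bar>f (y(d := k)) - f (x(d := k))\<bar> powr p) / L" for x y
    using mean_powr_le[of "{..<L}" p "\<lambda>k. f (y(d := k)) - f (x(d := k))"] L p
    by (auto simp: fb_def sum_subtractf diff_divide_distrib lessThan_empty_iff)
  have "(\<Sum>x\<in>box_verts (Suc d) L. \<bar>f x - ?\<mu>\<bar> powr p)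
     = (\<Sum>g\<in>box_verts d L. \<Sum>k<L. \<bar>f (g(d := k)) - ?\<mu>\<bar> powr p)" by (rule sum_box_Suc)
  also have "\<dots> \<le> (\<Sum>g\<in>box_verts d L. L * \<bar>fb g - ?\<mu>\<bar> powr p
        + ?c * (\<Sum>k<L - 1. \<bar>f (g(d := Suc k)) - f (g(d := k))\<bar> powr p))"
    by (intro sum_mono fibre)
  also have "\<dots> = L * (\<Sum>g\<in>box_verts d L. \<bar>fb g - mean d fb\<bar> powr p)
        + ?c * (\<Sum>g\<in>box_verts d L. \<Sum>k<L - 1. \<bar>f (g(d := Suc k)) - f (g(d := k))\<bar> powr p)"
    by (simp only: sum.distrib sum_distrib_left mean_fb)
  also have "L * (\<Sum>g\<in>box_verts d L. \<bar>fb g - mean d fb\<bar> powr p)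
      \<le> L * (?c * forward_sum d L (\<lambda>x y. \<bar>fb y - fb x\<bar> powr p))"
    by (intro mult_left_mono Suc.IH) simp
  also have "\<dots> \<le> L * (?c * forward_sum d L (\<lambda>x y. (\<Sum>k<L. \<bar>f (y(d := k)) - f (x(d := k))\<bar> powr p) / L))"
    using p by (intro mult_left_mono forward_sum_mono Jensen) auto
  also have "\<dots> = ?c * (\<Sum>k<L. forward_sum d L (\<lambda>x y. \<bar>f (y(d := k)) - f (x(d := k))\<bar> powr p))"
    using Lp by (simp add: forward_sum_divide forward_sum_sum)
  finally show ?case unfolding forward_sum_Suc by (simp only: distrib_left)
qed

lemma box_coord_less: "x \<in> box_verts d L \<Longrightarrow> i < d \<Longrightarrow> x i < L"
  by (auto simp: box_verts_def PiE_iff)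

lemma box_upd: "x \<in> box_verts d L \<Longrightarrow> i < d \<Longrightarrow> k < L \<Longrightarrow> x(i := k) \<in> box_verts d L"
  by (auto simp: box_verts_def PiE_iff extensional_def)

lemma box_adj_up:
  assumes "u \<in> box_verts d L" "i < d" "u i + 1 < L"
  shows "box_adj d L u (u(i := u i + 1))"
  unfolding box_adj_def using assms box_upd[OF assms] by blast

lemma box_adj_down:
  assumes "u \<in> box_verts d L" "i < d" "0 < u i"
  shows "box_adj d L u (u(i := u i - 1))"
proof -
  have "u i - 1 < L" using box_coord_less[OF assms(1,2)] by simp
  then have "u(i := u i - 1) \<in> box_verts d L" using assms by (intro box_upd)
  moreover have "u = (u(i := u i - 1))(i := (u(i := u i - 1)) i + 1)" using assms(3) by simp
  ultimately show ?thesis unfolding box_adj_def using assms(1,2) by blast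
qed

lemma box_adj_in: "box_adj d L u v \<Longrightarrow> v \<in> box_verts d L"
  by (simp add: box_adj_def)

section \<open>The dynamics on the box\<close>

locale box_dynamics =
  fixes d L :: nat and p :: real
  assumes d2: "2 \<le> d" and L2: "2 \<le> L" and p1: "1 < p"
begin

lemma zero_in_box: "(\<lambda>i\<in>{..<d}. 0) \<in> box_verts d L"
  using L2 by (auto simp: box_verts_def)

sublocale p_dynamics "box_verts d L" "box_adj d L" p
proof
  show "finite (box_verts d L)" by (rule finite_box)
  show "box_verts d L \<noteq> {}" using zero_in_box by auto
  show "box_adj d L u v \<Longrightarrow> box_adj d L v u" for u v by (auto simp: box_adj_def)
  show "\<not> box_adj d L u u" for u
  proof
    assume "box_adj d L u u"
    then obtain i where "u = u(i := u i + 1)" by (auto simp: box_adj_def)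
    from fun_cong[OF this, of i] show False by simp
  qed
  show "\<exists>v\<in>box_verts d L. box_adj d L u v" if u: "u \<in> box_verts d L" for u
  proof (cases "u 0 = 0")
    case True
    then have "box_adj d L u (u(0 := u 0 + 1))" using u d2 L2 by (intro box_adj_up) auto
    then show ?thesis using box_adj_in by blast
  next
    case False
    then have "box_adj d L u (u(0 := u 0 - 1))" using u d2 by (intro box_adj_down) auto
    then show ?thesis using box_adj_in by blast
  qed
  show "1 < p" by (rule p1)
qed

lemma N_eq:
  assumes u: "u \<in> box_verts d L"
  shows "N u = (\<lambda>i. u(i := u i + 1)) ` {i. i < d \<and> u i + 1 < L} \<union> (\<lambda>i. u(i := u i - 1)) ` {i. i < d \<and> 0 < u i}"
proof (intro equalityI subsetI)
  fix v assume "v \<in> N u"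
  then have v: "v \<in> box_verts d L" "box_adj d L u v" by (auto simp: N_def)
  then obtain i where i: "i < d" "v = u(i := u i + 1) \<or> u = v(i := v i + 1)" by (auto simp: box_adj_def)
  from i(2) show "v \<in> (\<lambda>i. u(i := u i + 1)) ` {i. i < d \<and> u i + 1 < L} \<union> (\<lambda>i. u(i := u i - 1)) ` {i. i < d \<and> 0 < u i}"
  proof
    assume *: "v = u(i := u i + 1)"
    then have "u i + 1 < L" using box_coord_less[OF v(1) i(1)] by simp
    with * i show ?thesis by auto
  next
    assume *: "u = v(i := v i + 1)"
    then have "0 < u i" "v = u(i := u i - 1)" by (auto simp: fun_eq_iff)
    with i show ?thesis by auto
  qed
next
  fix v assume "v \<in> (\<lambda>i. u(i := u i + 1)) ` {i. i < d \<and> u i + 1 < L} \<union> (\<lambda>i. u(i := u i - 1)) ` {i. i < d \<and> 0 < u i}"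
  then show "v \<in> N u"
  proof (elim UnE imageE)
    fix i assume "v = u(i := u i + 1)" "i \<in> {i. i < d \<and> u i + 1 < L}"
    then have "box_adj d L u v" using box_adj_up[OF u] by simp
    then show ?thesis using box_adj_in by (auto simp: N_def)
  next
    fix i assume "v = u(i := u i - 1)" "i \<in> {i. i < d \<and> 0 < u i}"
    then have "box_adj d L u v" using box_adj_down[OF u] by simp
    then show ?thesis using box_adj_in by (auto simp: N_def)
  qed
qed

lemma sum_N:
  fixes h :: "(nat \<Rightarrow> nat) \<Rightarrow> real"
  assumes u: "u \<in> box_verts d L"
  shows "(\<Sum>v\<in>N u. h v) = (\<Sum>i<d. (if u i + 1 < L then h (u(i := u i + 1)) else 0)
                              + (if 0 < u i then h (u(i := u i - 1)) else 0))"
proof -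
  let ?F = "{i. i < d \<and> u i + 1 < L}" and ?B = "{i. i < d \<and> 0 < u i}"
  have injF: "inj_on (\<lambda>i. u(i := u i + 1)) ?F"
  proof (rule inj_onI)
    fix i j assume "u(i := u i + 1) = u(j := u j + 1)"
    from fun_cong[OF this, of i] show "i = j" by (auto split: if_splits)
  qed
  have injB: "inj_on (\<lambda>i. u(i := u i - 1)) ?B"
  proof (rule inj_onI)
    fix i j assume ij: "i \<in> ?B" "u(i := u i - 1) = u(j := u j - 1)"
    from fun_cong[OF ij(2), of i] ij(1) show "i = j" by (auto split: if_splits)
  qed
  have disj: "(\<lambda>i. u(i := u i + 1)) ` ?F \<inter> (\<lambda>i. u(i := u i - 1)) ` ?B = {}"
  proof (rule ccontr)
    assume "\<not> ?thesis"
    then obtain i j where "0 < u j" "u(i := u i + 1) = u(j := u j - 1)" by auto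
    from fun_cong[OF this(2), of i] this(1) show False by (auto split: if_splits)
  qed
  have "(\<Sum>v\<in>N u. h v) = (\<Sum>i\<in>?F. h (u(i := u i + 1))) + (\<Sum>i\<in>?B. h (u(i := u i - 1)))"
    unfolding N_eq[OF u]
  proof (subst sum.union_disjoint)
    show "finite ((\<lambda>i. u(i := u i + 1)) ` ?F)" "finite ((\<lambda>i. u(i := u i - 1)) ` ?B)" by auto
  qed (simp_all only: disj sum.reindex[OF injF] sum.reindex[OF injB] o_def)
  also have "?F = {..<d} \<inter> {i. u i + 1 < L}" by auto
  also have "?B = {..<d} \<inter> {i. 0 < u i}" by auto
  finally show ?thesis by (simp only: sum.inter_restrict[OF finite_lessThan] sum.distrib mem_Collect_eq)
qed

lemma card_N_le: "u \<in> box_verts d L \<Longrightarrow> real (card (N u)) \<le> 2 * real d"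
proof -
  assume u: "u \<in> box_verts d L"
  have "real (card (N u)) = (\<Sum>v\<in>N u. 1)" by simp
  also have "\<dots> \<le> (\<Sum>i<d. 2)" unfolding sum_N[OF u] by (intro sum_mono) auto
  finally show ?thesis by simp
qed

lemma forward_sum_le:
  assumes "\<And>x y. 0 \<le> G x y"
  shows "forward_sum d L G \<le> (\<Sum>u\<in>box_verts d L. \<Sum>v\<in>N u. G u v)"
proof -
  have "forward_sum d L G = (\<Sum>x\<in>box_verts d L. \<Sum>i<d. if x i + 1 < L then G x (x(i := x i + 1)) else 0)"
    unfolding forward_sum_def by (rule sum.swap)
  also have "\<dots> \<le> (\<Sum>u\<in>box_verts d L. \<Sum>v\<in>N u. G u v)"
    by (intro sum_mono) (auto simp: sum_N assms intro!: sum_mono)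
  finally show ?thesis .
qed

lemma osc_le_Lipschitz:
  assumes "\<And>u v. u \<in> box_verts d L \<Longrightarrow> v \<in> N u \<Longrightarrow> \<bar>f u - f v\<bar> \<le> r"
  shows "osc (box_verts d L) f \<le> 2 * real d * real L * r"
proof -
  let ?o = "\<lambda>i\<in>{..<d}. 0 :: nat"
  have r0: "0 \<le> r"
  proof -
    obtain v where "v \<in> N ?o" using N_props(4)[OF zero_in_box] by auto
    then show ?thesis using assms[OF zero_in_box] by fastforce
  qed
  have dist: "\<bar>f u - f ?o\<bar> \<le> r * real (\<Sum>i<d. u i)" if "u \<in> box_verts d L" for u
    using that
  proof (induction "\<Sum>i<d. u i" arbitrary: u)
    case 0
    then have "u i = 0" if "i < d" for i using that by auto
    then have "u = ?o" using 0(2) by (auto simp: box_verts_def PiE_iff extensional_def fun_eq_iff)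
    then show ?case by simp
  next
    case (Suc s)
    then have "\<exists>i<d. 0 < u i" by (metis (no_types, lifting) gr0I lessThan_iff sum.neutral Zero_not_Suc)
    then obtain i where i: "i < d" "0 < u i" by auto
    let ?v = "u(i := u i - 1)"
    have v: "?v \<in> N u" unfolding N_eq[OF Suc.prems] using i by auto
    then have vb: "?v \<in> box_verts d L" using N_props(2) by auto
    have "(\<Sum>j<d. u j) = u i + (\<Sum>j\<in>{..<d} - {i}. u j)" using i by (intro sum.remove) auto
    moreover have "(\<Sum>j<d. ?v j) = ?v i + (\<Sum>j\<in>{..<d} - {i}. ?v j)" using i by (intro sum.remove) auto
    moreover have "(\<Sum>j\<in>{..<d} - {i}. ?v j) = (\<Sum>j\<in>{..<d} - {i}. u j)" by (intro sum.cong) auto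
    ultimately have s: "s = (\<Sum>j<d. ?v j)" using Suc(2) i by simp
    have "\<bar>f ?v - f ?o\<bar> \<le> r * real s" using Suc(1)[OF s vb] s by simp
    moreover have "\<bar>f u - f ?v\<bar> \<le> r" by (rule assms[OF Suc.prems v])
    ultimately have "\<bar>f u - f ?o\<bar> \<le> r * real s + r" by linarith
    then show ?case using Suc(2) by (simp flip: Suc(2) add: algebra_simps)
  qed
  have len: "real (\<Sum>i<d. u i) \<le> real d * real L" if "u \<in> box_verts d L" for u
  proof -
    have "(\<Sum>i<d. u i) \<le> (\<Sum>i<d. L)" using box_coord_less[OF that] by (intro sum_mono) (auto simp: less_imp_le)
    also have "\<dots> = d * L" by simp
    finally show ?thesis by (simp only: of_nat_le_iff of_nat_mult[symmetric])
  qed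
  have near: "\<bar>f u - f ?o\<bar> \<le> r * (real d * real L)" if "u \<in> box_verts d L" for u
    using dist[OF that] mult_left_mono[OF len[OF that] r0] by linarith
  show ?thesis
  proof (rule osc_leI)
    fix x y assume "x \<in> box_verts d L" "y \<in> box_verts d L"
    from near[OF this(1)] near[OF this(2)]
    have "f x - f y \<le> r * (real d * real L) + r * (real d * real L)" by linarith
    then show "f x - f y \<le> 2 * real d * real L * r" by (simp add: mult_ac)
  qed
qed

lemma Poincare_le2:
  assumes "p \<le> 2"
  shows "\<exists>m. (\<Sum>u\<in>box_verts d L. \<bar>f u - m\<bar> powr p) \<le> 2 * p * real L powr p * energy f"
proof -
  have "forward_sum d L (\<lambda>x y. \<bar>f y - f x\<bar> powr p) \<le> energy f"
    unfolding energy_def by (rule order.trans[OF forward_sum_le]) (auto simp: abs_minus_commute)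
  then have "2 * p * real L powr p * forward_sum d L (\<lambda>x y. \<bar>f y - f x\<bar> powr p) \<le> 2 * p * real L powr p * energy f"
    using p1 by (intro mult_left_mono) auto
  moreover have "1 \<le> L" using L2 by simp
  note box_Poincare[OF p1 assms this, of f d]
  ultimately show ?thesis by (blast intro: order.trans)
qed

text \<open>Apply the quadratic inequality to \<open>h = spow (p / 2) (f - m)\<close>, whose square is \<open>\<bar>f - m\<bar> powr p\<close>; the shift \<open>m\<close> is
chosen such that \<open>h\<close> has mean zero. The gradient of \<open>h\<close> is bounded by \<open>\<bar>f - m\<bar> powr (p / 2 - 1)\<close> times the
gradient of \<open>f\<close>, and interpolation absorbs the power of \<open>f - m\<close> into half of the left side. The scale \<open>K\<close> in the
interpolation is what makes that coefficient equal to one half.\<close>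

lemma Poincare_ge2:
  assumes p2: "2 \<le> p"
  shows "\<exists>m. (2 * real d) * (\<Sum>u\<in>box_verts d L. \<bar>f u - m\<bar> powr p)
            \<le> (8 * p\<^sup>2 * real d * (real L)\<^sup>2) powr (p / 2) * energy f"
proof -
  let ?V = "box_verts d L"
  obtain m where "(\<Sum>u\<in>?V. spow (p / 2) (m - f u)) = 0"
    using spow_root_exists[OF fin ne, of "p / 2" f] p2 by auto
  then have m: "(\<Sum>u\<in>?V. spow (p / 2) (f u - m)) = 0"
    using sum_negf[of "\<lambda>u. spow (p / 2) (m - f u)" ?V] by (simp flip: spow_minus)
  define F where "F u = f u - m" for u
  define h where "h u = spow (p / 2) (F u)" for u
  define S where "S = (\<Sum>u\<in>?V. \<bar>F u\<bar> powr p)"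
  define D where "D = 2 * real d"
  define K where "K = 4 * p\<^sup>2 * (real L)\<^sup>2 * D"
  have D: "0 < D" using d2 by (simp add: D_def)
  have K: "0 < K" using D p2 L2 by (simp add: K_def)
  have h2: "\<bar>h u\<bar> powr 2 = \<bar>F u\<bar> powr p" for u
    by (simp only: h_def abs_spow powr_powr) simp
  have grad: "\<bar>h v - h u\<bar> powr 2
      \<le> p\<^sup>2 / 4 * ((f u - f v)\<^sup>2 * \<bar>F u\<bar> powr (p - 2) + (f v - f u)\<^sup>2 * \<bar>F v\<bar> powr (p - 2))" for u v
  proof -
    let ?M = "max \<bar>F v\<bar> \<bar>F u\<bar>"
    have "\<bar>h v - h u\<bar> \<le> p / 2 * \<bar>F v - F u\<bar> * ?M powr (p / 2 - 1)"
      unfolding h_def using p2 by (intro spow_Lipschitz) auto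
    then have "\<bar>h v - h u\<bar> powr 2 \<le> (p / 2 * \<bar>F v - F u\<bar> * ?M powr (p / 2 - 1)) powr 2"
      by (intro powr_mono2) auto
    also have "\<dots> = (p / 2)\<^sup>2 * (F v - F u)\<^sup>2 * (?M powr (p / 2 - 1)) powr 2"
      using p2 by (simp add: powr_mult power_divide power_mult_distrib)
    also have "(?M powr (p / 2 - 1)) powr 2 = ?M powr (p - 2)"
      by (simp only: powr_powr) (simp add: algebra_simps)
    also have "(p / 2)\<^sup>2 * (F v - F u)\<^sup>2 * ?M powr (p - 2)
        \<le> (p / 2)\<^sup>2 * (F v - F u)\<^sup>2 * (\<bar>F u\<bar> powr (p - 2) + \<bar>F v\<bar> powr (p - 2))"
      by (intro mult_left_mono) (auto simp: max_def)
    finally show ?thesis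
      by (simp add: F_def power_divide power2_commute[of "f u" "f v"] algebra_simps)
  qed
  have "S = (\<Sum>u\<in>?V. \<bar>h u - (\<Sum>x\<in>?V. h x) / real (L ^ d)\<bar> powr 2)"
    using m unfolding S_def h2[symmetric] by (simp add: h_def F_def)
  also have "\<dots> \<le> 2 * 2 * real L powr 2 * forward_sum d L (\<lambda>x y. \<bar>h y - h x\<bar> powr 2)"
    using L2 by (intro box_Poincare) auto
  also have "real L powr 2 = (real L)\<^sup>2" using L2 by simp
  also have "2 * 2 * (real L)\<^sup>2 * forward_sum d L (\<lambda>x y. \<bar>h y - h x\<bar> powr 2)
      \<le> 2 * 2 * (real L)\<^sup>2 * (\<Sum>u\<in>?V. \<Sum>v\<in>N u. \<bar>h v - h u\<bar> powr 2)"
    by (intro mult_left_mono forward_sum_le) auto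
  also have "\<dots> \<le> 2 * 2 * (real L)\<^sup>2 * (\<Sum>u\<in>?V. \<Sum>v\<in>N u.
      p\<^sup>2 / 4 * ((f u - f v)\<^sup>2 * \<bar>F u\<bar> powr (p - 2) + (f v - f u)\<^sup>2 * \<bar>F v\<bar> powr (p - 2)))"
    by (intro mult_left_mono sum_mono grad) auto
  also have "\<dots> = p\<^sup>2 * (real L)\<^sup>2 * ((\<Sum>u\<in>?V. \<Sum>v\<in>N u. (f u - f v)\<^sup>2 * \<bar>F u\<bar> powr (p - 2))
       + (\<Sum>u\<in>?V. \<Sum>v\<in>N u. (f v - f u)\<^sup>2 * \<bar>F v\<bar> powr (p - 2)))"
    unfolding sum_distrib_left[symmetric] sum.distrib by simp
  also have "(\<Sum>u\<in>?V. \<Sum>v\<in>N u. (f v - f u)\<^sup>2 * \<bar>F v\<bar> powr (p - 2))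
      = (\<Sum>u\<in>?V. \<Sum>v\<in>N u. (f u - f v)\<^sup>2 * \<bar>F u\<bar> powr (p - 2))"
    by (rule sum_nbrs_swap)
  also have "p\<^sup>2 * (real L)\<^sup>2 * ((\<Sum>u\<in>?V. \<Sum>v\<in>N u. (f u - f v)\<^sup>2 * \<bar>F u\<bar> powr (p - 2))
       + (\<Sum>u\<in>?V. \<Sum>v\<in>N u. (f u - f v)\<^sup>2 * \<bar>F u\<bar> powr (p - 2)))
      = K / (2 * D) * (\<Sum>u\<in>?V. \<Sum>v\<in>N u. (f u - f v)\<^sup>2 * \<bar>F u\<bar> powr (p - 2))"
    using D by (simp add: K_def)
  finally have S_le: "S \<le> K / (2 * D) * (\<Sum>u\<in>?V. \<Sum>v\<in>N u. (f u - f v)\<^sup>2 * \<bar>F u\<bar> powr (p - 2))" .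
  have "(\<Sum>u\<in>?V. \<Sum>v\<in>N u. (f u - f v)\<^sup>2 * \<bar>F u\<bar> powr (p - 2))
      \<le> (\<Sum>u\<in>?V. \<Sum>v\<in>N u. 1 / K * (K powr (p / 2) * \<bar>f u - f v\<bar> powr p + \<bar>F u\<bar> powr p))"
  proof (intro sum_mono)
    fix u v
    have "(f u - f v)\<^sup>2 * \<bar>F u\<bar> powr (p - 2) = 1 / K * ((sqrt K * (f u - f v))\<^sup>2 * \<bar>F u\<bar> powr (p - 2))"
      using K by (simp add: power_mult_distrib)
    also have "\<dots> \<le> 1 / K * (\<bar>sqrt K * (f u - f v)\<bar> powr p + \<bar>F u\<bar> powr p)"
      using K p2 by (intro mult_left_mono sq_powr_le) auto
    also have "\<bar>sqrt K * (f u - f v)\<bar> powr p = K powr (p / 2) * \<bar>f u - f v\<bar> powr p"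
      using K by (simp add: abs_mult powr_mult powr_half_sqrt[symmetric] powr_powr)
    finally show "(f u - f v)\<^sup>2 * \<bar>F u\<bar> powr (p - 2)
        \<le> 1 / K * (K powr (p / 2) * \<bar>f u - f v\<bar> powr p + \<bar>F u\<bar> powr p)" .
  qed
  also have "\<dots> = 1 / K * (K powr (p / 2) * energy f + (\<Sum>u\<in>?V. \<Sum>v\<in>N u. \<bar>F u\<bar> powr p))"
    by (simp only: sum.distrib sum_distrib_left[symmetric] energy_def)
  also have "\<dots> \<le> 1 / K * (K powr (p / 2) * energy f + D * S)"
    using K unfolding S_def D_def by (intro mult_left_mono add_left_mono sum_nbrs_le card_N_le) auto
  finally have "K / (2 * D) * (\<Sum>u\<in>?V. \<Sum>v\<in>N u. (f u - f v)\<^sup>2 * \<bar>F u\<bar> powr (p - 2))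
      \<le> K / (2 * D) * (1 / K * (K powr (p / 2) * energy f + D * S))"
    using K D by (intro mult_left_mono) auto
  with S_le have "S \<le> K / (2 * D) * (1 / K * (K powr (p / 2) * energy f + D * S))" by linarith
  also have "\<dots> = (K powr (p / 2) * energy f + D * S) / (2 * D)" using K by simp
  finally have "D * S \<le> K powr (p / 2) * energy f" using D by (simp add: field_simps)
  then show ?thesis
    by (intro exI[of _ m]) (simp add: S_def F_def D_def K_def mult_ac)
qed

end

lemma one_minus_cos_le: "1 - cos x \<le> x\<^sup>2 / 2" for x :: real
proof -
  have "1 - cos x = 2 * (sin (x / 2))\<^sup>2" using cos_double_sin[of "x / 2"] by simp
  also have "(sin (x / 2))\<^sup>2 \<le> (x / 2)\<^sup>2"
    by (rule abs_le_square_iff[THEN iffD1, OF abs_sin_x_le_abs_x])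
  finally show ?thesis by (simp add: power_divide)
qed

context box_dynamics
begin

abbreviation V where "V \<equiv> box_verts d L"

section \<open>Upper bound on the box\<close>

lemma dL_le_n: "real d * real L \<le> real (L ^ d)"
proof -
  obtain k where k: "d = Suc k" using d2 by (cases d) auto
  have "d \<le> 2 ^ k" using Suc_leI[OF less_exp[of k]] k by simp
  also have "\<dots> \<le> L ^ k" using L2 by (intro power_mono) auto
  finally have "d * L \<le> L ^ k * L" by simp
  then have "d * L \<le> L ^ d" by (simp add: k mult.commute)
  then show ?thesis by (simp flip: of_nat_mult)
qed

lemma n_ge_4: "4 \<le> real (L ^ d)"
proof -
  have "2 * 2 \<le> real d * real L" using d2 L2 by (intro mult_mono) auto
  then show ?thesis using dL_le_n by simp
qed

text \<open>The number of vertices, the degree and the diameter are all at most of order \<open>n\<close>, so the ratio between the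
initial and the final energy is polynomial in \<open>n\<close>.\<close>

lemma log_factor_le:
  "ln (real (L ^ d) * (2 * real d) * (4 * (2 * real d * real L)) powr p) + 2 \<le> (3 * p + 8) * ln (2 * real (L ^ d))"
proof -
  define n where "n = real (L ^ d)"
  have n4: "4 \<le> n" and dL: "real d * real L \<le> n" using n_ge_4 dL_le_n by (auto simp: n_def)
  have "real d * 1 \<le> real d * real L" using L2 by (intro mult_left_mono) auto
  then have dn: "real d \<le> n" using dL by simp
  have pos: "0 < real d" "0 < real L" using d2 L2 by auto
  have "n * (2 * real d) * (4 * (2 * real d * real L)) powr p \<le> (8 * n) * (8 * n) * (8 * n) powr p"
  proof (intro mult_mono[OF mult_mono])
    have "4 * (2 * real d * real L) \<le> 8 * n" using dL by simp
    then show "(4 * (2 * real d * real L)) powr p \<le> (8 * n) powr p"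
      using p1 pos by (intro powr_mono2) auto
  qed (use n4 dn in auto)
  also have "\<dots> = (8 * n) powr (p + 2)"
    using n4 by (simp add: powr_add power2_eq_square)
  finally have "ln (n * (2 * real d) * (4 * (2 * real d * real L)) powr p) \<le> ln ((8 * n) powr (p + 2))"
    using n4 pos by (intro ln_mono) auto
  also have "\<dots> = (p + 2) * ln (8 * n)" by simp
  also have "\<dots> \<le> (p + 2) * (3 * ln (2 * n))"
  proof (intro mult_left_mono)
    have "8 * n * 1 \<le> 8 * n * n\<^sup>2" using n4 by (intro mult_left_mono) (auto intro: one_le_power)
    then have "8 * n \<le> (2 * n) ^ 3" by (simp add: power3_eq_cube power2_eq_square)
    then have "ln (8 * n) \<le> ln ((2 * n) ^ 3)" using n4 by (intro ln_mono) auto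
    also have "\<dots> = 3 * ln (2 * n)" using n4 by (subst ln_realpow) auto
    finally show "ln (8 * n) \<le> 3 * ln (2 * n)" .
  qed (use p1 in auto)
  finally have 1: "ln (n * (2 * real d) * (4 * (2 * real d * real L)) powr p) \<le> (p + 2) * (3 * ln (2 * n))" .
  have "exp 1 \<le> 2 * n" using exp_le n4 by linarith
  then have "ln (exp 1) \<le> ln (2 * n)" using n4 by (intro ln_mono) auto
  then have "1 \<le> ln (2 * n)" by simp
  with 1 show ?thesis unfolding n_def[symmetric] by (simp add: algebra_simps)
qed

lemma expected_time_le_of_box_contraction:
  assumes contr: "\<And>f. (\<Sum>u\<in>V. energy (upd f u)) \<le> (real (card V) - \<gamma>) * energy f"
    and \<gamma>: "0 < \<gamma>" "\<gamma> \<le> 1" and f0: "\<And>v. v \<in> V \<Longrightarrow> \<bar>f0 v\<bar> \<le> 1"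
  shows "expected_time p V (box_adj d L) (1/2) f0
      \<le> ennreal ((3 * p + 8) * real (L ^ d) * ln (2 * real (L ^ d)) / \<gamma>)"
proof -
  have "expected_time p V (box_adj d L) (1/2) f0
     \<le> ennreal (real (card V) * (ln (real (card V) * (2 * real d) * (4 * (2 * real d * real L)) powr p) + 2) / \<gamma>)"
  proof (rule expected_time_le_of_contraction[OF contr \<gamma> _ card_N_le _ osc_le_Lipschitz f0])
    show "1 \<le> 2 * real d" using d2 by simp
    have "1 * 1 \<le> (2 * real d) * real L" using d2 L2 by (intro mult_mono) auto
    then show "1 \<le> 2 * real d * real L" by simp
  qed
  also have "\<dots> \<le> ennreal ((3 * p + 8) * real (L ^ d) * ln (2 * real (L ^ d)) / \<gamma>)"
  proof (intro ennreal_leI divide_right_mono)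
    have "real (L ^ d) * (ln (real (L ^ d) * (2 * real d) * (4 * (2 * real d * real L)) powr p) + 2)
      \<le> real (L ^ d) * ((3 * p + 8) * ln (2 * real (L ^ d)))"
      by (intro mult_left_mono log_factor_le) simp
    then show "real (card V) * (ln (real (card V) * (2 * real d) * (4 * (2 * real d * real L)) powr p) + 2)
      \<le> (3 * p + 8) * real (L ^ d) * ln (2 * real (L ^ d))"
      by (simp only: card_box mult_ac)
  qed (use \<gamma> in auto)
  finally show ?thesis .
qed

lemma expected_time_upper_lt2:
  assumes "p < 2" and f0: "\<And>v. v \<in> V \<Longrightarrow> \<bar>f0 v\<bar> \<le> 1"
  shows "expected_time p V (box_adj d L) (1/2) f0
    \<le> ennreal ((3 * p + 8) * (2 / p) * (32 * p) powr (1 / (p - 1)) * (U_bound p d L * ln (2 * real (L ^ d))))"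
proof -
  define s where "s = 1 / (p - 1)"
  define D where "D = 2 * real d"
  define P where "P = 2 * p * real L powr p"
  define \<epsilon> where "\<epsilon> = (1 / (8 * D * P)) powr s"
  have s: "0 < s" using p1 by (simp add: s_def)
  have pos: "0 < real d" "0 < real L" "1 \<le> D" using d2 L2 by (auto simp: D_def)
  have P: "0 < P" using p1 pos by (simp add: P_def)
  have "1 \<le> real L powr p" using L2 p1 by (intro ge_one_powr_ge_zero) auto
  then have "1 * 1 \<le> (2 * p) * real L powr p" using p1 by (intro mult_mono) auto
  then have "1 \<le> P" by (simp add: P_def)
  then have "1 * 1 \<le> 8 * D * P" using pos by (intro mult_mono) auto
  then have \<epsilon>: "0 < \<epsilon>" "\<epsilon> \<le> 1" using s by (auto simp: \<epsilon>_def intro!: powr_le1)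
  have inv_\<epsilon>: "1 / \<epsilon> = (32 * p) powr s * (real d powr s * real L powr (p * s))"
  proof -
    have "1 / \<epsilon> = (8 * D * P) powr s" by (simp add: \<epsilon>_def powr_divide)
    also have "8 * D * P = (32 * p) * (real d * real L powr p)" by (simp add: D_def P_def)
    also have "\<dots> powr s = (32 * p) powr s * (real d powr s * real L powr (p * s))"
      by (simp only: powr_mult powr_powr)
    finally show ?thesis .
  qed
  have contr: "(\<Sum>u\<in>V. energy (upd f u)) \<le> (real (card V) - p * \<epsilon> / 2) * energy f" for f
  proof -
    obtain m where "(\<Sum>u\<in>V. \<bar>f u - m\<bar> powr p) \<le> P * energy f"
      using Poincare_le2[of f] assms(1) by (auto simp: P_def)
    from energy_contraction_le2[OF _ pos(3) _ P this] assms(1)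
    show ?thesis using card_N_le by (simp add: \<epsilon>_def s_def D_def)
  qed
  have "p * \<epsilon> \<le> 2 * 1" using assms(1) \<epsilon> p1 by (intro mult_mono) auto
  then have "expected_time p V (box_adj d L) (1/2) f0
      \<le> ennreal ((3 * p + 8) * real (L ^ d) * ln (2 * real (L ^ d)) / (p * \<epsilon> / 2))"
    using \<epsilon> p1 by (intro expected_time_le_of_box_contraction contr f0) auto
  also have "(3 * p + 8) * real (L ^ d) * ln (2 * real (L ^ d)) / (p * \<epsilon> / 2)
      = (3 * p + 8) * real (L ^ d) * ln (2 * real (L ^ d)) * ((2 / p) * (1 / \<epsilon>))"
    by simp
  also have "\<dots> = (3 * p + 8) * (2 / p) * (32 * p) powr s * (real (L ^ d) * real d powr s * real L powr (p * s) * ln (2 * real (L ^ d)))"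
    by (simp only: inv_\<epsilon> mult_ac)
  also have "real (L ^ d) * real d powr s * real L powr (p * s) = U_bound p d L"
    using assms(1) by (simp add: U_bound_def s_def)
  finally show ?thesis by (simp add: s_def)
qed

lemma expected_time_upper_ge2:
  assumes p2: "2 \<le> p" and f0: "\<And>v. v \<in> V \<Longrightarrow> \<bar>f0 v\<bar> \<le> 1"
  shows "expected_time p V (box_adj d L) (1/2) f0
    \<le> ennreal ((3 * p + 8) * (2 / p) * ((p + 12 * (p * (p - 1) * 2 powr (p - 2))) * (8 * p\<^sup>2))
         * (U_bound p d L * ln (2 * real (L ^ d))))"
proof -
  define C where "C = p * (p - 1) * 2 powr (p - 2)"
  define D where "D = 2 * real d"
  define K where "K = 8 * p\<^sup>2 * real d * (real L)\<^sup>2"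
  define \<epsilon> where "\<epsilon> = 1 / ((p + 12 * C) * K)"
  have C: "0 \<le> C" using p2 by (simp add: C_def)
  have pos: "0 < real d" "0 < real L" "1 \<le> D" using d2 L2 by (auto simp: D_def)
  have "1 * 1 * 1 * 1 \<le> K" unfolding K_def using p2 d2 L2
    by (intro mult_mono one_le_power) auto
  then have K: "1 \<le> K" by simp
  have pK: "p * 1 \<le> (p + 12 * C) * K" using C K p2 by (intro mult_mono) auto
  then have \<epsilon>: "0 < \<epsilon>" "p * \<epsilon> \<le> 1" using p2 by (auto simp: \<epsilon>_def)
  have contr: "(\<Sum>u\<in>V. energy (upd f u)) \<le> (real (card V) - p * \<epsilon> / 2) * energy f" for f
  proof -
    obtain m where "D * (\<Sum>u\<in>V. \<bar>f u - m\<bar> powr p) \<le> K powr (p / 2) * energy f"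
      using Poincare_ge2[OF p2, of f] by (auto simp: D_def K_def)
    from energy_contraction_ge2[OF p2 pos(3) _ K this]
    show ?thesis using card_N_le by (simp add: \<epsilon>_def D_def C_def)
  qed
  have "expected_time p V (box_adj d L) (1/2) f0
      \<le> ennreal ((3 * p + 8) * real (L ^ d) * ln (2 * real (L ^ d)) / (p * \<epsilon> / 2))"
    using \<epsilon> p2 by (intro expected_time_le_of_box_contraction contr f0) auto
  also have "(3 * p + 8) * real (L ^ d) * ln (2 * real (L ^ d)) / (p * \<epsilon> / 2)
      = (3 * p + 8) * real (L ^ d) * ln (2 * real (L ^ d)) * ((2 / p) * (1 / \<epsilon>))"
    by simp
  also have "1 / \<epsilon> = (p + 12 * C) * K" by (simp add: \<epsilon>_def)
  also have "(3 * p + 8) * real (L ^ d) * ln (2 * real (L ^ d)) * ((2 / p) * ((p + 12 * C) * K))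
      = (3 * p + 8) * (2 / p) * ((p + 12 * C) * (8 * p\<^sup>2)) * (real (L ^ d) * real d * (real L)\<^sup>2 * ln (2 * real (L ^ d)))"
    by (simp only: K_def mult_ac)
  also have "real (L ^ d) * real d * (real L)\<^sup>2 = U_bound p d L"
    using p2 by (simp add: U_bound_def)
  finally show ?thesis by (simp add: C_def)
qed

section \<open>Lower bounds on the box\<close>

lemma expected_time_le_worst:
  assumes "\<And>v. v \<in> V \<Longrightarrow> \<bar>f0 v\<bar> \<le> 1"
  shows "expected_time p V (box_adj d L) (1/2) (restrict f0 V) \<le> worst_expected_time p (1/2) d L"
  unfolding worst_expected_time_def
  by (rule SUP_upper) (use assms in \<open>auto simp: abs_le_iff minus_le_iff\<close>)

lemma p_mean_restrict:
  assumes "u \<in> V"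
  shows "p_mean p (N u) (restrict f V) = p_mean p (N u) f"
proof -
  have "\<bar>p_mean p (N u) (restrict f V) - p_mean p (N u) f\<bar> \<le> 0"
    by (rule p_mean_perturb) (use N_props[of u] assms p1 in auto)
  then show ?thesis by simp
qed

text \<open>The signs of the increasing function at \<open>f u \<plusminus> \<eta>\<close> locate its root, the p-mean.\<close>

lemma near_fixedI:
  assumes u: "u \<in> V"
    and above: "0 \<le> (\<Sum>v\<in>N u. spow (p - 1) (f u + \<eta> - f v))"
    and below: "(\<Sum>v\<in>N u. spow (p - 1) (f u - \<eta> - f v)) \<le> 0"
  shows "\<bar>p_mean p (N u) (restrict f V) - restrict f V u\<bar> \<le> \<eta>"
proof -
  have "p_mean p (N u) f \<le> f u + \<eta>" "f u - \<eta> \<le> p_mean p (N u) f"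
    using N_props[of u] u p1 by (auto intro!: p_mean_leI p_mean_geI above below)
  then show ?thesis using u by (simp add: p_mean_restrict abs_le_iff)
qed

lemma worst_ge_of_near_fixed:
  assumes \<eta>: "0 < \<eta>"
    and above: "\<And>u. u \<in> V \<Longrightarrow> 0 \<le> (\<Sum>v\<in>N u. spow (p - 1) (f u + \<eta> - f v))"
    and below: "\<And>u. u \<in> V \<Longrightarrow> (\<Sum>v\<in>N u. spow (p - 1) (f u - \<eta> - f v)) \<le> 0"
    and f: "\<And>v. v \<in> V \<Longrightarrow> \<bar>f v\<bar> \<le> 1" and xy: "x \<in> V" "y \<in> V" "f x - f y = 2"
  shows "ennreal (real (L ^ d) / (12 * exp 1 * real d * \<eta>)) \<le> worst_expected_time p (1/2) d L"
    and "p = 2 \<Longrightarrow> ennreal (real (L ^ d) / (6 * \<eta>)) \<le> worst_expected_time p (1/2) d L"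
proof -
  note near = near_fixedI[where f = f, OF _ above below]
  have "ennreal (real (card V) / (6 * exp 1 * (2 * real d) * \<eta>)) \<le> expected_time p V (box_adj d L) (1/2) (restrict f V)"
    by (rule expected_time_ge_of_near_fixed[OF \<eta> near _ card_N_le, where x = x and y = y])
      (use d2 f xy in auto)
  also have "\<dots> \<le> worst_expected_time p (1/2) d L" by (rule expected_time_le_worst[OF f])
  finally show "ennreal (real (L ^ d) / (12 * exp 1 * real d * \<eta>)) \<le> worst_expected_time p (1/2) d L"
    by (simp add: card_box mult.assoc)
  assume p2: "p = 2"
  have "ennreal (real (card V) / (6 * \<eta>)) \<le> expected_time p V (box_adj d L) (1/2) (restrict f V)"
    by (rule expected_time_ge_of_near_fixed_linear[OF p2 \<eta> near, where x = x and y = y])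
      (use f xy in auto)
  also have "\<dots> \<le> worst_expected_time p (1/2) d L" by (rule expected_time_le_worst[OF f])
  finally show "ennreal (real (L ^ d) / (6 * \<eta>)) \<le> worst_expected_time p (1/2) d L"
    by (simp add: card_box)
qed

text \<open>A profile along one coordinate with values from \<open>1\<close> to \<open>-1\<close>, curvature of order \<open>1 / L\<^sup>2\<close> and vanishing slope at
both ends, so that the missing neighbours at the boundary do no harm.\<close>

definition wave :: "nat \<Rightarrow> real" where
  "wave k = cos (pi * real k / real (L - 1))"

lemma wave_ends: "wave 0 = 1" "wave (L - 1) = - 1"
proof -
  have "real (L - 1) \<noteq> 0" using L2 by simp
  then have "pi * real (L - 1) / real (L - 1) = pi" by (rule nonzero_mult_div_cancel_right)
  then show "wave (L - 1) = - 1" unfolding wave_def by (simp only: cos_pi)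
qed (simp add: wave_def)

lemma wave_curvature:
  defines "\<sigma> \<equiv> 4 * pi\<^sup>2 / (real L)\<^sup>2"
  shows "0 < k \<Longrightarrow> \<bar>wave (k + 1) + wave (k - 1) - 2 * wave k\<bar> \<le> 2 * \<sigma>"
    and "\<bar>wave 1 - wave 0\<bar> \<le> \<sigma>" and "\<bar>wave (L - 2) - wave (L - 1)\<bar> \<le> \<sigma>"
proof -
  define \<delta> where "\<delta> = pi / real (L - 1)"
  have L1: "0 < real (L - 1)" "real L \<le> 2 * real (L - 1)" using L2 by auto
  have "\<delta> \<le> 2 * pi / real L" using L1 L2 pi_gt_zero by (simp add: \<delta>_def field_simps)
  then have "\<delta>\<^sup>2 \<le> (2 * pi / real L)\<^sup>2" using L1 by (intro power_mono) (auto simp: \<delta>_def)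
  then have "\<delta>\<^sup>2 \<le> \<sigma>" by (simp add: \<sigma>_def power_divide power_mult_distrib)
  moreover have "0 \<le> \<delta>\<^sup>2" by simp
  ultimately have c: "\<bar>1 - cos \<delta>\<bar> \<le> \<sigma>"
    using one_minus_cos_le[of \<delta>] cos_le_one[of \<delta>] by linarith
  have w: "wave k = cos (real k * \<delta>)" for k by (simp add: wave_def \<delta>_def mult.commute)
  show "\<bar>wave 1 - wave 0\<bar> \<le> \<sigma>" using c by (simp add: w abs_minus_commute)
  have "real (L - 1) * \<delta> = pi" using L1 by (simp add: \<delta>_def)
  moreover have "real (L - 2) * \<delta> = real (L - 1) * \<delta> - \<delta>" using L2 by (simp add: of_nat_diff algebra_simps)
  ultimately show "\<bar>wave (L - 2) - wave (L - 1)\<bar> \<le> \<sigma>" using c by (simp add: w cos_diff)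
  assume k: "0 < k"
  have "real (k + 1) * \<delta> = real k * \<delta> + \<delta>" "real (k - 1) * \<delta> = real k * \<delta> - \<delta>"
    using k by (simp_all add: of_nat_diff algebra_simps)
  then have "wave (k + 1) = cos (real k * \<delta> + \<delta>)" "wave (k - 1) = cos (real k * \<delta> - \<delta>)" "wave k = cos (real k * \<delta>)"
    by (simp_all only: w)
  then have "wave (k + 1) + wave (k - 1) - 2 * wave k = - 2 * cos (real k * \<delta>) * (1 - cos \<delta>)"
    by (simp only: cos_add cos_diff) (simp add: algebra_simps)
  then have "\<bar>wave (k + 1) + wave (k - 1) - 2 * wave k\<bar> = 2 * \<bar>cos (real k * \<delta>)\<bar> * \<bar>1 - cos \<delta>\<bar>"
    by (simp add: abs_mult)
  also have "\<dots> \<le> 2 * 1 * \<sigma>" using c by (intro mult_mono) auto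
  finally show "\<bar>wave (k + 1) + wave (k - 1) - 2 * wave k\<bar> \<le> 2 * \<sigma>" by simp
qed

text \<open>The average of the wave over all coordinates has increments that nearly cancel in opposite pairs, up to
\<open>\<sigma> / d\<close> where \<open>\<sigma>\<close> bounds the curvature of the wave. Since \<open>spow\<close> is odd and increasing, shifting the centre by
\<open>\<eta> = \<sigma> / d\<close> fixes the sign of every pair, for all \<open>p\<close> alike.\<close>

lemma worst_ge_wave:
  shows "ennreal (1 / (48 * exp 1 * pi\<^sup>2) * (real (L ^ d) * (real L)\<^sup>2)) \<le> worst_expected_time p (1/2) d L"
    and "p = 2 \<Longrightarrow> ennreal (1 / (24 * pi\<^sup>2) * (real (L ^ d) * (real d * (real L)\<^sup>2))) \<le> worst_expected_time p (1/2) d L"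
proof -
  define f where "f u = (\<Sum>i<d. wave (u i)) / real d" for u
  define \<sigma> where "\<sigma> = 4 * pi\<^sup>2 / (real L)\<^sup>2"
  define \<eta> where "\<eta> = \<sigma> / real d"
  have d0: "0 < real d" using d2 by simp
  have \<sigma>0: "0 < \<sigma>" using L2 by (simp add: \<sigma>_def)
  then have \<eta>0: "0 < \<eta>" using d0 by (simp add: \<eta>_def)
  note curv = wave_curvature[folded \<sigma>_def]
  have f_upd: "f (u(i := k)) = f u + (wave k - wave (u i)) / real d" if "i < d" for u i k
  proof -
    have "(\<Sum>j<d. wave ((u(i := k)) j)) = wave k + (\<Sum>j\<in>{..<d} - {i}. wave ((u(i := k)) j))"
      using that by (subst sum.remove[of _ i]) auto
    also have "(\<Sum>j\<in>{..<d} - {i}. wave ((u(i := k)) j)) = (\<Sum>j\<in>{..<d} - {i}. wave (u j))"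
      by (intro sum.cong) auto
    also have "\<dots> = (\<Sum>j<d. wave (u j)) - wave (u i)"
      using that sum.remove[of "{..<d}" i "\<lambda>j. wave (u j)"] by simp
    also have "wave k + \<dots> = (\<Sum>j<d. wave (u j)) + (wave k - wave (u i))" by simp
    finally show ?thesis by (simp only: f_def add_divide_distrib)
  qed
  let ?a = "\<lambda>u i. (wave (u i + 1) - wave (u i)) / real d" and ?b = "\<lambda>u i. (wave (u i - 1) - wave (u i)) / real d"
  have sumN: "(\<Sum>v\<in>N u. spow (p - 1) (f u + c - f v))
      = (\<Sum>i<d. (if u i + 1 < L then spow (p - 1) (c - ?a u i) else 0) + (if 0 < u i then spow (p - 1) (c - ?b u i) else 0))"
    if "u \<in> V" for u c
    unfolding sum_N[OF that] by (intro sum.cong refl) (auto simp: f_upd algebra_simps)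
  have both: "?a u i + ?b u i \<le> 2 * \<eta> \<and> - (2 * \<eta>) \<le> ?a u i + ?b u i" if "0 < u i" for u i
  proof -
    have "?a u i + ?b u i = (wave (u i + 1) + wave (u i - 1) - 2 * wave (u i)) / real d"
      using d0 by (simp add: field_simps)
    then have "\<bar>?a u i + ?b u i\<bar> \<le> 2 * \<eta>" using curv(1)[OF that] d0 by (simp add: \<eta>_def divide_right_mono)
    then show ?thesis by linarith
  qed
  have low: "?a u i \<le> \<eta> \<and> - \<eta> \<le> ?a u i" if "u i = 0" for u i
  proof -
    have "\<bar>?a u i\<bar> \<le> \<eta>" using curv(2) that d0 by (simp add: \<eta>_def divide_right_mono)
    then show ?thesis by linarith
  qed
  have high: "?b u i \<le> \<eta> \<and> - \<eta> \<le> ?b u i" if "u i < L" "\<not> u i + 1 < L" for u i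
  proof -
    have "u i = L - 1" "u i - 1 = L - 2" using that L2 by auto
    then have "\<bar>?b u i\<bar> \<le> \<eta>" using curv(3) d0 by (simp add: \<eta>_def divide_right_mono)
    then show ?thesis by linarith
  qed
  have above: "0 \<le> (\<Sum>v\<in>N u. spow (p - 1) (f u + \<eta> - f v))" if u: "u \<in> V" for u
    unfolding sumN[OF u]
  proof (rule sum_nonneg)
    fix i assume "i \<in> {..<d}"
    then have "u i < L" using box_coord_less u by auto
    then show "0 \<le> (if u i + 1 < L then spow (p - 1) (\<eta> - ?a u i) else 0) + (if 0 < u i then spow (p - 1) (\<eta> - ?b u i) else 0)"
      using both[of u i] low[of u i] high[of u i] p1
      by (auto intro!: spow_add_nonneg)
  qed
  have below: "(\<Sum>v\<in>N u. spow (p - 1) (f u - \<eta> - f v)) \<le> 0" if u: "u \<in> V" for u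
  proof -
    have "(\<Sum>i<d. (if u i + 1 < L then spow (p - 1) (- \<eta> - ?a u i) else 0) + (if 0 < u i then spow (p - 1) (- \<eta> - ?b u i) else 0)) \<le> 0"
    proof (rule sum_nonpos)
      fix i assume "i \<in> {..<d}"
      then have "u i < L" using box_coord_less u by auto
      then show "(if u i + 1 < L then spow (p - 1) (- \<eta> - ?a u i) else 0) + (if 0 < u i then spow (p - 1) (- \<eta> - ?b u i) else 0) \<le> 0"
        using both[of u i] low[of u i] high[of u i] p1
        by (auto intro!: spow_add_nonpos spow_nonpos)
    qed
    then show ?thesis using sumN[OF u, of "- \<eta>"] by simp
  qed
  have bound: "\<bar>f v\<bar> \<le> 1" if "v \<in> V" for v
  proof -
    have "\<bar>\<Sum>i<d. wave (v i)\<bar> \<le> (\<Sum>i<d. 1)"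
      by (rule order.trans[OF sum_abs sum_mono]) (simp add: wave_def)
    then show ?thesis using d0 by (simp add: f_def)
  qed
  have far: "(\<lambda>i\<in>{..<d}. L - 1) \<in> V" using L2 by (auto simp: box_verts_def)
  have const: "f (\<lambda>i\<in>{..<d}. k) = wave k" for k
    using d0 by (simp add: f_def)
  have "f (\<lambda>i\<in>{..<d}. 0) - f (\<lambda>i\<in>{..<d}. L - 1) = 2"
    unfolding const wave_ends by simp
  note lower = worst_ge_of_near_fixed[where f = f, OF \<eta>0 above below bound zero_in_box far this]
  have "real (L ^ d) / (12 * exp 1 * real d * \<eta>) = 1 / (48 * exp 1 * pi\<^sup>2) * (real (L ^ d) * (real L)\<^sup>2)"
    using d0 by (simp add: \<eta>_def \<sigma>_def)
  with lower(1) show "ennreal (1 / (48 * exp 1 * pi\<^sup>2) * (real (L ^ d) * (real L)\<^sup>2)) \<le> worst_expected_time p (1/2) d L"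
    by simp
  have "real (L ^ d) / (6 * \<eta>) = 1 / (24 * pi\<^sup>2) * (real (L ^ d) * (real d * (real L)\<^sup>2))"
    using d0 by (simp add: \<eta>_def \<sigma>_def)
  with lower(2) show "p = 2 \<Longrightarrow> ennreal (1 / (24 * pi\<^sup>2) * (real (L ^ d) * (real d * (real L)\<^sup>2))) \<le> worst_expected_time p (1/2) d L"
    by simp
qed

text \<open>A profile in the first coordinate only. Its increments are chosen such that their images under \<open>spow (p - 1)\<close>, the
fluxes \<open>c \<cdot> q j\<close>, rise with slope \<open>c\<close> from one end of the box to the middle and then fall again. At every vertex the
fluxes from both sides differ by at most \<open>c\<close>, also at the boundary, where one of them is missing. This
imbalance is outweighed by the neighbours in the other directions, at least \<open>d - 1\<close> of them, as soon as the centre is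
shifted by \<open>\<eta>\<close> with \<open>(d - 1) \<cdot> \<eta> powr (p - 1) \<ge> c\<close>. So \<open>\<eta>\<close> is of order
\<open>d powr (- 1 / (p - 1)) \<cdot> L powr (- p / (p - 1))\<close>, which for \<open>p < 2\<close> is smaller than what the wave achieves.\<close>

lemma worst_ge_flux:
  defines "s \<equiv> 1 / (p - 1)"
  shows "ennreal ((1/8) powr s / (192 * exp 1) * (real (L ^ d) * (real d powr (s - 1) * real L powr (p / (p - 1)))))
     \<le> worst_expected_time p (1/2) d L"
proof -
  define q where "q j = real (min (j + 1) (L - 1 - j))" for j :: nat
  define w where "w j = (q j / real L) powr s" for j
  define W where "W = (\<Sum>j<L - 1. w j)"
  define F where "F k = - 1 + 2 * (\<Sum>j<k. w j) / W" for k
  define c where "c = (2 / W) powr (p - 1) / real L"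
  define \<eta> where "\<eta> = 2 / W * (2 / (real d * real L)) powr s"
  have s: "0 < s" "(p - 1) * s = 1" using p1 by (auto simp: s_def)
  have pos: "0 < real d" "0 < real L" using d2 L2 by auto
  have w0: "0 \<le> w j" for j unfolding w_def by (rule powr_ge_zero)
  have W_ge: "real L / 8 * (1/4) powr s \<le> W"
  proof -
    (* The second quarter of the segment already contributes a fixed proportion. *)
    define m where "m = L div 2"
    have Lm: "L \<le> 2 * m + 1" "2 * m \<le> L" "2 * (m div 2) \<le> m" "m \<le> 2 * (m div 2) + 1"
      by (simp_all add: m_def)
    have "real L / 8 * (1/4) powr s \<le> real (m - m div 2) * (1/4) powr s"
    proof (intro mult_right_mono)
      have "L \<le> 8 * (m - m div 2)" using Lm L2 by linarith
      then show "real L / 8 \<le> real (m - m div 2)" by linarith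
    qed simp
    also have "\<dots> = (\<Sum>j\<in>{m div 2..<m}. (1/4) powr s)" by simp
    also have "\<dots> \<le> (\<Sum>j\<in>{m div 2..<m}. w j)"
    proof (rule sum_mono)
      fix j assume j: "j \<in> {m div 2..<m}"
      then have "m div 2 \<le> j" "j < m" by simp_all
      then have "L \<le> 4 * min (j + 1) (L - 1 - j)" using Lm L2 by (cases "j + 1 \<le> L - 1 - j") (simp_all add: min_def)
      then have "real L \<le> 4 * q j" unfolding q_def by linarith
      then have "1/4 \<le> q j / real L" using pos by (simp add: field_simps)
      then show "(1/4) powr s \<le> w j" unfolding w_def using s by (intro powr_mono2) auto
    qed
    also have "\<dots> \<le> W" unfolding W_def using L2 w0 Lm by (intro sum_mono2) auto
    finally show ?thesis .
  qed
  moreover have "0 < real L / 8 * (1/4) powr s" using pos by simp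
  ultimately have W: "0 < W" by linarith
  have c0: "0 < c" using W pos by (simp add: c_def)
  have \<eta>0: "0 < \<eta>" using W pos by (simp add: \<eta>_def)
  have \<eta>_pow: "\<eta> powr (p - 1) = 2 * c / real d"
    unfolding \<eta>_def c_def powr_mult powr_powr using s pos W by (simp add: mult.commute field_simps)
  have inc: "F (Suc j) - F j = 2 / W * w j" for j by (simp add: F_def add_divide_distrib distrib_left)
  have inc0: "0 \<le> F (Suc j) - F j" for j unfolding inc using W w0 by simp
  have flux: "spow (p - 1) (F (Suc j) - F j) = c * q j" for j
  proof -
    have "spow (p - 1) (F (Suc j) - F j) = (2 / W * w j) powr (p - 1)"
      using inc0[of j] by (simp only: spow_nonneg inc)
    also have "\<dots> = (2 / W) powr (p - 1) * (q j / real L) powr ((p - 1) * s)"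
      by (simp only: w_def powr_mult powr_powr mult.commute[of s])
    also have "(q j / real L) powr ((p - 1) * s) = q j / real L"
      unfolding s(2) by (rule powr_one) (simp add: q_def)
    finally show ?thesis by (simp add: c_def)
  qed
  let ?f = "\<lambda>u::nat \<Rightarrow> nat. F (u 0)"
  have sumN: "(\<Sum>v\<in>N u. spow (p - 1) (?f u + z - ?f v))
     = (if u 0 + 1 < L then spow (p - 1) (z - (F (Suc (u 0)) - F (u 0))) else 0)
       + (if 0 < u 0 then spow (p - 1) (z + (F (u 0) - F (u 0 - 1))) else 0)
       + spow (p - 1) z * (\<Sum>i\<in>{1..<d}. (if u i + 1 < L then 1 else 0) + (if 0 < u i then 1 else 0))"
    if u: "u \<in> V" for u z
  proof -
    let ?t = "\<lambda>i. (if u i + 1 < L then spow (p - 1) (?f u + z - ?f (u(i := u i + 1))) else 0)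
          + (if 0 < u i then spow (p - 1) (?f u + z - ?f (u(i := u i - 1))) else 0)"
    have "{..<d} = insert 0 {1..<d}" using d2 by auto
    then have "(\<Sum>v\<in>N u. spow (p - 1) (?f u + z - ?f v)) = ?t 0 + (\<Sum>i\<in>{1..<d}. ?t i)"
      unfolding sum_N[OF u] by simp
    also have "(\<Sum>i\<in>{1..<d}. ?t i) = (\<Sum>i\<in>{1..<d}. spow (p - 1) z * ((if u i + 1 < L then 1 else 0) + (if 0 < u i then 1 else 0)))"
      by (intro sum.cong refl) auto
    finally show ?thesis by (simp add: sum_distrib_left algebra_simps)
  qed
  have lateral: "real (d - 1) \<le> (\<Sum>i\<in>{1..<d}. (if u i + 1 < L then 1 else 0) + (if 0 < u i then 1 else (0::real)))" for u :: "nat \<Rightarrow> nat"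
  proof -
    have "real (d - 1) = (\<Sum>i\<in>{1..<d}. 1)" by simp
    also have "\<dots> \<le> (\<Sum>i\<in>{1..<d}. (if u i + 1 < L then 1 else 0) + (if 0 < u i then 1 else (0::real)))"
      using L2 by (intro sum_mono) auto
    finally show ?thesis .
  qed
  have lateral_flux: "c \<le> \<eta> powr (p - 1) * (\<Sum>i\<in>{1..<d}. (if u i + 1 < L then 1 else 0) + (if 0 < u i then 1 else (0::real)))" for u :: "nat \<Rightarrow> nat"
  proof -
    have "c * real d \<le> c * (2 * real (d - 1))" using c0 d2 by (intro mult_left_mono) auto
    then have "c \<le> 2 * c / real d * real (d - 1)" using pos by (simp add: field_simps)
    also have "\<dots> \<le> \<eta> powr (p - 1) * (\<Sum>i\<in>{1..<d}. (if u i + 1 < L then 1 else 0) + (if 0 < u i then 1 else (0::real)))"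
      unfolding \<eta>_pow using c0 pos by (intro mult_left_mono lateral) auto
    finally show ?thesis .
  qed
  have qdiff: "q k - q (k - 1) \<le> 1" "q (k - 1) - q k \<le> 1" if "0 < k" "k + 1 < L" for k
    using that unfolding q_def by (auto simp: min_def of_nat_diff)
  have q_ends: "q 0 \<le> 1" "q (L - 2) \<le> 1" unfolding q_def using L2 by (auto simp: min_def)
  have above: "0 \<le> (\<Sum>v\<in>N u. spow (p - 1) (?f u + \<eta> - ?f v))" if u: "u \<in> V" for u
  proof -
    let ?k = "u 0"
    have k: "?k < L" using box_coord_less[OF u, of 0] d2 by simp
    have up: "- c * q ?k \<le> spow (p - 1) (\<eta> - (F (Suc ?k) - F ?k))"
      using spow_mono[of "p - 1" "- (F (Suc ?k) - F ?k)" "\<eta> - (F (Suc ?k) - F ?k)"] flux[of ?k] \<eta>0 p1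
      unfolding spow_minus by simp
    have down: "c * q (?k - 1) \<le> spow (p - 1) (\<eta> + (F ?k - F (?k - 1)))" if "0 < ?k"
      using spow_mono[of "p - 1" "F ?k - F (?k - 1)" "\<eta> + (F ?k - F (?k - 1))"] flux[of "?k - 1"] \<eta>0 p1 that
      by simp
    have "- c \<le> (if ?k + 1 < L then spow (p - 1) (\<eta> - (F (Suc ?k) - F ?k)) else 0)
       + (if 0 < ?k then spow (p - 1) (\<eta> + (F ?k - F (?k - 1))) else 0)"
    proof (cases "?k + 1 < L")
      case up': True
      show ?thesis
      proof (cases "0 < ?k")
        case True
        have "c * (q ?k - q (?k - 1)) \<le> c * 1" using c0 qdiff(1)[OF True up'] by (intro mult_left_mono) auto
        then have "- c \<le> - c * q ?k + c * q (?k - 1)" by (simp add: algebra_simps)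
        then show ?thesis using up down[OF True] up' True by simp
      next
        case False
        have "c * q 0 \<le> c * 1" using c0 q_ends(1) by (intro mult_left_mono) auto
        then show ?thesis using up up' False by simp
      qed
    next
      case False
      then have "0 < ?k" using k L2 by simp
      have "0 \<le> c * q (?k - 1)" using c0 by (simp add: q_def)
      then show ?thesis using down[OF \<open>0 < ?k\<close>] False \<open>0 < ?k\<close> c0 by simp
    qed
    then show ?thesis
      using lateral_flux[of u] \<eta>0 unfolding sumN[OF u] by (simp add: spow_nonneg)
  qed
  have below: "(\<Sum>v\<in>N u. spow (p - 1) (?f u - \<eta> - ?f v)) \<le> 0" if u: "u \<in> V" for u
  proof -
    let ?k = "u 0"
    have k: "?k < L" using box_coord_less[OF u, of 0] d2 by simp
    have up: "spow (p - 1) (- \<eta> - (F (Suc ?k) - F ?k)) \<le> - c * q ?k"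
      using spow_mono[of "p - 1" "- \<eta> - (F (Suc ?k) - F ?k)" "- (F (Suc ?k) - F ?k)"] flux[of ?k] \<eta>0 p1
      unfolding spow_minus by simp
    have down: "spow (p - 1) (- \<eta> + (F ?k - F (?k - 1))) \<le> c * q (?k - 1)" if "0 < ?k"
      using spow_mono[of "p - 1" "- \<eta> + (F ?k - F (?k - 1))" "F ?k - F (?k - 1)"] flux[of "?k - 1"] \<eta>0 p1 that
      by simp
    have "(if ?k + 1 < L then spow (p - 1) (- \<eta> - (F (Suc ?k) - F ?k)) else 0)
       + (if 0 < ?k then spow (p - 1) (- \<eta> + (F ?k - F (?k - 1))) else 0) \<le> c"
    proof (cases "?k + 1 < L")
      case up': True
      show ?thesis
      proof (cases "0 < ?k")
        case True
        have "c * (q (?k - 1) - q ?k) \<le> c * 1" using c0 qdiff(2)[OF True up'] by (intro mult_left_mono) auto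
        then have "- c * q ?k + c * q (?k - 1) \<le> c" by (simp add: algebra_simps)
        then show ?thesis using up down[OF True] up' True by simp
      next
        case False
        have "0 \<le> c * q ?k" using c0 by (simp add: q_def)
        then show ?thesis using up up' False c0 by simp
      qed
    next
      case False
      then have "0 < ?k" "?k - 1 = L - 2" using k L2 by auto
      then have "c * q (?k - 1) \<le> c * 1" using c0 q_ends(2) by (intro mult_left_mono) auto
      then show ?thesis using down[OF \<open>0 < ?k\<close>] False \<open>0 < ?k\<close> by simp
    qed
    moreover have "spow (p - 1) (- \<eta>) = - (\<eta> powr (p - 1))" using \<eta>0 by (simp add: spow_nonneg)
    ultimately show ?thesis
      using lateral_flux[of u] sumN[OF u, of "- \<eta>"] by simp
  qed
  have bound: "\<bar>?f v\<bar> \<le> 1" if "v \<in> V" for v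
  proof -
    have "v 0 < L" using box_coord_less[OF that, of 0] d2 by simp
    then have "(\<Sum>j<v 0. w j) \<le> W" unfolding W_def using w0 by (intro sum_mono2) auto
    moreover have "0 \<le> (\<Sum>j<v 0. w j)" using w0 by (intro sum_nonneg) auto
    ultimately show ?thesis using W by (simp add: F_def abs_le_iff field_simps)
  qed
  have far: "(\<lambda>i\<in>{..<d}. L - 1) \<in> V" using L2 by (auto simp: box_verts_def)
  have ends: "?f (\<lambda>i\<in>{..<d}. L - 1) - ?f (\<lambda>i\<in>{..<d}. 0) = 2"
    using W d2 by (simp add: F_def W_def)
  have "ennreal (real (L ^ d) / (12 * exp 1 * real d * \<eta>)) \<le> worst_expected_time p (1/2) d L"
    by (rule worst_ge_of_near_fixed(1)[where f = ?f, OF \<eta>0 _ _ _ far zero_in_box ends]; fact above below bound)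
  moreover have "(1/8) powr s / (192 * exp 1) * (real (L ^ d) * (real d powr (s - 1) * real L powr (p / (p - 1))))
      \<le> real (L ^ d) / (12 * exp 1 * real d * \<eta>)"
  proof -
    have "real L / 16 * (1/8) powr s * (real d * real L) powr s
        = (real L / 8 * (1/4) powr s) / 2 * ((real d * real L) / 2) powr s"
    proof -
      have "(1/8) powr s = (1/4) powr s * (1/2) powr s" by (simp flip: powr_mult)
      then show ?thesis by (simp add: powr_divide)
    qed
    also have "\<dots> \<le> W / 2 * ((real d * real L) / 2) powr s"
      using W_ge by (intro mult_right_mono divide_right_mono) auto
    also have "\<dots> = 1 / \<eta>" by (simp add: \<eta>_def powr_divide)
    finally have "real L / 16 * (1/8) powr s * (real d * real L) powr s * (real (L ^ d) / (12 * exp 1 * real d))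
        \<le> 1 / \<eta> * (real (L ^ d) / (12 * exp 1 * real d))"
      by (intro mult_right_mono) auto
    also have "1 / \<eta> * (real (L ^ d) / (12 * exp 1 * real d)) = real (L ^ d) / (12 * exp 1 * real d * \<eta>)"
      by simp
    also have "real L / 16 * (1/8) powr s * (real d * real L) powr s * (real (L ^ d) / (12 * exp 1 * real d))
       = (1/8) powr s / (192 * exp 1) * (real (L ^ d) * ((real d powr s / real d) * (real L * real L powr s)))"
      by (simp add: powr_mult field_simps)
    also have "real d powr s / real d = real d powr (s - 1)" using pos by (simp add: powr_diff)
    also have "real L * real L powr s = real L powr (p / (p - 1))"
    proof -
      have "p / (p - 1) = 1 + s" using p1 by (simp add: s_def field_simps)
      then show ?thesis using pos by (simp add: powr_mult_base)
    qed
    finally show ?thesis .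
  qed
  ultimately show ?thesis using ennreal_leI order.trans by blast
qed

text \<open>Two colour classes of equal size \<open>k = n div 2\<close> suffice; a leftover vertex may have either value. The size of \<open>harm k\<close>
is compared with \<open>ln n\<close> through \<open>n \<le> (k + 1)\<^sup>2\<close>.\<close>

lemma worst_ge_coupon:
  "ennreal (1/4 * (real (L ^ d) * (real d * ln (real L)))) \<le> worst_expected_time p (1/2) d L"
proof -
  define n where "n = L ^ d"
  define k where "k = n div 2"
  have n4: "4 \<le> n" using n_ge_4 unfolding n_def by linarith
  have cV: "card V = n" by (simp add: card_box n_def)
  obtain A where A: "A \<subseteq> V" "card A = k"
    using obtain_subset_with_card_n[of k V] cV unfolding k_def by auto
  then have "card (V - A) = n - k" using cV fin by (simp add: card_Diff_subset finite_subset)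
  then have "k \<le> card (V - A)" unfolding k_def by simp
  then obtain B where B: "B \<subseteq> V - A" "card B = k"
    using obtain_subset_with_card_n[of k "V - A"] by blast
  define f where "f v = (if v \<in> A then 1 else - 1 :: real)" for v
  have "ennreal (real (card V) * (harm k / 2)) \<le> expected_time p V (box_adj d L) (1/2) (restrict f V)"
    by (rule expected_time_ge_two_colours[of A B]) (use A B in \<open>auto simp: f_def\<close>)
  also have "\<dots> \<le> worst_expected_time p (1/2) d L"
    by (rule expected_time_le_worst) (auto simp: f_def)
  finally have main: "ennreal (real n * (harm k / 2)) \<le> worst_expected_time p (1/2) d L" by (simp add: cV)
  have "n \<le> (k + 1)\<^sup>2"
  proof -
    have "n \<le> 2 * k + 1" unfolding k_def by simp
    also have "\<dots> \<le> (k + 1)\<^sup>2" by (simp add: power2_eq_square)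
    finally show ?thesis .
  qed
  then have "real n \<le> (real k + 1)\<^sup>2"
    by (metis of_nat_1 of_nat_add of_nat_le_iff of_nat_power)
  then have "ln (real n) \<le> ln ((real k + 1)\<^sup>2)" using n4 by (intro ln_mono) auto
  also have "\<dots> = 2 * ln (real k + 1)" by (simp add: ln_realpow)
  also have "ln (real k + 1) \<le> harm k" by (rule ln_le_harm)
  finally have "ln (real n) \<le> 2 * harm k" by simp
  moreover have "ln (real n) = real d * ln (real L)" using L2 by (simp add: n_def ln_realpow)
  ultimately have "real n * (real d * ln (real L)) \<le> real n * (2 * harm k)" by (intro mult_left_mono) auto
  moreover have "real n * (2 * harm k) = 4 * (real n * (harm k / 2))" by simp
  ultimately have "1/4 * (real n * (real d * ln (real L))) \<le> real n * (harm k / 2)" by linarith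
  then show ?thesis using main ennreal_leI order.trans unfolding n_def by blast
qed

end

section \<open>Comparison of the bounds\<close>

lemma worst_upper:
  assumes "1 < p"
  shows "\<exists>a>0. \<forall>d L. 2 \<le> d \<longrightarrow> 2 \<le> L \<longrightarrow>
    worst_expected_time p (1/2) d L \<le> ennreal (a * (U_bound p d L * ln (2 * real (L ^ d))))"
proof -
  define a where "a = (3 * p + 8) * (2 / p) * (if p < 2 then (32 * p) powr (1 / (p - 1))
      else (p + 12 * (p * (p - 1) * 2 powr (p - 2))) * (8 * p\<^sup>2))"
  have "0 < p + 12 * (p * (p - 1) * 2 powr (p - 2))" using assms by (intro add_pos_nonneg) auto
  then have "0 < a" unfolding a_def using assms by (auto intro!: mult_pos_pos divide_pos_pos)
  moreover have "worst_expected_time p (1/2) d L \<le> ennreal (a * (U_bound p d L * ln (2 * real (L ^ d))))"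
    if "2 \<le> d" "2 \<le> L" for d L
    unfolding worst_expected_time_def
  proof (rule SUP_least)
    fix f0 assume f0: "f0 \<in> box_verts d L \<rightarrow>\<^sub>E {-1..1::real}"
    interpret box_dynamics d L p by unfold_locales (use that assms in auto)
    have bd: "\<bar>f0 v\<bar> \<le> 1" if "v \<in> box_verts d L" for v
    proof -
      have "f0 v \<in> {-1..1}" using f0 that by (rule PiE_mem)
      then show ?thesis by auto
    qed
    show "expected_time p (box_verts d L) (box_adj d L) (1/2) f0 \<le> ennreal (a * (U_bound p d L * ln (2 * real (L ^ d))))"
    proof (cases "p < 2")
      case True
      then show ?thesis using expected_time_upper_lt2[OF True bd] by (simp add: a_def)
    next
      case False
      then have "2 \<le> p" by simp
      then show ?thesis using expected_time_upper_ge2[OF _ bd] False by (simp add: a_def)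
    qed
  qed
  ultimately show ?thesis by blast
qed

lemma ennreal_max_le:
  assumes "ennreal (b1 * (n * x)) \<le> w" "ennreal (b2 * (n * y)) \<le> w" "0 \<le> n" "0 \<le> x" "0 \<le> y"
  shows "ennreal (min b1 b2 * (n * max x y)) \<le> w"
proof (cases "x \<le> y")
  case True
  have "min b1 b2 * (n * max x y) \<le> b2 * (n * y)" using True assms by (auto intro!: mult_right_mono)
  then show ?thesis using assms(2) ennreal_leI order.trans by blast
next
  case False
  have "min b1 b2 * (n * max x y) \<le> b1 * (n * x)" using False assms by (auto intro!: mult_right_mono)
  then show ?thesis using assms(1) ennreal_leI order.trans by blast
qed

lemma worst_lower:
  assumes "1 < p"
  shows "\<exists>b>0. \<forall>d L. 2 \<le> d \<longrightarrow> 2 \<le> L \<longrightarrow> ennreal (b * Low_bound p d L) \<le> worst_expected_time p (1/2) d L"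
proof -
  define b where "b = (if p < 2 then min ((1/8) powr (1 / (p - 1)) / (192 * exp 1)) (1/4)
      else if p = 2 then 1 / (24 * pi\<^sup>2) else min (1/4) (1 / (48 * exp 1 * pi\<^sup>2)))"
  have "0 < b" using pi_gt_zero by (auto simp: b_def)
  moreover have "ennreal (b * Low_bound p d L) \<le> worst_expected_time p (1/2) d L" if "2 \<le> d" "2 \<le> L" for d L
  proof -
    interpret box_dynamics d L p by unfold_locales (use that assms in auto)
    have ln0: "0 \<le> real d * ln (real L)" using that by simp
    consider "p < 2" | "p = 2" | "2 < p" by linarith
    then show ?thesis
    proof cases
      case 1
      have "ennreal (min ((1/8) powr (1 / (p - 1)) / (192 * exp 1)) (1/4)
         * (real (L ^ d) * max (real d powr (1 / (p - 1) - 1) * real L powr (p / (p - 1))) (real d * ln (real L))))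
          \<le> worst_expected_time p (1/2) d L"
        by (rule ennreal_max_le[OF worst_ge_flux worst_ge_coupon _ _ ln0]) auto
      then show ?thesis using 1 by (simp only: b_def Low_bound_def if_True)
    next
      case 2
      then show ?thesis using worst_ge_wave(2)[OF 2] by (simp add: b_def Low_bound_def)
    next
      case 3
      have "ennreal (min (1/4) (1 / (48 * exp 1 * pi\<^sup>2))
         * (real (L ^ d) * max (real d * ln (real L)) ((real L)\<^sup>2))) \<le> worst_expected_time p (1/2) d L"
        by (rule ennreal_max_le[OF worst_ge_coupon worst_ge_wave(1) _ ln0]) auto
      moreover have "\<not> p < 2" "p \<noteq> 2" using 3 by auto
      ultimately show ?thesis by (simp only: b_def Low_bound_def if_False)
    qed
  qed
  ultimately show ?thesis by blast
qed

lemma U_bound_div_d_lt2: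
  assumes "p < 2" "0 < d"
  shows "real (L ^ d) * real d powr (1 / (p - 1) - 1) * real L powr (p / (p - 1)) = U_bound p d L / real d"
  using assms by (simp add: U_bound_def powr_diff)

lemma U_bound_div_d_gt2:
  assumes "2 < p" "0 < d"
  shows "real (L ^ d) * real L ^ 2 = U_bound p d L / real d"
  using assms by (simp add: U_bound_def)

text \<open>For \<open>p \<noteq> 2\<close> the quotient \<open>U / d\<close> is one of the two terms in the maximum; for \<open>p = 2\<close> both bounds agree and the factor
\<open>d\<close> is given away.\<close>

lemma Low_bound_ge:
  assumes "0 < d"
  shows "U_bound p d L / real d \<le> Low_bound p d L"
proof -
  consider "p < 2" | "p = 2" | "2 < p" by linarith
  then show ?thesis
  proof cases
    case 1
    show ?thesis
      unfolding U_bound_div_d_lt2[OF 1 assms, symmetric] Low_bound_def mult.assoc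
      using 1 by (auto intro!: mult_left_mono)
  next
    case 2
    have "1 \<le> real d" using assms by simp
    then have "real (L ^ d) * real d * real L ^ 2 / real d \<le> real (L ^ d) * real d * real L ^ 2 / 1"
      by (intro divide_left_mono) auto
    then show ?thesis using 2 by (simp add: U_bound_def Low_bound_def mult.assoc)
  next
    case 3
    show ?thesis
      unfolding U_bound_div_d_gt2[OF 3 assms, symmetric] Low_bound_def
      using 3 by (auto intro!: mult_left_mono)
  qed
qed

lemma U_bound_2_eq_Low: "U_bound 2 d L = Low_bound 2 d L"
  by (simp add: U_bound_def Low_bound_def)

lemma U_bound_pos: "0 < d \<Longrightarrow> 0 < L \<Longrightarrow> 0 < U_bound p d L"
  by (simp add: U_bound_def)

lemma log_n_bounds:
  assumes "2 \<le> d" "2 \<le> L"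
  shows "real d \<le> 2 * ln (real (L ^ d))" "ln (2 * real (L ^ d)) \<le> 2 * ln (real (L ^ d))"
    "ln (exp 1 * real (L ^ d)) = 1 + ln (real (L ^ d))"
proof -
  have "1/2 \<le> ln (2::real)" using ln2_ge_two_thirds by simp
  also have "ln 2 \<le> ln (real L)" using assms by (intro ln_mono) auto
  finally have "real d * (1/2) \<le> real d * ln (real L)" by (intro mult_left_mono) auto
  also have "real d * ln (real L) = ln (real (L ^ d))" using assms by (simp add: ln_realpow)
  finally show "real d \<le> 2 * ln (real (L ^ d))" by simp
  have "L ^ 1 \<le> L ^ d" using assms by (intro power_increasing) auto
  then have "2 \<le> real (L ^ d)" using assms by (simp flip: of_nat_power)
  then have "ln (2 * real (L ^ d)) \<le> ln (real (L ^ d) * real (L ^ d))"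
    using assms by (intro ln_mono mult_right_mono) auto
  also have "\<dots> = 2 * ln (real (L ^ d))" using assms by (subst ln_mult) auto
  finally show "ln (2 * real (L ^ d)) \<le> 2 * ln (real (L ^ d))" .
  show "ln (exp 1 * real (L ^ d)) = 1 + ln (real (L ^ d))" using assms by (subst ln_mult) auto
qed

theorem corollary6p4:
  fixes p :: real
  assumes "1 < p"
  shows "\<exists>c C a b :: real. 0 < c \<and> 0 < C \<and> 0 < a \<and> 0 < b \<and>
    (\<forall>d L n :: nat. 2 \<le> d \<longrightarrow> 2 \<le> L \<longrightarrow> n = L ^ d \<longrightarrow>
      worst_expected_time p (1/2) d L
        \<ge> ennreal (c * (if p \<noteq> 2 then U_bound p d L / ln (exp 1 * real n) else U_bound 2 d L)) \<and>
      worst_expected_time p (1/2) d L \<le> ennreal (a * (U_bound p d L * ln (2 * real n))) \<and>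
      worst_expected_time p (1/2) d L \<ge> ennreal (b * Low_bound p d L) \<and>
      U_bound p d L * ln (2 * real n) / Low_bound p d L
        \<le> C * (if p \<noteq> 2 then (ln (real n))\<^sup>2 else ln (real n)) \<and>
      (p < 2 \<longrightarrow> real n * real d powr (1 / (p - 1) - 1) * real L powr (p / (p - 1))
                   = U_bound p d L / real d) \<and>
      (2 < p \<longrightarrow> real n * real L ^ 2 = U_bound p d L / real d))"
proof -
  obtain a where a: "0 < a" and upper: "\<And>d L. 2 \<le> d \<Longrightarrow> 2 \<le> L \<Longrightarrow>
      worst_expected_time p (1/2) d L \<le> ennreal (a * (U_bound p d L * ln (2 * real (L ^ d))))"
    using worst_upper[OF assms] by blast
  obtain b where b: "0 < b" and lower: "\<And>d L. 2 \<le> d \<Longrightarrow> 2 \<le> L \<Longrightarrow>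
      ennreal (b * Low_bound p d L) \<le> worst_expected_time p (1/2) d L"
    using worst_lower[OF assms] by blast
  show ?thesis
  proof (rule exI[of _ "b / 2"], rule exI[of _ 4], rule exI[of _ a], rule exI[of _ b],
      intro conjI allI impI)
    show "0 < b / 2" "0 < (4::real)" "0 < a" "0 < b" using a b by auto
    fix d L n :: nat
    assume dL: "2 \<le> d" "2 \<le> L" and n: "n = L ^ d"
    let ?U = "U_bound p d L" and ?Low = "Low_bound p d L" and ?l = "ln (real n)"
    have d0: "0 < d" and U0: "0 < ?U" using dL U_bound_pos by auto
    have Low_ge: "?U / real d \<le> ?Low" by (rule Low_bound_ge[OF d0])
    have "0 < ?U / real d" using U0 d0 by simp
    with Low_ge have Low0: "0 < ?Low" by linarith
    have d_le: "real d \<le> 2 * ?l" and ln2n: "ln (2 * real n) \<le> 2 * ?l"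
      and lnen: "ln (exp 1 * real n) = 1 + ?l"
      unfolding n using log_n_bounds[OF dL] by auto
    show "worst_expected_time p (1/2) d L \<le> ennreal (a * (?U * ln (2 * real n)))"
      unfolding n by (rule upper[OF dL])
    show low: "ennreal (b * ?Low) \<le> worst_expected_time p (1/2) d L" by (rule lower[OF dL])
    have "(if p \<noteq> 2 then ?U / ln (exp 1 * real n) else U_bound 2 d L) \<le> 2 * ?Low"
    proof (cases "p = 2")
      case True
      then show ?thesis using Low0 U_bound_2_eq_Low[of d L] by simp
    next
      case False
      have "?U / ln (exp 1 * real n) \<le> ?U / (real d / 2)"
        using d_le U0 d0 by (intro divide_left_mono) (auto simp: lnen)
      also have "\<dots> = 2 * (?U / real d)" by simp
      also have "\<dots> \<le> 2 * ?Low" using Low_ge by simp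
      finally show ?thesis using False by simp
    qed
    then have "b / 2 * (if p \<noteq> 2 then ?U / ln (exp 1 * real n) else U_bound 2 d L) \<le> b / 2 * (2 * ?Low)"
      using b by (intro mult_left_mono) auto
    also have "\<dots> = b * ?Low" by simp
    finally show "ennreal (b / 2 * (if p \<noteq> 2 then ?U / ln (exp 1 * real n) else U_bound 2 d L))
        \<le> worst_expected_time p (1/2) d L"
      using low ennreal_leI order.trans by blast
    show "?U * ln (2 * real n) / ?Low \<le> 4 * (if p \<noteq> 2 then ?l\<^sup>2 else ?l)"
    proof (cases "p = 2")
      case True
      then have "?U * ln (2 * real n) / ?Low = ln (2 * real n)" using Low0 U_bound_2_eq_Low[of d L] by simp
      then show ?thesis using True ln2n d_le by simp
    next
      case False
      have "0 < n" using dL by (simp add: n)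
      then have l0: "0 \<le> ln (2 * real n)" by simp
      have "?U \<le> real d * ?Low" using Low_ge d0 by (simp add: field_simps)
      then have "?U * ln (2 * real n) \<le> real d * ?Low * ln (2 * real n)"
        using l0 by (intro mult_right_mono)
      then have "?U * ln (2 * real n) / ?Low \<le> real d * ln (2 * real n)"
        using Low0 by (simp add: field_simps)
      also have "\<dots> \<le> (2 * ?l) * (2 * ?l)" using d_le ln2n l0 by (intro mult_mono) auto
      finally show ?thesis using False by (simp add: power2_eq_square)
    qed
    show "p < 2 \<Longrightarrow> real n * real d powr (1 / (p - 1) - 1) * real L powr (p / (p - 1)) = ?U / real d"
      unfolding n by (rule U_bound_div_d_lt2[OF _ d0])
    show "2 < p \<Longrightarrow> real n * real L ^ 2 = ?U / real d"
      unfolding n by (rule U_bound_div_d_gt2[OF _ d0])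
  qed
qed

end
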